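(* Let $3\le N\le 9$ and let $a:[0,1]\to\mathbb{R}$ be such that $x\mapsto a(|x|)$ belongs to $C^2(\overline{B_1})$, $a(r)>0$ on $[0,1]$, and $a(0)=1$. Then the bifurcation diagram of radial solutions of $$-\Delta u=\lambda a(|x|)e^{u}\ \text{ in } B_1,\qquad u>0\ \text{ in } B_1,\qquad u=0\ \text{ on }\partial B_1 \tag{P}$$ is of Type I.
   Context: $B_1\subset\mathbb{R}^N$ is the open unit ball, and $\lambda>0$ is a parameter. Radial functions are identified with functions of $r=|x|$, and then $\Delta=\frac{d^2}{dr^2}+\frac{N-1}{r}\frac{d}{dr}$. For $\beta\in\mathbb{R}$, $v(\cdot,\beta)$ denotes the solution on $[0,1]$ of $-\Delta v=a(r)e^{v}$, $v(0,\beta)=\beta$, $\frac{d}{dr}v(0,\beta)=0$. Put $\lambda(\beta):=e^{v(1,\beta)}$, $u_\beta(r):=v(r,\beta)-\log\lambda(\beta)$, $\alpha(\beta):=\beta-\log\lambda(\beta)=\lVert u_\beta\rVert_{L^\infty(B_1)}$. The pairs $(\lambda(\beta),u_\beta)$, $\beta\in\mathbb{R}$, are exactly the classical radial solutions of (P), and $\mathcal{C}:=\{(\lambda(\beta),\alpha(\beta));\beta\in\mathbb{R}\}$ is called the bifurcation curve. A point $(\lambda(\beta),\alpha(\beta))$ is a turning point if the function $\lambda(\cdot)$ has a local minimum or a local maximum at $\beta$. Type I: the curve turns infinitely many times around some value $\lambda_*$, i.e. there is $\lambda_*>0$ such that $\lambda(\beta)\to\lambda_*$ as $\beta\to\infty$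 and $\lambda(\beta)-\lambda_*$ changes sign infinitely many times as $\beta\to\infty$ (for every $\beta_0$ there are $\beta,\beta'>\beta_0$ with $\lambda(\beta)<\lambda_*<\lambda(\beta')$); in particular $\mathcal{C}$ has infinitely many turning points. *)

theory Defs
  imports "HOL-Analysis.Analysis"
begin

text \<open>
  The class \<open>C\<^sup>2\<close> on the closure of an open set \<open>S\<close>: \<open>f\<close> is \<open>C\<^sup>2\<close> in \<open>S\<close>, and \<open>f\<close>, its gradient \<open>g\<close>
  and its Hessian \<open>H\<close> extend continuously up to the boundary.
\<close>

definition C2_on_closure :: "(real ^ 'n \<Rightarrow> real) \<Rightarrow> (real ^ 'n) set \<Rightarrow> bool" where
  "C2_on_closure f S \<longleftrightarrow>
     (\<exists>(g :: real ^ 'n \<Rightarrow> real ^ 'n) (H :: real ^ 'n \<Rightarrow> real ^ 'n ^ 'n).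
        continuous_on (closure S) f \<and> continuous_on (closure S) g \<and> continuous_on (closure S) H \<and>
        (\<forall>x\<in>S. (f has_derivative (\<lambda>h. g x \<bullet> h)) (at x)) \<and>
        (\<forall>x\<in>S. (g has_derivative (\<lambda>h. H x *v h)) (at x)))"

text \<open>
  \<open>v \<in> C\<^sup>2[0,1]\<close> solves \<open>- \<Delta> v = a(r) e\<^sup>v\<close>, \<open>v(0) = \<beta>\<close>, \<open>v'(0) = 0\<close>, where \<open>\<Delta>\<close> is the radial Laplacian
  in dimension \<open>N\<close>; derivatives at the endpoints are one-sided. The equation is imposed for \<open>r > 0\<close>
  only, as its coefficient is singular at \<open>0\<close>.
\<close>

definition radial_ivp_solution :: "nat \<Rightarrow> (real \<Rightarrow> real) \<Rightarrow> real \<Rightarrow> (real \<Rightarrow> real) \<Rightarrow> bool" where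
  "radial_ivp_solution N a \<beta> v \<longleftrightarrow>
     (\<exists>v' v''.
        (\<forall>r\<in>{0..1}. (v has_real_derivative v' r) (at r within {0..1})) \<and>
        (\<forall>r\<in>{0..1}. (v' has_real_derivative v'' r) (at r within {0..1})) \<and>
        continuous_on {0..1} v'' \<and>
        (\<forall>r\<in>{0<..1}. - (v'' r + (real N - 1) / r * v' r) = a r * exp (v r)) \<and>
        v 0 = \<beta> \<and> v' 0 = 0)"

text \<open>The solution is unique only as a function on \<open>[0,1]\<close>, hence the normalisation outside.\<close>

definition radial_v :: "nat \<Rightarrow> (real \<Rightarrow> real) \<Rightarrow> real \<Rightarrow> real \<Rightarrow> real" where
  "radial_v N a \<beta> = (THE v. v \<in> extensional {0..1} \<and> radial_ivp_solution N a \<beta> v)"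

definition bif_lambda :: "nat \<Rightarrow> (real \<Rightarrow> real) \<Rightarrow> real \<Rightarrow> real" where
  "bif_lambda N a \<beta> = exp (radial_v N a \<beta> 1)"

text \<open>
  The function \<open>u\<^sub>\<beta> = v(\<cdot>,\<beta>) - log \<lambda>(\<beta>)\<close> is the radial solution with parameter \<open>\<lambda>(\<beta>)\<close>; it is
  decreasing in \<open>r\<close>, so its sup norm is \<open>u\<^sub>\<beta>(0) = \<beta> - log \<lambda>(\<beta>)\<close>.
\<close>

definition bif_alpha :: "nat \<Rightarrow> (real \<Rightarrow> real) \<Rightarrow> real \<Rightarrow> real" where
  "bif_alpha N a \<beta> = \<beta> - ln (bif_lambda N a \<beta>)"

definition bif_point :: "nat \<Rightarrow> (real \<Rightarrow> real) \<Rightarrow> real \<Rightarrow> real \<times> real" where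
  "bif_point N a \<beta> = (bif_lambda N a \<beta>, bif_alpha N a \<beta>)"

definition local_extremum_at :: "(real \<Rightarrow> real) \<Rightarrow> real \<Rightarrow> bool" where
  "local_extremum_at f \<beta> \<longleftrightarrow>
     (\<forall>\<^sub>F \<gamma> in nhds \<beta>. f \<beta> \<le> f \<gamma>) \<or> (\<forall>\<^sub>F \<gamma> in nhds \<beta>. f \<gamma> \<le> f \<beta>)"

definition turning_points :: "nat \<Rightarrow> (real \<Rightarrow> real) \<Rightarrow> (real \<times> real) set" where
  "turning_points N a = {bif_point N a \<beta> | \<beta>. local_extremum_at (bif_lambda N a) \<beta>}"

text \<open>
  The last conjunct is not independent: it follows from the others, because \<open>\<lambda>(\<cdot>)\<close> is continuous.
\<close>

definition type_I :: "nat \<Rightarrow> (real \<Rightarrow> real) \<Rightarrow> bool" where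
  "type_I N a \<longleftrightarrow>
     (\<exists>L>0. (bif_lambda N a \<longlongrightarrow> L) at_top \<and>
        (\<forall>\<beta>\<^sub>0. \<exists>\<beta>>\<beta>\<^sub>0. \<exists>\<beta>'>\<beta>\<^sub>0. bif_lambda N a \<beta> < L \<and> L < bif_lambda N a \<beta>')) \<and>
     infinite (turning_points N a)"

end

theory Submission
  imports Defs
begin

text \<open>
  In the variable \<open>t = ln r\<close> the function \<open>w = v + 2t - ln (2m)\<close>, \<open>m = N - 2\<close>, solves the damped equation
  \<open>w'' + m w' + 2m (a(e\<^sup>t) e\<^sup>w - 1) = 0\<close>, which is an exponentially small perturbation of an autonomous
  one as \<open>t \<rightarrow> -\<infinity>\<close>. A strict Lyapunov function shows, uniformly in \<open>\<beta> \<ge> 0\<close>, that \<open>(w, w')\<close> is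
  \<open>O(e\<^bsup>-\<kappa>(t + \<beta>/2)\<^esup> + e\<^bsup>\<kappa>t\<^esup>)\<close> on \<open>[-\<beta>/2, 0]\<close>. The difference \<open>z\<close> of two solutions therefore solves
  \<open>z'' + m z' + 2m z = 0\<close> up to an error that is integrable in \<open>t\<close>, uniformly in \<open>\<beta>\<close>. Hence
  differences decay exponentially, the solutions converge as \<open>\<beta> \<rightarrow> \<infinity>\<close> to a singular solution \<open>w\<^sup>*\<close>, and
  \<open>\<lambda>(\<beta>) = 2m e\<^bsup>w(0,\<beta>)\<^esup>\<close> converges. Since \<open>0 < m < 8\<close> the linear equation is a spiral: the phase of
  \<open>(z', z)\<close> for \<open>z = w(\<cdot>,\<beta>) - w\<^sup>*\<close> starts in a fixed half plane at \<open>t = -\<beta>/2\<close>, advances by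
  \<open>\<omega>\<beta>/2 + O(1)\<close> up to \<open>t = 0\<close>, and depends continuously on \<open>\<beta>\<close>. So \<open>w(0,\<beta>) - w\<^sup>*(0)\<close> changes sign infinitely
  often, and between consecutive sign changes \<open>\<lambda>\<close> has extrema.
\<close>

section \<open>Radial averages and a weighted fixed point theorem\<close>

text \<open>As \<open>t\<close> tends to minus infinity a regular solution behaves like
  \<open>\<beta> + 2t - ln (2m)\<close>, far from the equilibrium 0, so no estimate uniform in
  \<beta> can start there. At \<open>t = -\<beta>/2\<close>, where
  \<open>r^2 exp \<beta> = 1\<close>, the pair (w, w') lies in a fixed compact set; hence every
  estimate starts at that time. Nor is there smallness at the other end: near \<open>t = 0\<close>
  the weight \<open>a\<close> may be far from 1. What survives is that the error in the equation of
  a difference \<open>z\<close> is at most b(t) |z|, where b is the sum of a transient decaying away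
  from -\<beta>/2 and a term decaying away from 0. Being proportional to |z|, the error changes the
  logarithm of the radius of the spiral and its angle by O(1) only: the radius cannot vanish, and
  the linear growth of the angle wins. The singular solution is the common centre because it tends
  to 0 as \<open>t\<close> tends to minus infinity, whereas
  \<open>w(-\<beta>/2) \<le> -ln (2m)\<close>. For large \<beta> the spirals therefore start in the
  lower half plane, where the principal logarithm gives an initial angle that is continuous in
  \<beta>.\<close>

lemma weighted_contraction_fixpoint:
  fixes \<Phi> :: "(real \<Rightarrow> real) \<Rightarrow> real \<Rightarrow> real"
  assumes cont: "\<And>u. continuous_on {0..1} u \<Longrightarrow> continuous_on {0..1} (\<Phi> u)"
    and contr: "\<And>u v D r. \<lbrakk>continuous_on {0..1} u; continuous_on {0..1} v;
        \<And>s. s \<in> {0..1} \<Longrightarrow> \<bar>u s - v s\<bar> \<le> D * exp (k * s); r \<in> {0..1}\<rbrakk>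
        \<Longrightarrow> \<bar>\<Phi> u r - \<Phi> v r\<bar> \<le> D / 2 * exp (k * r)"
    and k: "0 \<le> k"
  shows "\<exists>u. continuous_on {0..1} u \<and> (\<forall>r\<in>{0..1}. u r = \<Phi> u r)"
proof -
  define U where "U n = (\<Phi> ^^ n) (\<lambda>_. 0)" for n
  have U0: "U 0 r = 0" and US: "U (Suc n) = \<Phi> (U n)" for n r by (simp_all add: U_def)
  have contU: "continuous_on {0..1} (U n)" for n
    by (induction n) (simp_all add: US cont, simp add: U_def)
  obtain D where D: "\<And>r. r \<in> {0..1} \<Longrightarrow> \<bar>U 1 r\<bar> \<le> D" "0 \<le> D"
  proof -
    have "compact (U 1 ` {0..1})" using contU compact_continuous_image by blast
    then obtain B where "\<forall>x\<in>U 1 ` {0..1}. norm x \<le> B" using compact_imp_bounded bounded_iff by metis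
    then show ?thesis using that[of "max B 0"] by force
  qed
  \<comment> \<open>In the norm sup |u(r)| exp (-k r) the map \<open>\<Phi>\<close> is a contraction
    with factor 1/2; this is Picard iteration in that norm.\<close>
  have step: "\<bar>U (Suc n) r - U n r\<bar> \<le> D * (1/2) ^ n * exp (k * r)" if "r \<in> {0..1}" for n r
    using that
  proof (induction n arbitrary: r)
    case 0
    have "D \<le> D * exp (k * r)" using D(2) k 0 by (simp add: mult_le_cancel_left1)
    then show ?case using D(1)[OF 0] by (simp add: U0)
  next
    case (Suc n)
    from contr[OF contU[of "Suc n"] contU[of n] Suc.IH Suc.prems]
    show ?case unfolding US[of "Suc n"] US[of n] by simp
  qed
  have M: "norm (U (Suc n) r - U n r) \<le> D * exp k * (1/2) ^ n" if "r \<in> {0..1}" for n r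
  proof -
    have "exp (k * r) \<le> exp k" using k that by (simp add: mult_left_le)
    then have "D * (1/2) ^ n * exp (k * r) \<le> D * (1/2) ^ n * exp k"
      using D(2) by (intro mult_left_mono) auto
    then show ?thesis using step[OF that, of n] by (simp add: mult_ac)
  qed
  have "summable (\<lambda>n. D * exp k * (1/2) ^ n)"
    by (intro summable_mult summable_geometric) simp
  from Weierstrass_m_test[of "{0..1}" "\<lambda>n r. U (Suc n) r - U n r", OF M this] obtain u where "uniform_limit {0..1} (\<lambda>n r. \<Sum>i<n. U (Suc i) r - U i r) u sequentially"
    by blast
  moreover have "(\<lambda>n r. \<Sum>i<n. U (Suc i) r - U i r) = U"
    using sum_lessThan_telescope[of "\<lambda>i. U i _"] by (intro ext) (simp add: U0)
  ultimately have lim: "uniform_limit {0..1} U u sequentially" by simp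
  have contu: "continuous_on {0..1} u"
    using uniform_limit_theorem[OF _ lim] contU by simp
  have "u r = \<Phi> u r" if r: "r \<in> {0..1}" for r
  proof -
    have "(\<lambda>n. U (Suc n) r) \<longlonglongrightarrow> \<Phi> u r"
    proof (rule LIMSEQ_I)
      fix e :: real assume e: "e > 0"
      then have "e / exp k > 0" by simp
      then have "\<forall>\<^sub>F n in sequentially. \<forall>s\<in>{0..1}. dist (U n s) (u s) < e / exp k"
        using uniform_limitD[OF lim] by blast
      then obtain n0 where n0: "\<And>n s. n \<ge> n0 \<Longrightarrow> s \<in> {0..1} \<Longrightarrow> \<bar>U n s - u s\<bar> < e / exp k"
        unfolding eventually_sequentially dist_real_def by blast
      have "norm (U (Suc n) r - \<Phi> u r) < e" if n: "n \<ge> n0" for n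
      proof -
        \<comment> \<open>The weight lies between 1 and \<open>exp k\<close> on the unit interval,
          so uniform closeness is closeness in the weighted norm.\<close>
        have "\<bar>U n s - u s\<bar> \<le> e / exp k * exp (k * s)" if s: "s \<in> {0..1}" for s
        proof -
          have "e / exp k * 1 \<le> e / exp k * exp (k * s)"
            using e k s by (intro mult_left_mono) auto
          then show ?thesis using n0[OF n s] by linarith
        qed
        from contr[OF contU contu this r]
        have "\<bar>U (Suc n) r - \<Phi> u r\<bar> \<le> e / exp k / 2 * exp (k * r)" by (simp add: US)
        also have "\<dots> \<le> e / exp k / 2 * exp k"
          using e k r by (intro mult_left_mono) (auto simp: mult_left_le)
        also have "\<dots> < e" using e by simp
        finally show ?thesis by simp
      qed
      then show "\<exists>n0. \<forall>n\<ge>n0. norm (U (Suc n) r - \<Phi> u r) < e" by blast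
    qed
    moreover have "(\<lambda>n. U (Suc n) r) \<longlonglongrightarrow> u r"
      using tendsto_uniform_limitI[OF lim r] LIMSEQ_Suc by blast
    ultimately show ?thesis using LIMSEQ_unique by blast
  qed
  with contu show ?thesis by blast
qed

text \<open>By compactness the weighted supremum D of \<open>d\<close> is attained. The assumption
  at the point of attainment bounds D there by \<open>\<delta>\<close> plus half of itself, and the
  half is absorbed. With \<open>\<delta> = 0\<close> this is a uniqueness statement.\<close>

lemma weighted_contraction_stability:
  fixes d :: "real \<Rightarrow> real"
  assumes d: "continuous_on {0..1} d" and k: "0 \<le> k" and \<delta>: "0 \<le> \<delta>"
    and contr: "\<And>D r. \<lbrakk>\<And>s. s \<in> {0..1} \<Longrightarrow> \<bar>d s\<bar> \<le> D * exp (k * s); r \<in> {0..1}\<rbrakk>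
        \<Longrightarrow> \<bar>d r\<bar> \<le> \<delta> + D / 2 * exp (k * r)"
    and r: "r \<in> {0..1}"
  shows "\<bar>d r\<bar> \<le> 2 * \<delta> * exp k"
proof -
  have c: "continuous_on {0..1} (\<lambda>s. \<bar>d s\<bar> * exp (- k * s))"
    by (intro continuous_intros d)
  have "\<exists>x\<in>{0..1}. \<forall>y\<in>{0..1}. \<bar>d y\<bar> * exp (- k * y) \<le> \<bar>d x\<bar> * exp (- k * x)"
    by (rule continuous_attains_sup[OF compact_Icc _ c]) simp
  then obtain r0 where r0: "r0 \<in> {0..1}"
    "\<And>s. s \<in> {0..1} \<Longrightarrow> \<bar>d s\<bar> * exp (- k * s) \<le> \<bar>d r0\<bar> * exp (- k * r0)"
    by blast
  define D where "D = \<bar>d r0\<bar> * exp (- k * r0)"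
  have le: "\<bar>d s\<bar> \<le> D * exp (k * s)" if "s \<in> {0..1}" for s
    using r0(2)[OF that] by (simp add: D_def exp_minus field_simps)
  have "D * exp (k * r0) \<le> \<delta> + D / 2 * exp (k * r0)"
    using contr[OF le r0(1)] by (simp add: D_def exp_minus field_simps)
  then have "D / 2 * exp (k * r0) \<le> \<delta>" by (simp add: field_simps)
  moreover have "D / 2 * 1 \<le> D / 2 * exp (k * r0)"
    using k r0(1) by (intro mult_left_mono) (auto simp: D_def)
  ultimately have "D \<le> 2 * \<delta>" by linarith
  then have "D * exp (k * r) \<le> 2 * \<delta> * exp k"
    using k r \<delta> by (intro mult_mono) (auto simp: mult_left_le)
  with le[OF r] show ?thesis by linarith
qed

text \<open>For r > 0 this is the integral of s^n h(s) over [0,r] divided by r^(n+1). The form over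
  the fixed interval [0,1] is meaningful and continuous also at r = 0. With n = N - 1,
  \<open>r * radial_avg n h r\<close> is minus the derivative of a radial solution of -\<Delta>v =
  h, so \<open>radial_int\<close> below inverts -\<Delta> up to sign and an additive
  constant.\<close>

definition radial_avg :: "nat \<Rightarrow> (real \<Rightarrow> real) \<Rightarrow> real \<Rightarrow> real" where
  "radial_avg n h r = integral {0..1} (\<lambda>s. s ^ n * h (r * s))"

definition radial_int :: "nat \<Rightarrow> (real \<Rightarrow> real) \<Rightarrow> real \<Rightarrow> real" where
  "radial_int n h r = integral {0..r} (\<lambda>s. s * radial_avg n h s)"

section \<open>Continuity, bounds and derivatives of radial averages\<close>

lemma continuous_on_radial_avg_param:
  fixes h :: "'a::metric_space \<Rightarrow> real \<Rightarrow> real"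
  assumes "continuous_on (U \<times> {0..1}) (\<lambda>(x, r). h x r)"
  shows "continuous_on (U \<times> {0..1}) (\<lambda>(x, r). radial_avg n (h x) r)"
proof -
  have 1: "continuous_on ((U \<times> {0..1}) \<times> {0..1}) (\<lambda>p. (\<lambda>(x, r). h x r) (fst (fst p), snd (fst p) * snd p))"
    by (rule continuous_on_compose2[OF assms])
      (auto intro!: continuous_intros simp: mult_le_one)
  have "continuous_on ((U \<times> {0..1}) \<times> cbox 0 1) (\<lambda>(p, s). s ^ n * h (fst p) (snd p * s))"
    unfolding case_prod_beta using 1 by (auto intro!: continuous_intros)
  from integral_continuous_on_param[OF this]
  show ?thesis by (simp add: radial_avg_def case_prod_beta)
qed

lemma continuous_on_radial_avg:
  assumes "continuous_on {0..1} h"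
  shows "continuous_on {0..1} (radial_avg n h)"
proof -
  have "continuous_on (({0} :: real set) \<times> {0..1}) (\<lambda>(x, r). h r)"
    unfolding case_prod_beta by (rule continuous_on_compose2[OF assms]) (auto intro!: continuous_intros)
  then have "continuous_on ({0} \<times> {0..1}) (\<lambda>(x::real, r). radial_avg n h r)"
    by (rule continuous_on_radial_avg_param)
  from continuous_on_compose2[OF this, of "{0..1}" "\<lambda>r. (0, r)"]
  show ?thesis by (simp add: image_subset_iff continuous_on_Pair)
qed

lemma radial_avg_integrand_continuous:
  fixes h :: "real \<Rightarrow> real"
  assumes "continuous_on {0..1} h" "r \<in> {0..1}"
  shows "continuous_on {0..1} (\<lambda>s. s ^ n * h (r * s))"
  using assms by (auto intro!: continuous_intros continuous_on_compose2[OF assms(1)] simp: mult_le_one)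

lemma radial_avg_diff:
  assumes "continuous_on {0..1} g" "continuous_on {0..1} h" "r \<in> {0..1}"
  shows "radial_avg n (\<lambda>s. g s - h s) r = radial_avg n g r - radial_avg n h r"
  unfolding radial_avg_def
  by (subst integral_diff[symmetric])
    (simp_all only: right_diff_distrib integrable_continuous_real radial_avg_integrand_continuous assms)

lemma abs_radial_avg_le:
  assumes "continuous_on {0..1} h" "r \<in> {0..1}" "\<And>s. s \<in> {0..r} \<Longrightarrow> \<bar>h s\<bar> \<le> B"
  shows "\<bar>radial_avg n h r\<bar> \<le> B"
proof -
  have "norm (s ^ n * h (r * s)) \<le> B" if s: "s \<in> {0..1}" for s
  proof -
    have "r * s \<in> {0..r}" using s assms(2) by (auto simp: mult_left_le)
    then have b: "\<bar>h (r * s)\<bar> \<le> B" by (rule assms(3))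
    have "s ^ n * \<bar>h (r * s)\<bar> \<le> 1 * B" using s b by (intro mult_mono) (auto simp: power_le_one)
    then show ?thesis using s by (simp add: abs_mult)
  qed
  from integral_bound[OF _ radial_avg_integrand_continuous[OF assms(1,2)] this]
  show ?thesis by (simp add: radial_avg_def)
qed

lemma radial_avg_nonneg:
  assumes "\<And>s. s \<in> {0..r} \<Longrightarrow> 0 \<le> h s" "r \<in> {0..1}"
  shows "0 \<le> radial_avg n h r"
  unfolding radial_avg_def
proof (cases "(\<lambda>s. s ^ n * h (r * s)) integrable_on {0..1}")
  case True
  then show "0 \<le> integral {0..1} (\<lambda>s. s ^ n * h (r * s))"
  proof (rule integral_nonneg)
    fix s :: real assume "s \<in> {0..1}"
    with assms(2) have "r * s \<in> {0..r}" "0 \<le> s ^ n" by (auto simp: mult_left_le)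
    with assms(1) show "0 \<le> s ^ n * h (r * s)" by (intro mult_nonneg_nonneg)
  qed
qed (simp add: not_integrable_integral)

lemma radial_avg_0: "radial_avg n h 0 = h 0 / (real n + 1)"
proof -
  have "((\<lambda>s. s ^ Suc n / real (Suc n)) has_real_derivative x ^ n) (at x within {0..1})" for x
    by (rule derivative_eq_intros | simp)+
  then have "((\<lambda>s. s ^ n) has_integral (1 ^ Suc n / real (Suc n) - 0 ^ Suc n / real (Suc n))) {0..1::real}"
    using fundamental_theorem_of_calculus[of 0 1 "\<lambda>s. s ^ Suc n / real (Suc n)" "\<lambda>s. s ^ n"]
    by (simp add: has_real_derivative_iff_has_vector_derivative del: power_Suc)
  then have "integral {0..1} (\<lambda>s::real. s ^ n) = 1 / (real n + 1)"
    by (simp add: integral_unique add.commute)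
  then show ?thesis by (simp add: radial_avg_def)
qed

lemma radial_avg_eq:
  assumes "0 < r"
  shows "r ^ Suc n * radial_avg n h r = integral {0..r} (\<lambda>s. s ^ n * h s)"
proof -
  have "(\<lambda>x. x / r) ` {0..r} = {0..1}"
    using image_divide_atLeastAtMost[OF assms, of 0 r] assms by simp
  then have "integral {0..1} (\<lambda>s. (r * s) ^ n * h (r * s)) = (1 / r) * integral {0..r} (\<lambda>s. s ^ n * h s)"
    using integral_stretch_real[of r 0 r "\<lambda>s. s ^ n * h s"] assms by simp
  moreover have "integral {0..1} (\<lambda>s. (r * s) ^ n * h (r * s)) = r ^ n * radial_avg n h r"
    unfolding radial_avg_def by (subst integral_mult_right[symmetric]) (simp add: power_mult_distrib mult_ac)
  ultimately show ?thesis using assms by (simp add: field_simps)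
qed

lemma radial_int_has_derivative:
  assumes "continuous_on {0..1} h" "r \<in> {0..1}"
  shows "(radial_int n h has_real_derivative r * radial_avg n h r) (at r within {0..1})"
  unfolding radial_int_def
  by (rule integral_has_real_derivative[OF _ assms(2)]) (intro continuous_intros continuous_on_radial_avg assms(1))

text \<open>For r > 0 the function is the integral of s^n h(s) over [0,r] divided by r^n, and the
  quotient rule applies. At r = 0 the difference quotient is the average itself, with limit
  h(0)/(n+1) = h(0) - n h(0)/(n+1), so the two cases share one formula.\<close>

lemma radial_flux_has_derivative:
  assumes h: "continuous_on {0..1} h" and r: "r \<in> {0..1}"
  shows "((\<lambda>r. r * radial_avg n h r) has_real_derivative h r - real n * radial_avg n h r)
    (at r within {0..1})"
proof (cases "r = 0")
  case True
  have "h 0 - real n * (h 0 / (real n + 1)) = h 0 / (real n + 1)" by (simp add: field_simps)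
  moreover have "(radial_avg n h \<longlongrightarrow> radial_avg n h 0) (at 0 within {0..1})"
    using continuous_on_radial_avg[OF h, of n] by (auto simp: continuous_on_def)
  then have "((\<lambda>y. (y * radial_avg n h y - 0 * radial_avg n h 0) / (y - 0)) \<longlongrightarrow> radial_avg n h 0)
      (at 0 within {0..1})"
    by (rule Lim_transform_eventually) (auto simp: eventually_at_filter)
  ultimately show ?thesis using True by (simp add: has_field_derivative_iff radial_avg_0)
next
  case False
  then have r0: "0 < r" using r by simp
  have I: "((\<lambda>r. integral {0..r} (\<lambda>s. s ^ n * h s)) has_real_derivative r ^ n * h r) (at r within {0..1})"
    by (rule integral_has_real_derivative[OF _ r]) (intro continuous_intros h)
  have "((\<lambda>r. integral {0..r} (\<lambda>s. s ^ n * h s) / r ^ n) has_real_derivative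
      (r ^ n * h r * r ^ n - integral {0..r} (\<lambda>s. s ^ n * h s) * (real n * r ^ (n - 1))) / (r ^ n * r ^ n))
      (at r within {0..1})"
    by (rule derivative_eq_intros I | use r0 in simp)+
  also have "(r ^ n * h r * r ^ n - integral {0..r} (\<lambda>s. s ^ n * h s) * (real n * r ^ (n - 1))) / (r ^ n * r ^ n)
      = h r - real n * radial_avg n h r"
    unfolding radial_avg_eq[OF r0, symmetric] using r0 by (cases n) (simp_all add: field_simps)
  finally show ?thesis
  proof (rule has_field_derivative_transform_within[OF _ r0 r])
    fix x :: real assume "x \<in> {0..1}" "dist x r < r"
    then have "0 < x" by (auto simp: dist_real_def)
    then show "integral {0..x} (\<lambda>s. s ^ n * h s) / x ^ n = x * radial_avg n h x"
      by (simp flip: radial_avg_eq)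
  qed
qed

section \<open>The radial initial value problem\<close>

lemma exp_diff_le_exp_mult:
  fixes x y B :: real
  assumes "x \<le> B" "y \<le> B"
  shows "\<bar>exp x - exp y\<bar> \<le> exp B * \<bar>x - y\<bar>"
proof -
  have *: "exp y - exp x \<le> exp B * (y - x)" if "x \<le> y" "y \<le> B" for x y :: real
  proof -
    have "exp y - exp x = exp y * (1 - exp (x - y))" by (simp add: exp_diff right_diff_distrib)
    also have "\<dots> \<le> exp y * (y - x)"
    proof (rule mult_left_mono)
      show "1 - exp (x - y) \<le> y - x" using exp_ge_add_one_self[of "x - y"] by linarith
    qed simp
    also have "\<dots> \<le> exp B * (y - x)" using that by (intro mult_right_mono) auto
    finally show ?thesis .
  qed
  show ?thesis
  proof (cases "x \<le> y")
    case True
    then show ?thesis using *[OF True assms(2)] by simp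
  next
    case False
    then show ?thesis using *[of y x] assms(1) by simp
  qed
qed

lemma has_integral_of_derivative_unit_interval:
  fixes f g :: "real \<Rightarrow> real"
  assumes "\<And>s. s \<in> {0..1} \<Longrightarrow> (f has_real_derivative g s) (at s within {0..1})" "r \<in> {0..1}"
  shows "(g has_integral (f r - f 0)) {0..r}"
proof (rule fundamental_theorem_of_calculus[where f = f])
  fix s assume s: "s \<in> {0..r}"
  then have "s \<in> {0..1}" "{0..r} \<subseteq> {0..1}" using assms(2) by auto
  then have "(f has_real_derivative g s) (at s within {0..r})"
    using assms(1) DERIV_subset by blast
  then show "(f has_vector_derivative g s) (at s within {0..r})"
    by (simp add: has_real_derivative_iff_has_vector_derivative)
qed (use assms(2) in simp)

lemma radial_int_cong:
  assumes "\<And>s. s \<in> {0..r} \<Longrightarrow> g s = h s"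
  shows "radial_int n g r = radial_int n h r"
proof -
  have "radial_avg n g s = radial_avg n h s" if s: "s \<in> {0..r}" for s
    unfolding radial_avg_def
  proof (rule integral_cong)
    fix x :: real assume "x \<in> {0..1}"
    then have "s * x \<le> s * 1" "0 \<le> s * x" using s by (auto simp: mult_left_le)
    then have "s * x \<in> {0..r}" using s by simp
    then show "x ^ n * g (s * x) = x ^ n * h (s * x)" using assms by simp
  qed
  then show ?thesis unfolding radial_int_def by (intro integral_cong) simp
qed

lemma radial_int_nonneg:
  assumes h: "continuous_on {0..1} h" and nn: "\<And>s. s \<in> {0..1} \<Longrightarrow> 0 \<le> h s" and r: "r \<in> {0..1}"
  shows "0 \<le> radial_int n h r"
  unfolding radial_int_def
proof (rule integral_nonneg)
  show "(\<lambda>s. s * radial_avg n h s) integrable_on {0..r}"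
    using r by (intro integrable_continuous_real continuous_intros
        continuous_on_subset[OF continuous_on_radial_avg[OF h]]) auto
  show "0 \<le> s * radial_avg n h s" if "s \<in> {0..r}" for s
    using that r nn by (intro mult_nonneg_nonneg radial_avg_nonneg) auto
qed

text \<open>Averaging over [0,s] preserves the bound D exp (k s), because the weight increases; the
  outer integration then gains the factor 1/k. This gain makes the integral operator a contraction
  for large k.\<close>

lemma radial_int_diff_le:
  assumes g: "continuous_on {0..1} g" and h: "continuous_on {0..1} h"
    and D: "\<And>s. s \<in> {0..1} \<Longrightarrow> \<bar>g s - h s\<bar> \<le> D * exp (k * s)"
    and k: "0 < k" and r: "r \<in> {0..1}"
  shows "\<bar>radial_int n g r - radial_int n h r\<bar> \<le> D / k * exp (k * r)"
proof -
  have D0: "0 \<le> D" using D[of 0] by simp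
  have sub: "{0..r} \<subseteq> {0..1}" using r by auto
  have cont: "continuous_on {0..r} (\<lambda>s. s * radial_avg n f s)" if "continuous_on {0..1} f" for f
    by (intro continuous_intros continuous_on_subset[OF continuous_on_radial_avg[OF that] sub])
  have FTC: "((\<lambda>s. D * exp (k * s)) has_integral (D / k * exp (k * r) - D / k * exp (k * 0))) {0..r}"
  proof (rule fundamental_theorem_of_calculus)
    show "((\<lambda>s. D / k * exp (k * s)) has_vector_derivative D * exp (k * x)) (at x within {0..r})" for x
      unfolding has_real_derivative_iff_has_vector_derivative[symmetric]
      by (rule derivative_eq_intros | use k in simp)+
  qed (use r in simp)
  have le: "norm (s * radial_avg n g s - s * radial_avg n h s) \<le> D * exp (k * s)" if s: "s \<in> {0..r}" for s
  proof -
    have s1: "s \<in> {0..1}" using s r by auto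
    have "\<bar>radial_avg n (\<lambda>s. g s - h s) s\<bar> \<le> D * exp (k * s)"
    proof (rule abs_radial_avg_le[OF _ s1])
      fix x assume x: "x \<in> {0..s}"
      then have "D * exp (k * x) \<le> D * exp (k * s)" using k D0 by (intro mult_left_mono) auto
      then show "\<bar>g x - h x\<bar> \<le> D * exp (k * s)" using D[of x] x s1 by auto
    qed (intro continuous_intros g h)
    then have "s * \<bar>radial_avg n g s - radial_avg n h s\<bar> \<le> 1 * (D * exp (k * s))"
      using s1 by (intro mult_mono) (auto simp: radial_avg_diff[OF g h s1])
    then show ?thesis using s1 by (simp add: right_diff_distrib[symmetric] abs_mult)
  qed
  have "\<bar>radial_int n g r - radial_int n h r\<bar>
      = norm (integral {0..r} (\<lambda>s. s * radial_avg n g s - s * radial_avg n h s))"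
    unfolding radial_int_def by (subst integral_diff) (auto intro!: integrable_continuous_real cont g h)
  also have "\<dots> \<le> integral {0..r} (\<lambda>s. D * exp (k * s))"
    using FTC by (intro integral_norm_bound_integral integrable_diff integrable_continuous_real cont g h le)
      (auto intro!: continuous_intros)
  also have "\<dots> \<le> D / k * exp (k * r)" using integral_unique[OF FTC] D0 k by simp
  finally show ?thesis .
qed

text \<open>All constants in the estimates are built from N and the bounds \<open>a0\<close>,
  \<open>A\<close>, \<open>A1\<close>. The derivative is required at interior radii only, which
  correspond to t < 0 in the logarithmic variable.\<close>

locale gelfand =
  fixes N :: nat and a a' :: "real \<Rightarrow> real" and A a0 A1 :: real
  assumes N: "3 \<le> N" "N \<le> 9"
    and a_cont: "continuous_on {0..1} a"
    and a_deriv: "\<And>r. \<lbrakk>0 < r; r < 1\<rbrakk> \<Longrightarrow> (a has_real_derivative a' r) (at r)"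
    and a'_bound: "\<And>r. \<lbrakk>0 < r; r < 1\<rbrakk> \<Longrightarrow> \<bar>a' r\<bar> \<le> A1"
    and a_lower: "\<And>r. r \<in> {0..1} \<Longrightarrow> a0 \<le> a r"
    and a_upper: "\<And>r. r \<in> {0..1} \<Longrightarrow> a r \<le> A"
    and a0_pos: "0 < a0"
    and a_0: "a 0 = 1"
begin

lemma a0_le: "a0 \<le> 1" and A_ge: "1 \<le> A"
  using a_lower[of 0] a_upper[of 0] a_0 by auto

lemma a_nonneg: "r \<in> {0..1} \<Longrightarrow> 0 \<le> a r"
  using a_lower a0_pos by fastforce

lemma A1_nonneg: "0 \<le> A1"
  using a'_bound[of "1/2"] by simp

text \<open>In divergence form the equation says that the derivative of s^(N-1) v' is -s^(N-1) a exp
  v. Integrating from 0 determines v', and integrating again gives the integral equation.\<close>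

lemma radial_ivp_solution_integral:
  assumes "radial_ivp_solution N a \<beta> v"
  shows "continuous_on {0..1} v"
    and "r \<in> {0..1} \<Longrightarrow> v r = \<beta> - radial_int (N - 1) (\<lambda>s. a s * exp (v s)) r"
proof -
  obtain v' v'' where v: "\<And>r. r \<in> {0..1} \<Longrightarrow> (v has_real_derivative v' r) (at r within {0..1})"
    and v': "\<And>r. r \<in> {0..1} \<Longrightarrow> (v' has_real_derivative v'' r) (at r within {0..1})"
    and eq: "\<And>r. r \<in> {0<..1} \<Longrightarrow> - (v'' r + (real N - 1) / r * v' r) = a r * exp (v r)"
    and init: "v 0 = \<beta>" "v' 0 = 0"
    using assms unfolding radial_ivp_solution_def by metis
  show cont: "continuous_on {0..1} v"
    using v by (rule DERIV_continuous_on)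
  define h where "h s = a s * exp (v s)" for s
  have h: "continuous_on {0..1} h" unfolding h_def by (intro continuous_intros a_cont cont)
  \<comment> \<open>With N = j + 3 the powers s^(N-1) and s^(N-2) visibly vanish at s = 0, so the
    divergence form holds trivially at the point where the equation is not imposed.\<close>
  have "N = Suc (Suc (Suc (N - 3)))" using N by simp
  then obtain j where j: "N = Suc (Suc (Suc j))" ..
  have v'_eq: "v' r = - (r * radial_avg (N - 1) h r)" if r: "r \<in> {0..1}" for r
  proof (cases "r = 0")
    case False
    with r have r0: "0 < r" by simp
    have "((\<lambda>s. s ^ (N - 1) * v' s) has_real_derivative - (s ^ (N - 1) * h s)) (at s within {0..1})"
      if s: "s \<in> {0..1}" for s
    proof -
      have "((\<lambda>s. s ^ (N - 1) * v' s) has_real_derivative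
          real (N - 1) * s ^ (N - 2) * v' s + s ^ (N - 1) * v'' s) (at s within {0..1})"
        by (rule derivative_eq_intros v'[OF s] | simp add: j)+
      also have "real (N - 1) * s ^ (N - 2) * v' s + s ^ (N - 1) * v'' s = - (s ^ (N - 1) * h s)"
      proof (cases "s = 0")
        case False
        with s have v'': "v'' s = - h s - (real N - 1) / s * v' s" using eq[of s] by (simp add: h_def)
        show ?thesis unfolding v'' using False by (simp add: j field_simps)
      qed (simp add: j)
      finally show ?thesis .
    qed
    then have "((\<lambda>s. - (s ^ (N - 1) * h s)) has_integral
        (r ^ (N - 1) * v' r - 0 ^ (N - 1) * v' 0)) {0..r}"
      using r by (rule has_integral_of_derivative_unit_interval)
    from integral_unique[OF this] have "integral {0..r} (\<lambda>s. - (s ^ (N - 1) * h s)) = r ^ (N - 1) * v' r"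
      using init by simp
    then have "r ^ (N - 1) * v' r = r ^ (N - 1) * - (r * radial_avg (N - 1) h r)"
      using radial_avg_eq[OF r0, of "N - 1" h] by (simp add: mult_ac)
    then show ?thesis using r0 by (subst (asm) mult_left_cancel) simp_all
  qed (simp add: init)
  assume r: "r \<in> {0..1}"
  have "((\<lambda>s. - (s * radial_avg (N - 1) h s)) has_integral (v r - v 0)) {0..r}"
    by (rule has_integral_of_derivative_unit_interval[OF _ r]) (use v v'_eq in metis)
  from integral_unique[OF this] show "v r = \<beta> - radial_int (N - 1) (\<lambda>s. a s * exp (v s)) r"
    using init by (simp add: radial_int_def flip: h_def)
qed

text \<open>The derivatives are read off from the integral equation; the resulting formula for v''
  has no singular coefficient, so it is continuous up to r = 0.\<close>

lemma radial_ivp_solutionI: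
  assumes cont: "continuous_on {0..1} v"
    and eq: "\<And>r. r \<in> {0..1} \<Longrightarrow> v r = \<beta> - radial_int (N - 1) (\<lambda>s. a s * exp (v s)) r"
  shows "radial_ivp_solution N a \<beta> v"
proof -
  define h where "h s = a s * exp (v s)" for s
  have h: "continuous_on {0..1} h" unfolding h_def by (intro continuous_intros a_cont cont)
  show ?thesis unfolding radial_ivp_solution_def
  proof (intro exI conjI ballI)
    fix r :: real assume r: "r \<in> {0..1}"
    have "((\<lambda>r. \<beta> - radial_int (N - 1) h r) has_real_derivative - (r * radial_avg (N - 1) h r)) (at r within {0..1})"
      by (rule derivative_eq_intros radial_int_has_derivative[OF h r] | simp)+
    then show "(v has_real_derivative - (r * radial_avg (N - 1) h r)) (at r within {0..1})"
      by (rule has_field_derivative_transform_within[OF _ zero_less_one r]) (simp add: eq flip: h_def)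
    show "((\<lambda>r. - (r * radial_avg (N - 1) h r)) has_real_derivative
        - (h r - real (N - 1) * radial_avg (N - 1) h r)) (at r within {0..1})"
      by (rule derivative_eq_intros radial_flux_has_derivative[OF h r] refl)+
  next
    show "continuous_on {0..1} (\<lambda>r. - (h r - real (N - 1) * radial_avg (N - 1) h r))"
      by (intro continuous_intros continuous_on_radial_avg h)
  next
    fix r :: real assume "r \<in> {0<..1}"
    then show "- (- (h r - real (N - 1) * radial_avg (N - 1) h r) + (real N - 1) / r * - (r * radial_avg (N - 1) h r))
      = a r * exp (v r)"
      using N by (simp add: h_def of_nat_diff)
  next
    show "v 0 = \<beta>" using eq[of 0] by (simp add: radial_int_def)
  qed simp
qed

lemma nonlinearity_diff_le:
  assumes "x \<le> B" "y \<le> B" "\<bar>x - y\<bar> \<le> D * E" "s \<in> {0..1}"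
  shows "\<bar>a s * exp x - a s * exp y\<bar> \<le> A * exp B * D * E"
proof -
  have a: "0 \<le> a s" "a s \<le> A" using a_lower[OF assms(4)] a_upper[OF assms(4)] a0_pos by auto
  have "\<bar>exp x - exp y\<bar> \<le> exp B * (D * E)"
    using exp_diff_le_exp_mult[OF assms(1,2)] mult_left_mono[OF assms(3) exp_ge_zero]
    by (rule order_trans)
  then have "a s * \<bar>exp x - exp y\<bar> \<le> A * (exp B * (D * E))"
    using a by (intro mult_mono) auto
  moreover have "\<bar>a s * exp x - a s * exp y\<bar> = a s * \<bar>exp x - exp y\<bar>"
    using a by (simp add: right_diff_distrib[symmetric] abs_mult)
  ultimately show ?thesis by (simp add: mult.assoc)
qed

text \<open>
  Capping the exponent at \<open>\<beta>\<close> makes the nonlinearity Lipschitz; since solutions lie below \<open>\<beta>\<close>, the cap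
  is never active.
\<close>

lemma radial_ivp_solution_exists: "\<exists>v. radial_ivp_solution N a \<beta> v"
proof -
  define \<Phi> where "\<Phi> u r = \<beta> - radial_int (N - 1) (\<lambda>s. a s * exp (min (u s) \<beta>)) r" for u r
  \<comment> \<open>Twice the Lipschitz constant of the capped nonlinearity, which makes the
    contraction factor 1/2.\<close>
  define k where "k = 2 * A * exp \<beta>"
  have k: "0 < k" using A_ge by (simp add: k_def)
  have h: "continuous_on {0..1} (\<lambda>s. a s * exp (min (u s) \<beta>))" if "continuous_on {0..1} u" for u
    by (intro continuous_intros a_cont that)
  have "\<exists>u. continuous_on {0..1} u \<and> (\<forall>r\<in>{0..1}. u r = \<Phi> u r)"
  proof (rule weighted_contraction_fixpoint)
    show "continuous_on {0..1} (\<Phi> u)" if "continuous_on {0..1} u" for u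
    proof -
      have "continuous_on {0..1} (radial_int (N - 1) (\<lambda>s. a s * exp (min (u s) \<beta>)))"
        using radial_int_has_derivative[OF h[OF that]] by (rule DERIV_continuous_on)
      then show ?thesis unfolding \<Phi>_def by (intro continuous_intros)
    qed
    show "\<bar>\<Phi> u r - \<Phi> v r\<bar> \<le> D / 2 * exp (k * r)"
      if u: "continuous_on {0..1} u" and v: "continuous_on {0..1} v"
        and D: "\<And>s. s \<in> {0..1} \<Longrightarrow> \<bar>u s - v s\<bar> \<le> D * exp (k * s)" and r: "r \<in> {0..1}" for u v D r
    proof -
      have "\<bar>a s * exp (min (u s) \<beta>) - a s * exp (min (v s) \<beta>)\<bar> \<le> A * exp \<beta> * D * exp (k * s)"
        if s: "s \<in> {0..1}" for s
        by (rule nonlinearity_diff_le[OF _ _ _ s]) (use D[OF s] in auto)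
      from radial_int_diff_le[OF h[OF u] h[OF v] this k r, of "N - 1"]
      have "\<bar>\<Phi> u r - \<Phi> v r\<bar> \<le> A * exp \<beta> * D / k * exp (k * r)" by (simp add: \<Phi>_def)
      also have "A * exp \<beta> * D / k = D / 2" using k A_ge by (simp add: k_def)
      finally show ?thesis .
    qed
  qed (use k in simp)
  then obtain u where u: "continuous_on {0..1} u" and eq: "\<And>r. r \<in> {0..1} \<Longrightarrow> u r = \<Phi> u r" by blast
  have le: "u r \<le> \<beta>" if r: "r \<in> {0..1}" for r
  proof -
    have "0 \<le> radial_int (N - 1) (\<lambda>s. a s * exp (min (u s) \<beta>)) r"
      by (rule radial_int_nonneg[OF h[OF u] _ r]) (simp add: a_nonneg)
    then show ?thesis using eq[OF r] by (simp add: \<Phi>_def)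
  qed
  have "radial_int (N - 1) (\<lambda>s. a s * exp (min (u s) \<beta>)) r = radial_int (N - 1) (\<lambda>s. a s * exp (u s)) r"
    if r: "r \<in> {0..1}" for r
    using r le by (intro radial_int_cong) (simp add: min_absorb1)
  then have "radial_ivp_solution N a \<beta> u"
    using eq by (intro radial_ivp_solutionI u) (simp add: \<Phi>_def)
  then show ?thesis by blast
qed

lemma radial_ivp_solution_le:
  assumes v: "radial_ivp_solution N a \<beta> v" and r: "r \<in> {0..1}"
  shows "v r \<le> \<beta>"
proof -
  note vc = radial_ivp_solution_integral(1)[OF v]
  have "0 \<le> radial_int (N - 1) (\<lambda>s. a s * exp (v s)) r"
    by (rule radial_int_nonneg[OF _ _ r]) (auto intro!: continuous_intros a_cont vc simp: a_nonneg)
  then show ?thesis using radial_ivp_solution_integral(2)[OF v r] by simp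
qed

text \<open>Both solutions stay at or below B, where the nonlinearity has Lipschitz constant A exp
  B. For \<beta> = \<gamma> the bound is uniqueness; otherwise it is Lipschitz dependence on the
  initial value, locally uniform in \<beta>.\<close>

lemma radial_ivp_solution_stable:
  assumes u: "radial_ivp_solution N a \<beta> u" and v: "radial_ivp_solution N a \<gamma> v"
    and B: "\<beta> \<le> B" "\<gamma> \<le> B" and r: "r \<in> {0..1}"
  shows "\<bar>u r - v r\<bar> \<le> 2 * \<bar>\<beta> - \<gamma>\<bar> * exp (2 * A * exp B)"
proof (rule weighted_contraction_stability[where d = "\<lambda>r. u r - v r" and k = "2 * A * exp B"])
  define k where "k = 2 * A * exp B"
  have k: "0 < k" using A_ge by (simp add: k_def)
  note uc = radial_ivp_solution_integral(1)[OF u] and vc = radial_ivp_solution_integral(1)[OF v]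
  show "continuous_on {0..1} (\<lambda>r. u r - v r)" by (intro continuous_intros uc vc)
  show "0 \<le> 2 * A * exp B" using A_ge by simp
  show "\<bar>u r - v r\<bar> \<le> \<bar>\<beta> - \<gamma>\<bar> + D / 2 * exp (2 * A * exp B * r)"
    if D: "\<And>s. s \<in> {0..1} \<Longrightarrow> \<bar>u s - v s\<bar> \<le> D * exp (2 * A * exp B * s)" and r: "r \<in> {0..1}" for D r
  proof -
    have "\<bar>a s * exp (u s) - a s * exp (v s)\<bar> \<le> A * exp B * D * exp (k * s)" if s: "s \<in> {0..1}" for s
      using radial_ivp_solution_le[OF u s] radial_ivp_solution_le[OF v s] B D[OF s]
      by (intro nonlinearity_diff_le[OF _ _ _ s]) (auto simp: k_def)
    moreover have "continuous_on {0..1} (\<lambda>s. a s * exp (u s))" "continuous_on {0..1} (\<lambda>s. a s * exp (v s))"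
      by (intro continuous_intros a_cont uc vc)+
    ultimately have "\<bar>radial_int (N - 1) (\<lambda>s. a s * exp (u s)) r - radial_int (N - 1) (\<lambda>s. a s * exp (v s)) r\<bar>
        \<le> A * exp B * D / k * exp (k * r)"
      by (intro radial_int_diff_le k r)
    moreover have e: "A * exp B * D / k = D / 2" using k A_ge by (simp add: k_def)
    ultimately have "\<bar>u r - v r\<bar> \<le> \<bar>\<beta> - \<gamma>\<bar> + D / 2 * exp (k * r)"
      using radial_ivp_solution_integral(2)[OF u r] radial_ivp_solution_integral(2)[OF v r]
      unfolding e by linarith
    then show ?thesis by (simp only: k_def)
  qed
qed (use r in auto)

text \<open>This justifies the definite description in \<open>radial_v\<close>: some solution
  exists, its restriction is extensional and still solves the integral equation, and stability with
  equal initial values leaves no other.\<close>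

lemma radial_v_solution: "radial_ivp_solution N a \<beta> (radial_v N a \<beta>)"
proof -
  obtain v where v: "radial_ivp_solution N a \<beta> v" using radial_ivp_solution_exists by blast
  have "radial_v N a \<beta> \<in> extensional {0..1} \<and> radial_ivp_solution N a \<beta> (radial_v N a \<beta>)"
    unfolding radial_v_def
  proof (rule theI[where P = "\<lambda>v. v \<in> extensional {0..1} \<and> radial_ivp_solution N a \<beta> v"
        and a = "restrict v {0..1}"])
    have *: "radial_int (N - 1) (\<lambda>s. a s * exp (restrict v {0..1} s)) r = radial_int (N - 1) (\<lambda>s. a s * exp (v s)) r"
      if r: "r \<in> {0..1}" for r
      using r by (intro radial_int_cong) simp
    have "continuous_on {0..1} (restrict v {0..1})"
      using radial_ivp_solution_integral(1)[OF v] continuous_on_cong by (metis (mono_tags) restrict_apply')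
    then have "radial_ivp_solution N a \<beta> (restrict v {0..1})"
      by (rule radial_ivp_solutionI) (simp only: * radial_ivp_solution_integral(2)[OF v] restrict_apply')
    then show "restrict v {0..1} \<in> extensional {0..1} \<and> radial_ivp_solution N a \<beta> (restrict v {0..1})"
      by simp
    fix u assume u: "u \<in> extensional {0..1} \<and> radial_ivp_solution N a \<beta> u"
    show "u = restrict v {0..1}"
    proof (rule extensionalityI[where A = "{0..1}"])
      fix r :: real assume r: "r \<in> {0..1}"
      have "\<bar>u r - v r\<bar> \<le> 0" using radial_ivp_solution_stable[OF conjunct2[OF u] v order_refl order_refl r] by simp
      then show "u r = restrict v {0..1} r" using r by simp
    qed (use u in auto)
  qed
  then show ?thesis ..
qed

text \<open>Equal to -v'(r)/r, continued to r = 0.\<close>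

definition flux :: "real \<Rightarrow> real \<Rightarrow> real" where
  "flux \<beta> = radial_avg (N - 1) (\<lambda>s. a s * exp (radial_v N a \<beta> s))"

section \<open>Properties of the solution and of its flux\<close>

lemma continuous_radial_v: "continuous_on {0..1} (radial_v N a \<beta>)"
  using radial_ivp_solution_integral(1)[OF radial_v_solution] .

lemma radial_v_le: "r \<in> {0..1} \<Longrightarrow> radial_v N a \<beta> r \<le> \<beta>"
  using radial_ivp_solution_le[OF radial_v_solution] .

lemma continuous_source: "continuous_on {0..1} (\<lambda>s. a s * exp (radial_v N a \<beta> s))"
  by (intro continuous_intros a_cont continuous_radial_v)

lemma radial_v_0: "radial_v N a \<beta> 0 = \<beta>"
  using radial_v_solution unfolding radial_ivp_solution_def by blast

lemma radial_v_has_derivative: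
  assumes r: "r \<in> {0..1}"
  shows "(radial_v N a \<beta> has_real_derivative - (r * flux \<beta> r)) (at r within {0..1})"
proof -
  have "((\<lambda>r. \<beta> - radial_int (N - 1) (\<lambda>s. a s * exp (radial_v N a \<beta> s)) r) has_real_derivative - (r * flux \<beta> r))
      (at r within {0..1})"
    unfolding flux_def by (rule derivative_eq_intros radial_int_has_derivative[OF continuous_source r] | simp)+
  then show ?thesis
    by (rule has_field_derivative_transform_within[OF _ zero_less_one r])
      (use radial_ivp_solution_integral(2)[OF radial_v_solution] in simp)
qed

lemma flux_has_derivative:
  assumes r: "r \<in> {0..1}"
  shows "((\<lambda>r. r * flux \<beta> r) has_real_derivative a r * exp (radial_v N a \<beta> r) - (real N - 1) * flux \<beta> r)
    (at r within {0..1})"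
  using radial_flux_has_derivative[OF continuous_source r, where n = "N - 1"] N by (simp add: flux_def of_nat_diff)

lemma flux_bounds:
  assumes r: "r \<in> {0..1}"
  shows "0 \<le> flux \<beta> r" "flux \<beta> r \<le> A * exp \<beta>"
proof -
  have "0 \<le> a s" "a s \<le> A" if "s \<in> {0..r}" for s
    using a_lower[of s] a_upper[of s] a0_pos that r by auto
  then show "0 \<le> flux \<beta> r" unfolding flux_def by (intro radial_avg_nonneg r) auto
  have "\<bar>flux \<beta> r\<bar> \<le> A * exp \<beta>"
    unfolding flux_def
  proof (rule abs_radial_avg_le[OF continuous_source r])
    fix s assume s: "s \<in> {0..r}"
    then have s1: "s \<in> {0..1}" using r by auto
    show "\<bar>a s * exp (radial_v N a \<beta> s)\<bar> \<le> A * exp \<beta>"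
      using a_lower[OF s1] a_upper[OF s1] a0_pos radial_v_le[OF s1]
      by (auto simp: abs_mult intro!: mult_mono)
  qed
  then show "flux \<beta> r \<le> A * exp \<beta>" by simp
qed

text \<open>Continuity in r at fixed \<beta> is combined with the Lipschitz bound in \<beta>, which
  is uniform in r.\<close>

lemma continuous_radial_v_joint: "continuous_on (UNIV \<times> {0..1}) (\<lambda>(\<beta>, r). radial_v N a \<beta> r)"
  unfolding continuous_on_iff
proof (intro ballI allI impI)
  fix p :: "real \<times> real" and e :: real assume p: "p \<in> UNIV \<times> {0..1}" and e: "0 < e"
  obtain \<beta> r where pr: "p = (\<beta>, r)" by (cases p)
  with p have r: "0 \<le> r" "r \<le> 1" by auto
  define L where "L = 2 * exp (2 * A * exp (\<beta> + 1))"
  have L: "0 < L" by (simp add: L_def)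
  obtain d where d: "0 < d" "\<And>s. s \<in> {0..1} \<Longrightarrow> dist s r < d \<Longrightarrow> dist (radial_v N a \<beta> s) (radial_v N a \<beta> r) < e / 2"
    using continuous_radial_v[of \<beta>] r e unfolding continuous_on_iff
    by (metis atLeastAtMost_iff half_gt_zero)
  define \<delta> where "\<delta> = min d (min 1 (e / (2 * L)))"
  have "dist (radial_v N a \<gamma> s) (radial_v N a \<beta> r) < e"
    if s: "0 \<le> s" "s \<le> 1" and dd: "dist (\<gamma>, s) (\<beta>, r) < \<delta>" for \<gamma> s
  proof -
    have 1: "dist \<gamma> \<beta> < \<delta>" "dist s r < \<delta>"
      using dd dist_fst_le[of "(\<gamma>, s)" "(\<beta>, r)"] dist_snd_le[of "(\<gamma>, s)" "(\<beta>, r)"] by auto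
    then have "\<gamma> \<le> \<beta> + 1" by (auto simp: \<delta>_def dist_real_def)
    then have "\<bar>radial_v N a \<gamma> s - radial_v N a \<beta> s\<bar> \<le> L * \<bar>\<gamma> - \<beta>\<bar>"
      using radial_ivp_solution_stable[OF radial_v_solution radial_v_solution, of \<gamma> "\<beta> + 1" \<beta> s] s
      by (simp add: L_def mult_ac)
    also have "\<dots> < L * (e / (2 * L))"
      using 1 L by (intro mult_strict_left_mono) (auto simp: \<delta>_def dist_real_def)
    also have "\<dots> = e / 2" using L by simp
    finally have "dist (radial_v N a \<gamma> s) (radial_v N a \<beta> s) < e / 2" by (simp add: dist_real_def)
    moreover have "dist (radial_v N a \<beta> s) (radial_v N a \<beta> r) < e / 2"
      using d(2)[of s] s 1 by (simp add: \<delta>_def)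
    ultimately show ?thesis using dist_triangle_half_l dist_commute by metis
  qed
  moreover have "0 < \<delta>" using d e L by (simp add: \<delta>_def)
  ultimately show "\<exists>d>0. \<forall>q\<in>UNIV \<times> {0..1}. dist q p < d \<longrightarrow>
      dist (case q of (\<gamma>, s) \<Rightarrow> radial_v N a \<gamma> s) (case p of (\<beta>, r) \<Rightarrow> radial_v N a \<beta> r) < e"
    by (auto simp: pr)
qed

lemma continuous_flux_joint: "continuous_on (UNIV \<times> {0..1}) (\<lambda>(\<beta>, r). flux \<beta> r)"
  unfolding flux_def
proof (rule continuous_on_radial_avg_param)
  show "continuous_on (UNIV \<times> {0..1}) (\<lambda>(\<beta>, r). a r * exp (radial_v N a \<beta> r))"
    using continuous_radial_v_joint unfolding case_prod_beta
    by (intro continuous_intros continuous_on_compose2[OF a_cont]) auto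
qed

end

section \<open>Logarithmic variables and uniform decay\<close>

text \<open>Gronwall's inequality: P exp (-c) is nonincreasing. Since P may have any sign, the lemma
  applied to -P yields lower bounds.\<close>

lemma deriv_le_imp_exp_bound:
  fixes P P' c c' :: "real \<Rightarrow> real"
  assumes "s \<le> t" and contP: "continuous_on {s..t} P" and contc: "continuous_on {s..t} c"
    and P: "\<And>x. \<lbrakk>s < x; x < t\<rbrakk> \<Longrightarrow> (P has_real_derivative P' x) (at x)"
    and c: "\<And>x. \<lbrakk>s < x; x < t\<rbrakk> \<Longrightarrow> (c has_real_derivative c' x) (at x)"
    and le: "\<And>x. \<lbrakk>s < x; x < t\<rbrakk> \<Longrightarrow> P' x \<le> c' x * P x"
  shows "P t \<le> P s * exp (c t - c s)"
proof -
  have "P t * exp (- c t) \<le> P s * exp (- c s)"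
  proof (rule DERIV_nonpos_imp_decreasing_open[OF \<open>s \<le> t\<close>])
    show "continuous_on {s..t} (\<lambda>x. P x * exp (- c x))" by (intro continuous_intros contP contc)
    fix x assume x: "s < x" "x < t"
    have "((\<lambda>x. P x * exp (- c x)) has_real_derivative (P' x - c' x * P x) * exp (- c x)) (at x)"
      by (rule derivative_eq_intros P[OF x] c[OF x] refl | simp add: algebra_simps)+
    moreover have "(P' x - c' x * P x) * exp (- c x) \<le> 0" using le[OF x] by (simp add: mult_nonpos_nonneg)
    ultimately show "\<exists>y. ((\<lambda>x. P x * exp (- c x)) has_real_derivative y) (at x) \<and> y \<le> 0" by blast
  qed
  then have "P t * exp (- c t) * exp (c t) \<le> P s * exp (- c s) * exp (c t)"
    by (intro mult_right_mono) auto
  then show ?thesis by (simp add: exp_diff exp_minus field_simps)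
qed

section \<open>Convexity estimates and a strict Lyapunov function\<close>

lemma mult_exp_minus_one_ge:
  fixes w R :: real
  assumes "\<bar>w\<bar> \<le> R"
  shows "exp (- R) * w\<^sup>2 \<le> w * (exp w - 1)"
proof -
  obtain t where t: "\<bar>t\<bar> \<le> \<bar>w\<bar>" "exp w = (\<Sum>m<1. w ^ m / fact m) + exp t / fact 1 * w ^ 1"
    using Maclaurin_exp_le by blast
  have "exp (- R) * w\<^sup>2 \<le> exp t * w\<^sup>2" using t(1) assms by (intro mult_right_mono) auto
  then show ?thesis using t(2) by (simp add: power2_eq_square algebra_simps)
qed

lemma exp_minus_linear_ge:
  fixes w R :: real
  assumes "\<bar>w\<bar> \<le> R"
  shows "exp (- R) / 2 * w\<^sup>2 \<le> exp w - 1 - w"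
proof -
  obtain t where t: "\<bar>t\<bar> \<le> \<bar>w\<bar>" "exp w = (\<Sum>m<2. w ^ m / fact m) + exp t / fact 2 * w ^ 2"
    using Maclaurin_exp_le by blast
  have "exp (- R) * w\<^sup>2 \<le> exp t * w\<^sup>2" using t(1) assms by (intro mult_right_mono) auto
  then show ?thesis using t(2) by (simp add: numeral_2_eq_2 field_simps)
qed

lemma exp_minus_linear_le:
  fixes w :: real
  shows "exp w - 1 - w \<le> w * (exp w - 1)"
proof -
  have "exp w * (1 - w) \<le> exp w * exp (- w)" using exp_ge_add_one_self[of "- w"] by (intro mult_left_mono) auto
  also have "\<dots> = 1" by (simp add: exp_minus)
  finally show ?thesis by (simp add: algebra_simps)
qed

text \<open>The left side is the derivative of F = p^2/2 + 2m (exp w - 1 - w) + e w p along w' = p,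
  p' = -m p - 2m (\<alpha> exp w - 1). For \<alpha> = 1 the part of F without the cross term loses
  only m p^2, which does not see w; the cross term adds the loss 2 m e w (exp w - 1). The last term
  on the right is the cost of \<alpha> differing from 1.\<close>

lemma lyapunov_dissipation:
  fixes w p m c e R \<alpha> \<delta> :: real
  assumes m: "1 \<le> m" and R: "0 \<le> R" "\<bar>w\<bar> \<le> R" "\<bar>p\<bar> \<le> R" and e: "e = exp (- R) / 4"
    and \<alpha>: "\<bar>\<alpha> - 1\<bar> \<le> \<delta>"
  shows "p * (- m * p - 2 * m * (\<alpha> * exp w - 1)) + 2 * m * (exp w - 1) * p
      + e * p\<^sup>2 + e * w * (- m * p - 2 * m * (\<alpha> * exp w - 1))
    \<le> - (e / 2) * (p\<^sup>2 / 2 + 2 * m * (exp w - 1 - w) + e * w * p) + 4 * m * R * exp R * \<delta>"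
proof -
  have e0: "0 < e" "e \<le> 1/4" using R(1) by (auto simp: e)
  have err: "- (2 * m * (\<alpha> - 1) * exp w * (p + e * w)) \<le> 4 * m * R * exp R * \<delta>"
  proof -
    have "\<bar>e * w\<bar> \<le> 1 * R" unfolding abs_mult using R e0 by (intro mult_mono) auto
    then have "\<bar>p + e * w\<bar> \<le> R + 1 * R" using R by linarith
    moreover have "\<bar>\<alpha> - 1\<bar> * exp w \<le> \<delta> * exp R" using R \<alpha> by (intro mult_mono) auto
    moreover have "0 \<le> \<delta>" using \<alpha> by linarith
    ultimately have "\<bar>\<alpha> - 1\<bar> * exp w * \<bar>p + e * w\<bar> \<le> \<delta> * exp R * (R + 1 * R)"
      by - (rule mult_mono, auto)
    then have "2 * m * (\<bar>\<alpha> - 1\<bar> * exp w * \<bar>p + e * w\<bar>) \<le> 2 * m * (\<delta> * exp R * (R + 1 * R))"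
      using m by (intro mult_left_mono) auto
    moreover have "\<bar>2 * m * (\<alpha> - 1) * exp w * (p + e * w)\<bar> = 2 * m * (\<bar>\<alpha> - 1\<bar> * exp w * \<bar>p + e * w\<bar>)"
      using m by (simp add: abs_mult)
    ultimately show ?thesis by (simp add: algebra_simps)
  qed
  \<comment> \<open>Half of the dissipation 2 m e X pays for the potential part of (e/2) F. The
    other half yields 4 m (e w)^2, which together with the friction term absorbs the mixed term
    because e is at most 1/4.\<close>
  define X where "X = w * (exp w - 1)"
  have "4 * e * w\<^sup>2 \<le> X" using mult_exp_minus_one_ge[OF R(2)] by (simp add: X_def e)
  then have X: "m * e * (4 * e * w\<^sup>2) \<le> m * e * X" using m e0 by (intro mult_left_mono) auto
  have "m * e * (exp w - 1 - w) \<le> m * e * X"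
    using m e0 exp_minus_linear_le[of w] by (intro mult_left_mono) (auto simp: X_def)
  moreover have "0 \<le> (m - 5 * e / 4) * p\<^sup>2 + (m - e / 2) * (e * w) * p + 4 * m * (e * w)\<^sup>2"
  proof -
    define q where "q = e * w"
    have "\<bar>(m - e / 2) * q * p\<bar> \<le> m * (\<bar>q\<bar> * \<bar>p\<bar>)"
      using m e0 by (simp add: abs_mult mult.assoc mult_right_mono)
    also have "\<dots> \<le> m * (p\<^sup>2 / 2 + q\<^sup>2)"
    proof (rule mult_left_mono)
      have "2 * (\<bar>q\<bar> * \<bar>p\<bar>) \<le> q\<^sup>2 + p\<^sup>2" using sum_squares_bound[of "\<bar>q\<bar>" "\<bar>p\<bar>"] by (simp add: mult.assoc)
      then show "\<bar>q\<bar> * \<bar>p\<bar> \<le> p\<^sup>2 / 2 + q\<^sup>2" using zero_le_power2[of q] by linarith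
    qed (use m in simp)
    finally have "- (m * p\<^sup>2 / 2 + m * q\<^sup>2) \<le> (m - e / 2) * q * p" by (simp add: algebra_simps)
    moreover have "m / 2 * p\<^sup>2 \<le> (m - 5 * e / 4) * p\<^sup>2" using m e0 by (intro mult_right_mono) auto
    moreover have "0 \<le> m * q\<^sup>2" using m by simp
    ultimately show ?thesis unfolding q_def[symmetric] by simp
  qed
  ultimately show ?thesis using err X unfolding X_def by (simp add: power2_eq_square algebra_simps)
qed

text \<open>The potential is at least quadratic on [-R,R], and completing the square bounds the
  cross term by p^2/4 and a multiple of w^2 that the potential exceeds.\<close>

lemma lyapunov_lower:
  fixes w p m e R :: real
  assumes m: "1 \<le> m" and R: "0 \<le> R" "\<bar>w\<bar> \<le> R" and e: "e = exp (- R) / 4"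
  shows "p\<^sup>2 / 4 + 2 * e * w\<^sup>2 \<le> p\<^sup>2 / 2 + 2 * m * (exp w - 1 - w) + e * w * p"
proof -
  have e0: "0 < e" "e \<le> 1/4" using R(1) by (auto simp: e)
  have ew: "0 \<le> e * w\<^sup>2" using e0 by simp
  have "2 * e * w\<^sup>2 \<le> exp w - 1 - w" using exp_minus_linear_ge[OF R(2)] by (simp add: e)
  then have "2 * (2 * e * w\<^sup>2) \<le> 2 * m * (exp w - 1 - w)"
    using m ew by (intro mult_mono) auto
  moreover have "0 \<le> (p / 2 + e * w)\<^sup>2" by simp
  then have "- (p\<^sup>2 / 4 + e * e * w\<^sup>2) \<le> e * w * p" by (simp add: power2_eq_square algebra_simps)
  moreover have "e * e * w\<^sup>2 \<le> 1 * e * w\<^sup>2" using e0 by (intro mult_right_mono) auto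
  ultimately show ?thesis using ew by linarith
qed

context gelfand
begin

definition m :: real where "m = real N - 2"

lemma m_bounds: "1 \<le> m" "m \<le> 7"
  using N by (auto simp: m_def)

lemma exp_in: "t \<le> 0 \<Longrightarrow> exp t \<in> {0..1::real}" by simp

lemma a_minus_1_le:
  assumes r: "r \<in> {0..1}"
  shows "\<bar>a r - 1\<bar> \<le> A1 * r"
proof (cases "r = 0")
  case False
  with r have r0: "0 < r" by simp
  have "continuous_on {0..r} a" by (rule continuous_on_subset[OF a_cont]) (use r in auto)
  moreover have "(a has_derivative (*) (a' x)) (at x)" if "0 < x" "x < r" for x
    using a_deriv[of x] that r by (simp add: has_field_derivative_def)
  ultimately obtain x where x: "0 < x" "x < r" "a r - a 0 = a' x * (r - 0)"
    using mvt[OF r0, of a "\<lambda>x. (*) (a' x)"] by blast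
  then have "\<bar>a r - 1\<bar> = \<bar>a' x\<bar> * r" using r0 a_0 by (simp add: abs_mult)
  also have "\<dots> \<le> A1 * r" using a'_bound[of x] x r by (intro mult_right_mono) auto
  finally show ?thesis .
qed (simp add: a_0)

text \<open>A predicate on pairs rather than a property of \<open>W\<close>, because it must also
  hold for the singular solution, which does not come from a \<open>radial_v\<close>. At t = 0 only
  continuity is required, so that all derivatives are two-sided.\<close>

definition em_solution :: "(real \<Rightarrow> real) \<Rightarrow> (real \<Rightarrow> real) \<Rightarrow> bool" where
  "em_solution w p \<longleftrightarrow> continuous_on {..0} w \<and> continuous_on {..0} p \<and>
    (\<forall>t<0. (w has_real_derivative p t) (at t) \<and>
      (p has_real_derivative - m * p t - 2 * m * (a (exp t) * exp (w t) - 1)) (at t))"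

text \<open>
  Emden's variables: with \<open>t = ln r\<close> the singular profile \<open>-2 ln r + ln (2m)\<close> of the case \<open>a = 1\<close>
  becomes the equilibrium \<open>w = 0\<close>.
\<close>

definition W :: "real \<Rightarrow> real \<Rightarrow> real" where
  "W \<beta> t = radial_v N a \<beta> (exp t) + 2 * t - ln (2 * m)"

definition Wd :: "real \<Rightarrow> real \<Rightarrow> real" where
  "Wd \<beta> t = 2 - exp t * (exp t * flux \<beta> (exp t))"

lemma em_solution_W: "em_solution (W \<beta>) (Wd \<beta>)"
  unfolding em_solution_def
proof (intro conjI allI impI)
  have sub: "exp ` {..0} \<subseteq> {0..1::real}" by auto
  show "continuous_on {..0} (W \<beta>)" unfolding W_def
    by (intro continuous_intros continuous_on_compose2[OF continuous_radial_v _ sub])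
  have "continuous_on {0..1} (flux \<beta>)"
    unfolding flux_def by (rule continuous_on_radial_avg[OF continuous_source])
  then show "continuous_on {..0} (Wd \<beta>)" unfolding Wd_def
    by (intro continuous_intros continuous_on_compose2[OF _ _ sub])
next
  fix t :: real assume t: "t < 0"
  have at: "at (exp t) within {0..1} = at (exp t)" using t by (intro at_within_Icc_at) auto
  have in01: "exp t \<in> {0..1}" using t by simp
  note dv = DERIV_chain2[where g = exp and x = t, OF radial_v_has_derivative[OF in01, of \<beta>, unfolded at] DERIV_exp]
    and df = DERIV_chain2[where g = exp and x = t, OF flux_has_derivative[OF in01, of \<beta>, unfolded at] DERIV_exp]
  show "(W \<beta> has_real_derivative Wd \<beta> t) (at t)"
    unfolding W_def Wd_def
    by (rule derivative_eq_intros dv refl | simp)+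
  \<comment> \<open>The identity r^2 exp v = 2m exp w, which makes the equation autonomous up to the
    factor \<open>a\<close>.\<close>
  have e: "exp (W \<beta> t) * (2 * m) = exp (radial_v N a \<beta> (exp t)) * (exp t * exp t)"
    using m_bounds by (simp add: W_def exp_add exp_diff exp_double power2_eq_square)
  have "(Wd \<beta> has_real_derivative - (exp t * (exp t * flux \<beta> (exp t))
      + exp t * ((a (exp t) * exp (radial_v N a \<beta> (exp t)) - (real N - 1) * flux \<beta> (exp t)) * exp t))) (at t)"
    unfolding Wd_def
    by (rule derivative_eq_intros df refl | simp)+
  also have "- (exp t * (exp t * flux \<beta> (exp t))
      + exp t * ((a (exp t) * exp (radial_v N a \<beta> (exp t)) - (real N - 1) * flux \<beta> (exp t)) * exp t))
    = m * (exp t * (exp t * flux \<beta> (exp t))) - a (exp t) * (exp (radial_v N a \<beta> (exp t)) * (exp t * exp t))"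
    by (simp add: m_def algebra_simps)
  also have "\<dots> = - m * Wd \<beta> t - 2 * m * (a (exp t) * exp (W \<beta> t) - 1)"
    unfolding e[symmetric] by (simp add: Wd_def algebra_simps)
  finally show "(Wd \<beta> has_real_derivative - m * Wd \<beta> t - 2 * m * (a (exp t) * exp (W \<beta> t) - 1)) (at t)" .
qed

section \<open>A bound uniform in \<beta> from the energy\<close>

lemma alpha_continuous: "continuous_on {..0} (\<lambda>t. a (exp t))"
  by (rule continuous_on_compose2[OF a_cont]) (auto intro!: continuous_intros)

text \<open>
  The weight \<open>a\<close> is kept inside the energy so that its derivative is bounded linearly by the energy
  itself; the constant term makes the energy dominate \<open>exp w\<close>.
\<close>

definition energy :: "(real \<Rightarrow> real) \<Rightarrow> (real \<Rightarrow> real) \<Rightarrow> real \<Rightarrow> real" where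
  "energy w p t = (p t)\<^sup>2 / 2 + 2 * m * (a (exp t) * exp (w t) - w t - 1) - 2 * m * ln (a0 / 2)"

text \<open>The inequality 1 + x \<le> exp x at x = w + ln (a0/2) lets half of a0 exp w absorb the
  linear term in w; the other half remains on the left.\<close>

lemma energy_ge:
  assumes t: "t \<le> 0"
  shows "(p t)\<^sup>2 / 2 + m * a0 * exp (w t) \<le> energy w p t"
proof -
  have "1 + (w t + ln (a0 / 2)) \<le> exp (w t + ln (a0 / 2))" by (rule exp_ge_add_one_self)
  also have "\<dots> = exp (w t) * (a0 / 2)" using a0_pos by (simp add: exp_add)
  finally have 1: "1 + w t + ln (a0 / 2) \<le> a0 / 2 * exp (w t)" by (simp add: mult.commute)
  have "a0 * exp (w t) \<le> a (exp t) * exp (w t)" using a_lower[OF exp_in[OF t]] by (intro mult_right_mono) auto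
  with 1 have "a0 / 2 * exp (w t) \<le> a (exp t) * exp (w t) - w t - 1 - ln (a0 / 2)" by linarith
  then have "2 * m * (a0 / 2 * exp (w t)) \<le> 2 * m * (a (exp t) * exp (w t) - w t - 1 - ln (a0 / 2))"
    using m_bounds by (intro mult_left_mono) auto
  then show ?thesis by (simp add: energy_def algebra_simps)
qed

text \<open>Friction lowers the energy, and the variation of \<open>a\<close> raises it at relative
  rate at most (2 A1/a0) exp t. This rate has integral at most 2 A1/a0 over the negative half line,
  so the factor is independent of the starting time.\<close>

lemma energy_le:
  assumes sol: "em_solution w p" and st: "s \<le> t" "t \<le> 0"
  shows "energy w p t \<le> energy w p s * exp (2 * A1 / a0)"
proof -
  have sub: "{s..t} \<subseteq> {..0}" using st by auto
  have wc: "continuous_on {s..t} w" and pc: "continuous_on {s..t} p"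
    and ac: "continuous_on {s..t} (\<lambda>t. a (exp t))"
    using sol alpha_continuous continuous_on_subset[OF _ sub] by (auto simp: em_solution_def)
  define c where "c x = 2 * A1 / a0 * exp x" for x :: real
  have "energy w p t \<le> energy w p s * exp (c t - c s)"
  proof (rule deriv_le_imp_exp_bound[OF st(1)])
    show "continuous_on {s..t} (energy w p)" unfolding energy_def
      by (intro continuous_intros wc pc ac) auto
    show "continuous_on {s..t} c" unfolding c_def by (intro continuous_intros)
    fix x assume x: "s < x" "x < t"
    then have x0: "x < 0" using st by simp
    have dw: "(w has_real_derivative p x) (at x)"
      and dp: "(p has_real_derivative - m * p x - 2 * m * (a (exp x) * exp (w x) - 1)) (at x)"
      using sol x0 by (auto simp: em_solution_def)
    have da: "((\<lambda>x. a (exp x)) has_real_derivative a' (exp x) * exp x) (at x)"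
      by (rule DERIV_chain2[OF a_deriv]) (use x0 in \<open>auto intro!: derivative_eq_intros\<close>)
    show "(c has_real_derivative 2 * A1 / a0 * exp x) (at x)"
      unfolding c_def by (rule derivative_eq_intros | simp)+
    show "(energy w p has_real_derivative - m * (p x)\<^sup>2 + 2 * m * (a' (exp x) * exp x) * exp (w x)) (at x)"
      unfolding energy_def
      by (rule derivative_eq_intros dw dp da refl | simp)+ (simp add: power2_eq_square algebra_simps)
    have "m * a0 * exp (w x) \<le> energy w p x"
      using energy_ge[of x p w] x0 by (smt (verit) zero_le_power2 divide_nonneg_nonneg)
    then have "(2 * A1 / a0 * exp x) * (m * a0 * exp (w x)) \<le> 2 * A1 / a0 * exp x * energy w p x"
      using A1_nonneg a0_pos by (intro mult_left_mono) auto
    moreover have "2 * m * (a' (exp x) * exp x) * exp (w x) \<le> 2 * m * (A1 * exp x) * exp (w x)"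
      using a'_bound[of "exp x"] x0 m_bounds by (intro mult_right_mono mult_left_mono) auto
    moreover have "(2 * A1 / a0 * exp x) * (m * a0 * exp (w x)) = 2 * m * (A1 * exp x) * exp (w x)"
      using a0_pos by simp
    moreover have "0 \<le> m * (p x)\<^sup>2" using m_bounds by simp
    ultimately show "- m * (p x)\<^sup>2 + 2 * m * (a' (exp x) * exp x) * exp (w x) \<le> 2 * A1 / a0 * exp x * energy w p x"
      by linarith
  qed
  also have "\<dots> \<le> energy w p s * exp (2 * A1 / a0)"
  proof (rule mult_left_mono)
    have "2 * A1 / a0 * exp t \<le> 2 * A1 / a0 * 1"
      using A1_nonneg a0_pos st by (intro mult_left_mono) auto
    moreover have "0 \<le> 2 * A1 / a0 * exp s" using A1_nonneg a0_pos by simp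
    ultimately
    show "exp (c t - c s) \<le> exp (2 * A1 / a0)" by (simp add: c_def)
    have "0 \<le> (p s)\<^sup>2 / 2 + m * a0 * exp (w s)" using m_bounds a0_pos by simp
    then show "0 \<le> energy w p s" using energy_ge[of s p w] st by linarith
  qed
  finally show ?thesis .
qed

text \<open>The radius r = exp (-\<beta>/2) is the scale of the core: r^2 exp \<beta> = 1. Since the
  flux is at most A exp \<beta>, the function v(s) + A exp \<beta> s^2/2 is nondecreasing, so v has
  dropped by at most A/2 there, and r^2 times the flux is at most A.\<close>

lemma W_initial:
  assumes \<beta>: "0 \<le> \<beta>"
  shows "W \<beta> (- \<beta> / 2) \<le> - ln (2 * m)" "- A - ln (2 * m) \<le> W \<beta> (- \<beta> / 2)" "\<bar>Wd \<beta> (- \<beta> / 2)\<bar> \<le> A + 2"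
proof -
  define r where "r = exp (- \<beta> / 2)"
  have r: "r \<in> {0..1}" "0 < r" using \<beta> by (auto simp: r_def)
  have rr: "r * r * exp \<beta> = 1" by (simp add: r_def flip: exp_add)
  show "W \<beta> (- \<beta> / 2) \<le> - ln (2 * m)" using radial_v_le[OF r(1), of \<beta>] by (simp add: W_def r_def)
  have fl: "flux \<beta> s \<le> A * exp \<beta>" if "s \<in> {0..1}" for s using flux_bounds[OF that] by simp
  have "radial_v N a \<beta> 0 + A * exp \<beta> * 0\<^sup>2 / 2 \<le> radial_v N a \<beta> r + A * exp \<beta> * r\<^sup>2 / 2"
  proof (rule DERIV_nonneg_imp_increasing_open[where f = "\<lambda>s. radial_v N a \<beta> s + A * exp \<beta> * s\<^sup>2 / 2"])
    show "continuous_on {0..r} (\<lambda>s. radial_v N a \<beta> s + A * exp \<beta> * s\<^sup>2 / 2)"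
      using r by (intro continuous_intros continuous_on_subset[OF continuous_radial_v]) auto
    fix s assume s: "0 < s" "s < r"
    then have s1: "s \<in> {0..1}" and at: "at s within {0..1} = at s" using r by (auto intro!: at_within_Icc_at)
    have "((\<lambda>s. radial_v N a \<beta> s + A * exp \<beta> * s\<^sup>2 / 2) has_real_derivative s * (A * exp \<beta> - flux \<beta> s)) (at s)"
      by (rule derivative_eq_intros radial_v_has_derivative[OF s1, unfolded at] refl | simp)+
        (simp add: algebra_simps)
    moreover have "0 \<le> s * (A * exp \<beta> - flux \<beta> s)" using s fl[OF s1] by simp
    ultimately show "\<exists>y. ((\<lambda>s. radial_v N a \<beta> s + A * exp \<beta> * s\<^sup>2 / 2) has_real_derivative y) (at s) \<and> 0 \<le> y"
      by blast
  qed (use r in simp)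
  moreover have "A * exp \<beta> * r\<^sup>2 / 2 = A / 2 * (r * r * exp \<beta>)" by (simp add: power2_eq_square)
  ultimately have "\<beta> - A / 2 \<le> radial_v N a \<beta> r" unfolding rr radial_v_0 by simp
  then show "- A - ln (2 * m) \<le> W \<beta> (- \<beta> / 2)" using A_ge by (simp add: W_def r_def)
  have "r * r * flux \<beta> r \<le> r * r * (A * exp \<beta>)" using fl[OF r(1)] r by (intro mult_left_mono) auto
  also have "\<dots> = A * (r * r * exp \<beta>)" by (simp add: mult_ac)
  also have "\<dots> = A" by (simp only: rr mult_1_right)
  finally have "r * (r * flux \<beta> r) \<le> A" by (simp add: mult.assoc)
  moreover have "0 \<le> r * (r * flux \<beta> r)" using flux_bounds[OF r(1)] r by simp
  moreover have "Wd \<beta> (- \<beta> / 2) = 2 - r * (r * flux \<beta> r)" by (simp add: Wd_def r_def)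
  ultimately show "\<bar>Wd \<beta> (- \<beta> / 2)\<bar> \<le> A + 2" by linarith
qed

text \<open>The energy at -\<beta>/2 is at most E0 by \<open>W_initial\<close>, and hence at most M
  up to t = 0. It controls exp w and p^2; the constant R is a crude sum of the resulting
  bounds.\<close>

lemma W_bounded: "\<exists>R\<ge>0. \<forall>\<beta>\<ge>0. \<forall>t\<in>{- \<beta> / 2..0}. \<bar>W \<beta> t\<bar> \<le> R \<and> \<bar>Wd \<beta> t\<bar> \<le> R"
proof -
  define E0 where "E0 = (A + 2)\<^sup>2 / 2 + 2 * m * (A + A + ln (2 * m)) - 2 * m * ln (a0 / 2)"
  define M where "M = E0 * exp (2 * A1 / a0)"
  define R where "R = 1 + 2 * M + M / (m * a0) + M + 2 * m"
  have main: "\<bar>W \<beta> t\<bar> \<le> R \<and> \<bar>Wd \<beta> t\<bar> \<le> R \<and> 0 \<le> R" if \<beta>: "0 \<le> \<beta>" and t: "t \<in> {- \<beta> / 2..0}" for \<beta> t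
  proof -
    let ?s = "- \<beta> / 2"
    have s0: "?s \<le> 0" using \<beta> by simp
    have "energy (W \<beta>) (Wd \<beta>) ?s \<le> E0"
    proof -
      have "(Wd \<beta> ?s)\<^sup>2 \<le> (A + 2)\<^sup>2" using W_initial(3)[OF \<beta>] A_ge by (simp add: abs_le_square_iff[symmetric])
      moreover have "a (exp ?s) * exp (W \<beta> ?s) \<le> A * 1"
      proof (rule mult_mono)
        have "0 \<le> ln (2 * m)" using m_bounds by simp
        then show "exp (W \<beta> ?s) \<le> 1" using W_initial(1)[OF \<beta>] by simp
      qed (use a_upper[OF exp_in[OF s0]] A_ge in auto)
      then have "2 * m * (a (exp ?s) * exp (W \<beta> ?s) - W \<beta> ?s - 1) \<le> 2 * m * (A + A + ln (2 * m))"
        using W_initial(2)[OF \<beta>] m_bounds by (intro mult_left_mono) auto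
      ultimately show ?thesis unfolding energy_def E0_def by simp
    qed
    then have "energy (W \<beta>) (Wd \<beta>) ?s * exp (2 * A1 / a0) \<le> M"
      unfolding M_def by (intro mult_right_mono) auto
    then have E: "energy (W \<beta>) (Wd \<beta>) t \<le> M"
      using energy_le[OF em_solution_W, of ?s t \<beta>] t by simp
    have ge: "(Wd \<beta> t)\<^sup>2 / 2 + m * a0 * exp (W \<beta> t) \<le> M"
      using energy_ge[of t "Wd \<beta>" "W \<beta>"] t E by simp
    have p0: "0 < m * a0 * exp (W \<beta> t)" using m_bounds a0_pos by simp
    have p1: "0 \<le> (Wd \<beta> t)\<^sup>2 / 2" by simp
    have M0: "0 \<le> M" using ge p0 p1 by linarith
    have q: "0 \<le> M / (m * a0)" using M0 m_bounds a0_pos by simp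
    have "m * a0 * exp (W \<beta> t) \<le> M" using ge p1 by linarith
    then have "exp (W \<beta> t) \<le> M / (m * a0)"
      using m_bounds a0_pos by (simp add: pos_le_divide_eq mult_ac)
    then have up: "W \<beta> t \<le> R" using exp_ge_add_one_self[of "W \<beta> t"] M0 m_bounds unfolding R_def by linarith
    define l0 where "l0 = ln (a0 / 2)"
    have "l0 \<le> 0" using a0_le a0_pos by (simp add: l0_def)
    then have l: "0 \<le> - (2 * m * l0)" using m_bounds by (simp add: mult_nonneg_nonpos)
    have ae: "0 \<le> 2 * m * (a (exp t) * exp (W \<beta> t))"
      using a_lower[of "exp t"] a0_pos m_bounds t by (intro mult_nonneg_nonneg) auto
    \<comment> \<open>The lower bound on w comes from the linear term -2 m w of the energy, the only
      one that is large when w is very negative.\<close>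
    have "(Wd \<beta> t)\<^sup>2 / 2 + 2 * m * (a (exp t) * exp (W \<beta> t)) - 2 * m * W \<beta> t - 2 * m - 2 * m * l0 \<le> M"
      using E by (simp add: energy_def l0_def algebra_simps)
    then have "- (2 * m * W \<beta> t) \<le> 1 * (M + 2 * m)" using p1 l ae by argo
    also have "\<dots> \<le> 2 * m * (M + 2 * m)" using m_bounds M0 by (intro mult_right_mono) auto
    finally have "2 * m * (- W \<beta> t) \<le> 2 * m * (M + 2 * m)" by simp
    then have "- W \<beta> t \<le> M + 2 * m" using m_bounds by (subst (asm) mult_le_cancel_left_pos) auto
    then have low: "- W \<beta> t \<le> R" using M0 q unfolding R_def by linarith
    have "(Wd \<beta> t)\<^sup>2 \<le> 2 * M" using ge p0 by simp
    moreover have "2 * \<bar>Wd \<beta> t\<bar> \<le> 1 + (Wd \<beta> t)\<^sup>2" using sum_squares_bound[of 1 "\<bar>Wd \<beta> t\<bar>"] by simp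
    ultimately have "\<bar>Wd \<beta> t\<bar> \<le> R" using M0 q m_bounds unfolding R_def by linarith
    then show ?thesis using up low by auto
  qed
  then show ?thesis using main[of 0 0] by (intro exI[of _ R]) auto
qed

text \<open>
  Adding the cross term \<open>e * w * p\<close> makes the energy a strict Lyapunov function, which turns
  boundedness into exponential decay up to the perturbation \<open>a - 1\<close>.
\<close>

lemma lyapunov_decay:
  assumes sol: "em_solution w p" and s: "s \<le> 0" and R: "0 \<le> R"
    and bd: "\<And>t. t \<in> {s..0} \<Longrightarrow> \<bar>w t\<bar> \<le> R \<and> \<bar>p t\<bar> \<le> R"
    and e: "e = exp (- R) / 4" and t: "t \<in> {s..0}"
  shows "(p t)\<^sup>2 / 4 + 2 * e * (w t)\<^sup>2
    \<le> (R\<^sup>2 + 2 * m * (exp R + R) + R\<^sup>2) * exp (- (e / 2) * (t - s)) + 4 * m * R * exp R * A1 / e * exp (e / 2 * t)"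
proof -
  define D where "D = 4 * m * R * exp R * A1"
  have e0: "0 < e" "e \<le> 1/4" using R by (auto simp: e)
  have D0: "0 \<le> D" using R A1_nonneg m_bounds by (simp add: D_def)
  define F where "F x = (p x)\<^sup>2 / 2 + 2 * m * (exp (w x) - 1 - w x) + e * w x * p x" for x
  \<comment> \<open>The subtracted term is an exact solution of y' = -(e/2) y + D exp (e x/2), so
    the inequality for Q is homogeneous.\<close>
  define Q where "Q x = F x - D / e * exp (e / 2 * x)" for x
  have sub: "{s..t} \<subseteq> {..0}" using t by auto
  have wc: "continuous_on {s..t} w" and pc: "continuous_on {s..t} p"
    using sol continuous_on_subset[OF _ sub] by (auto simp: em_solution_def)
  have "Q t \<le> Q s * exp (- (e / 2) * t - (- (e / 2) * s))"
  proof (rule deriv_le_imp_exp_bound[where P = Q and c = "\<lambda>x. - (e / 2) * x"])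
    show "continuous_on {s..t} Q" unfolding Q_def F_def by (intro continuous_intros wc pc) auto
    fix x assume x: "s < x" "x < t"
    then have x0: "x < 0" and xs: "x \<in> {s..0}" using t by auto
    have dw: "(w has_real_derivative p x) (at x)"
      and dp: "(p has_real_derivative - m * p x - 2 * m * (a (exp x) * exp (w x) - 1)) (at x)"
      using sol x0 by (auto simp: em_solution_def)
    let ?p' = "- m * p x - 2 * m * (a (exp x) * exp (w x) - 1)"
    let ?F' = "p x * ?p' + 2 * m * (exp (w x) - 1) * p x + e * (p x)\<^sup>2 + e * w x * ?p'"
    have dF: "(F has_real_derivative ?F') (at x)"
      unfolding F_def
      by (rule derivative_eq_intros dw dp refl | simp)+ (simp add: power2_eq_square algebra_simps)
    have "((\<lambda>x. F x - D / e * exp (e / 2 * x)) has_real_derivative ?F' - D / e * (exp (e / 2 * x) * (e / 2))) (at x)"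
      by (rule derivative_eq_intros dF refl | simp)+
    moreover have "D / e * (exp (e / 2 * x) * (e / 2)) = D / 2 * exp (e / 2 * x)" using e0 by simp
    ultimately show "(Q has_real_derivative ?F' - D / 2 * exp (e / 2 * x)) (at x)"
      unfolding Q_def by (simp only:)
    show "((\<lambda>x. - (e / 2) * x) has_real_derivative - (e / 2)) (at x)"
      by (rule derivative_eq_intros | simp)+
    \<comment> \<open>For x < 0 the rate of the perturbation is lowered from 1 to e/2, so that its
      response decays towards minus infinity at the same rate as the transient decays
      forwards.\<close>
    have "\<bar>a (exp x) - 1\<bar> \<le> A1 * exp (e / 2 * x)"
    proof -
      have "A1 * exp x \<le> A1 * exp (e / 2 * x)"
        using x0 e0 A1_nonneg by (intro mult_left_mono) auto
      then show ?thesis using a_minus_1_le[of "exp x"] x0 by simp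
    qed
    from lyapunov_dissipation[OF m_bounds(1) R _ _ e this, of "w x" "p x"] bd[OF xs]
    have "?F' \<le> - (e / 2) * F x + D * exp (e / 2 * x)"
      unfolding F_def D_def by (simp add: mult_ac)
    moreover have "- (e / 2) * Q x = - (e / 2) * F x + D / 2 * exp (e / 2 * x)"
      using e0 by (simp add: Q_def algebra_simps)
    ultimately show "?F' - D / 2 * exp (e / 2 * x) \<le> - (e / 2) * Q x" by linarith
  qed (use t in \<open>auto intro!: continuous_intros\<close>)
  also have "\<dots> \<le> (R\<^sup>2 + 2 * m * (exp R + R) + R\<^sup>2) * exp (- (e / 2) * (t - s))"
  proof -
    have b: "\<bar>w s\<bar> \<le> R" "\<bar>p s\<bar> \<le> R" using bd[of s] s by auto
    have "(p s)\<^sup>2 \<le> R\<^sup>2" using b R by (simp add: abs_le_square_iff[symmetric])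
    moreover have "2 * m * (exp (w s) - 1 - w s) \<le> 2 * m * (exp R + R)"
    proof (rule mult_left_mono)
      have "exp (w s) \<le> exp R" using b by simp
      then show "exp (w s) - 1 - w s \<le> exp R + R" using b by linarith
    qed (use m_bounds in simp)
    moreover have "e * w s * p s \<le> R\<^sup>2"
    proof -
      have "\<bar>e * w s * p s\<bar> \<le> 1 * R * R" unfolding abs_mult using b e0 R by (intro mult_mono) auto
      then show ?thesis by (simp add: power2_eq_square)
    qed
    moreover have "0 \<le> D / e * exp (e / 2 * s)" using D0 e0 by simp
    ultimately have "Q s \<le> R\<^sup>2 + 2 * m * (exp R + R) + R\<^sup>2"
      unfolding Q_def F_def using zero_le_power2[of "p s"] by linarith
    then have "Q s * exp (- (e / 2) * (t - s)) \<le> (R\<^sup>2 + 2 * m * (exp R + R) + R\<^sup>2) * exp (- (e / 2) * (t - s))"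
      by (rule mult_right_mono) simp
    then show ?thesis by (simp add: right_diff_distrib)
  qed
  finally have "F t \<le> (R\<^sup>2 + 2 * m * (exp R + R) + R\<^sup>2) * exp (- (e / 2) * (t - s)) + D / e * exp (e / 2 * t)"
    by (simp add: Q_def)
  moreover have "(p t)\<^sup>2 / 4 + 2 * e * (w t)\<^sup>2 \<le> F t"
    unfolding F_def using bd[OF t] by (intro lyapunov_lower[OF m_bounds(1) R _ e]) simp
  ultimately show ?thesis by (simp add: D_def)
qed

text \<open>The first term is the transient of the start at time s and decays forwards; the second
  is the effect of a - 1 and decays towards t = -\<infinity>.\<close>

definition boundary_layer :: "real \<Rightarrow> real \<Rightarrow> real \<Rightarrow> real" where
  "boundary_layer \<kappa> s t = exp (- \<kappa> * (t - s)) + exp (\<kappa> * t)"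

lemma W_decay:
  "\<exists>C \<kappa>. 0 \<le> C \<and> 0 < \<kappa> \<and> \<kappa> \<le> 1 \<and> (\<forall>\<beta>\<ge>0. \<forall>t\<in>{- \<beta> / 2..0}.
    \<bar>W \<beta> t\<bar> \<le> C * boundary_layer \<kappa> (- \<beta> / 2) t \<and> \<bar>Wd \<beta> t\<bar> \<le> C * boundary_layer \<kappa> (- \<beta> / 2) t)"
proof -
  obtain R where R: "0 \<le> R" "\<And>\<beta> t. 0 \<le> \<beta> \<Longrightarrow> t \<in> {- \<beta> / 2..0} \<Longrightarrow> \<bar>W \<beta> t\<bar> \<le> R \<and> \<bar>Wd \<beta> t\<bar> \<le> R"
    using W_bounded by blast
  define e where "e = exp (- R) / 4"
  have e0: "0 < e" "e \<le> 1/4" using R(1) by (auto simp: e_def)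
  define K where "K = (R\<^sup>2 + 2 * m * (exp R + R) + R\<^sup>2) + 4 * m * R * exp R * A1 / e"
  have K1: "0 \<le> R\<^sup>2 + 2 * m * (exp R + R) + R\<^sup>2" "0 \<le> 4 * m * R * exp R * A1 / e"
    using R(1) m_bounds A1_nonneg e0 by auto
  then have K0: "0 \<le> K" by (simp add: K_def)
  define L where "L = K / (2 * e)"
  have L0: "0 \<le> L" using K0 e0 by (simp add: L_def)
  define C where "C = sqrt (4 * K) + sqrt L"
  show ?thesis
  \<comment> \<open>Taking square roots of the quadratic Lyapunov bound halves its rate e/2.\<close>
  proof (rule exI[of _ C], rule exI[of _ "e / 4"], intro conjI allI impI ballI)
    fix \<beta> t :: real assume \<beta>: "0 \<le> \<beta>" and t: "t \<in> {- \<beta> / 2..0}"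
    let ?s = "- \<beta> / 2" and ?b = "boundary_layer (e / 4) (- \<beta> / 2) t"
    define X Y where "X = exp (- (e / 4) * (t - ?s))" and "Y = exp (e / 4 * t)"
    have XY: "0 < X" "0 < Y" "?b = X + Y" by (auto simp: X_def Y_def boundary_layer_def)
    have X2: "exp (- (e / 2) * (t - ?s)) = X\<^sup>2" and Y2: "exp (e / 2 * t) = Y\<^sup>2"
      by (simp_all add: X_def Y_def power2_eq_square algebra_simps flip: exp_add)
    have "(Wd \<beta> t)\<^sup>2 / 4 + 2 * e * (W \<beta> t)\<^sup>2
        \<le> (R\<^sup>2 + 2 * m * (exp R + R) + R\<^sup>2) * X\<^sup>2 + 4 * m * R * exp R * A1 / e * Y\<^sup>2"
      unfolding X2[symmetric] Y2[symmetric]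
      by (rule lyapunov_decay[OF em_solution_W _ R(1) _ e_def t]) (use R(2) \<beta> in auto)
    also have "\<dots> \<le> (R\<^sup>2 + 2 * m * (exp R + R) + R\<^sup>2) * (X + Y)\<^sup>2 + 4 * m * R * exp R * A1 / e * (X + Y)\<^sup>2"
      using K1 XY by (intro add_mono mult_left_mono power_mono) auto
    also have "\<dots> = K * ?b\<^sup>2" unfolding XY(3) by (simp only: K_def distrib_right)
    finally have F: "(Wd \<beta> t)\<^sup>2 / 4 + 2 * e * (W \<beta> t)\<^sup>2 \<le> K * ?b\<^sup>2" .
    have b0: "0 \<le> ?b" using XY by simp
    have "0 \<le> 2 * e * (W \<beta> t)\<^sup>2" using e0 by simp
    with F have "(Wd \<beta> t)\<^sup>2 \<le> 4 * K * ?b\<^sup>2" by linarith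
    then have "sqrt ((Wd \<beta> t)\<^sup>2) \<le> sqrt (4 * K * ?b\<^sup>2)" by (rule real_sqrt_le_mono)
    then have "\<bar>Wd \<beta> t\<bar> \<le> sqrt (4 * K) * ?b" using b0 by (simp add: real_sqrt_mult)
    moreover have "sqrt (4 * K) * ?b \<le> C * ?b"
      unfolding C_def using K0 L0 b0 by (intro mult_right_mono) auto
    ultimately show "\<bar>Wd \<beta> t\<bar> \<le> C * ?b" by linarith
    have "2 * e * (W \<beta> t)\<^sup>2 \<le> K * ?b\<^sup>2" using F zero_le_power2[of "Wd \<beta> t"] by linarith
    then have "(W \<beta> t)\<^sup>2 \<le> L * ?b\<^sup>2" using e0 by (simp add: L_def field_simps)
    then have "sqrt ((W \<beta> t)\<^sup>2) \<le> sqrt (L * ?b\<^sup>2)" by (rule real_sqrt_le_mono)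
    then have "\<bar>W \<beta> t\<bar> \<le> sqrt L * ?b" using b0 by (simp add: real_sqrt_mult)
    moreover have "sqrt L * ?b \<le> C * ?b"
      unfolding C_def using K0 L0 b0 by (intro mult_right_mono) auto
    ultimately show "\<bar>W \<beta> t\<bar> \<le> C * ?b" by linarith
  next
    show "0 \<le> C" using K0 L0 by (simp add: C_def)
  qed (use e0 in auto)
qed

end

section \<open>Differences of solutions\<close>

text \<open>The derivative exp u - 1 of exp u - u is at most exp R * B on [-B,B]. The factor B makes
  the linearisation error as small as the solutions themselves.\<close>

lemma exp_diff_minus_diff_le:
  fixes x y B R :: real
  assumes x: "\<bar>x\<bar> \<le> B" and y: "\<bar>y\<bar> \<le> B" and B: "B \<le> R"
  shows "\<bar>exp x - exp y - (x - y)\<bar> \<le> exp R * B * \<bar>x - y\<bar>"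
proof -
  have "norm ((exp x - x) - (exp y - y)) \<le> exp R * B * norm (x - y)"
  proof (rule field_differentiable_bound[of "{- B..B}" "\<lambda>u. exp u - u" "\<lambda>u. exp u - 1"])
    fix u assume u: "u \<in> {- B..B}"
    show "((\<lambda>u. exp u - u) has_field_derivative exp u - 1) (at u within {- B..B})"
      by (rule derivative_eq_intros | simp)+
    have "\<bar>exp u - exp 0\<bar> \<le> exp R * \<bar>u - 0\<bar>" using u B by (intro exp_diff_le_exp_mult) auto
    also have "\<dots> \<le> exp R * B" using u by (intro mult_left_mono) auto
    finally show "norm (exp u - 1) \<le> exp R * B" by simp
  qed (use x y in auto)
  then show ?thesis by (simp add: algebra_simps)
qed

section \<open>Derivatives of limits and continuity on a half line\<close>

lemma has_real_derivative_sequence: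
  fixes f f' :: "nat \<Rightarrow> real \<Rightarrow> real"
  assumes f: "\<And>n x. x \<in> {u<..<v} \<Longrightarrow> (f n has_real_derivative f' n x) (at x)"
    and lim: "\<And>x. x \<in> {u<..<v} \<Longrightarrow> (\<lambda>n. f n x) \<longlonglongrightarrow> g x"
    and f': "\<And>x. x \<in> {u<..<v} \<Longrightarrow> \<forall>n\<ge>start. \<bar>f' n x - g' x\<bar> \<le> err n"
    and err: "err \<longlonglongrightarrow> 0" and x: "x \<in> {u<..<v}"
  shows "(g has_real_derivative g' x) (at x)"
proof -
  have "\<exists>h. \<forall>y\<in>{u<..<v}. (\<lambda>n. f n y) \<longlonglongrightarrow> h y \<and> (h has_derivative (*) (g' y)) (at y within {u<..<v})"
  proof (rule has_derivative_sequence[where f' = "\<lambda>n y. (*) (f' n y)"])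
    show "(f n has_derivative (*) (f' n y)) (at y within {u<..<v})" if "y \<in> {u<..<v}" for n y
      using f[OF that, of n] by (auto simp: has_field_derivative_def intro: has_derivative_at_withinI)
    show "\<forall>\<^sub>F n in sequentially. \<forall>y\<in>{u<..<v}. \<forall>h. norm (f' n y * h - g' y * h) \<le> e * norm h"
      if e: "0 < e" for e :: real
    proof -
      have "\<forall>\<^sub>F n in sequentially. err n < e" using err e by (rule order_tendstoD)
      then show ?thesis using eventually_ge_at_top[of start]
      proof eventually_elim
        case (elim n)
        show ?case
        proof (intro ballI allI)
          fix y h assume "y \<in> {u<..<v}"
          with f' elim have "\<bar>f' n y - g' y\<bar> \<le> e" by fastforce
          then have "\<bar>f' n y - g' y\<bar> * \<bar>h\<bar> \<le> e * \<bar>h\<bar>" by (rule mult_right_mono) simp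
          then show "norm (f' n y * h - g' y * h) \<le> e * norm h"
            by (simp add: left_diff_distrib[symmetric] abs_mult)
        qed
      qed
    qed
  qed (use lim x in auto)
  then obtain h where h: "\<And>y. y \<in> {u<..<v} \<Longrightarrow> (\<lambda>n. f n y) \<longlonglongrightarrow> h y"
    "\<And>y. y \<in> {u<..<v} \<Longrightarrow> (h has_derivative (*) (g' y)) (at y within {u<..<v})" by blast
  have eq: "h y = g y" if "y \<in> {u<..<v}" for y using LIMSEQ_unique[OF h(1)[OF that] lim[OF that]] .
  have "(h has_real_derivative g' x) (at x)"
    using h(2)[OF x] x by (simp add: has_field_derivative_def at_within_open[of x "{u<..<v}"])
  then show ?thesis
    by (rule has_field_derivative_transform_within_open[OF _ open_greaterThanLessThan x eq])
qed

lemma continuous_on_atMost_0I: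
  fixes f :: "real \<Rightarrow> real"
  assumes "\<And>s. continuous_on {s..0} f"
  shows "continuous_on {..0} f"
  unfolding continuous_on_iff
proof (intro ballI allI impI)
  fix x e :: real assume x: "x \<in> {..0}" and e: "0 < e"
  then have "x \<in> {x - 1..0}" by simp
  then obtain d where d: "0 < d" "\<And>y. y \<in> {x - 1..0} \<Longrightarrow> dist y x < d \<Longrightarrow> dist (f y) (f x) < e"
    using assms[of "x - 1"] e unfolding continuous_on_iff by metis
  have "dist (f y) (f x) < e" if "y \<in> {..0}" "dist y x < min d 1" for y
    using d(2)[of y] that by (auto simp: dist_real_def)
  then show "\<exists>d>0. \<forall>y\<in>{..0}. dist y x < d \<longrightarrow> dist (f y) (f x) < e"
    using d(1) by (intro exI[of _ "min d 1"]) auto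
qed

context gelfand
begin

text \<open>The roots of x^2 + m x + 2m are -m/2 plus or minus i om.\<close>

definition om :: real where "om = sqrt (2 * m - m\<^sup>2 / 4)"

lemma om_pos: "0 < om" and om_sq: "om\<^sup>2 = 2 * m - m\<^sup>2 / 4"
proof -
  have "0 < m * (8 - m) / 4" using m_bounds by simp
  then have "0 < 2 * m - m\<^sup>2 / 4" by (simp add: power2_eq_square algebra_simps)
  then show "0 < om" "om\<^sup>2 = 2 * m - m\<^sup>2 / 4" by (simp_all add: om_def)
qed

definition em_decay :: "real \<Rightarrow> real \<Rightarrow> real \<Rightarrow> (real \<Rightarrow> real) \<Rightarrow> (real \<Rightarrow> real) \<Rightarrow> bool" where
  "em_decay C \<kappa> s w p \<longleftrightarrow> em_solution w p \<and>
    (\<forall>t\<in>{s..0}. \<bar>w t\<bar> \<le> C * boundary_layer \<kappa> s t \<and> \<bar>p t\<bar> \<le> C * boundary_layer \<kappa> s t)"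

definition layer_int :: "real \<Rightarrow> real \<Rightarrow> real \<Rightarrow> real" where
  "layer_int \<kappa> s t = (exp (\<kappa> * t) - exp (- \<kappa> * (t - s))) / \<kappa>"

lemma layer_int_has_derivative:
  assumes "0 < \<kappa>"
  shows "(layer_int \<kappa> s has_real_derivative boundary_layer \<kappa> s t) (at t)"
proof -
  have "((\<lambda>t. exp (\<kappa> * t) - exp (- \<kappa> * (t - s))) has_real_derivative
      \<kappa> * exp (\<kappa> * t) + \<kappa> * exp (- \<kappa> * (t - s))) (at t)"
    by (auto intro!: derivative_eq_intros)
  from DERIV_cdivide[OF this, of \<kappa>] show ?thesis
    using assms by (simp add: layer_int_def[abs_def] boundary_layer_def add_divide_distrib add.commute)
qed

text \<open>The bound on the integral of the boundary layer is independent of s; this is the source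
  of the uniformity in \<beta> from here on.\<close>

lemma layer_int_diff_le:
  assumes "0 < \<kappa>" "s \<le> t" "t \<le> 0"
  shows "layer_int \<kappa> s t - layer_int \<kappa> s s \<le> 2 / \<kappa>"
proof -
  have "exp (\<kappa> * t) \<le> 1" using assms by (simp add: mult_nonneg_nonpos)
  then have "exp (\<kappa> * t) - exp (- \<kappa> * (t - s)) - (exp (\<kappa> * s) - 1) \<le> 2"
    using exp_gt_zero[of "- \<kappa> * (t - s)"] exp_gt_zero[of "\<kappa> * s"] by linarith
  then have "(exp (\<kappa> * t) - exp (- \<kappa> * (t - s)) - (exp (\<kappa> * s) - 1)) / \<kappa> \<le> 2 / \<kappa>"
    using assms by (intro divide_right_mono) auto
  then show ?thesis by (simp add: layer_int_def diff_divide_distrib)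
qed

lemma boundary_layer_bounds:
  assumes "0 < \<kappa>" "\<kappa> \<le> 1" "s \<le> t" "t \<le> 0"
  shows "exp t \<le> boundary_layer \<kappa> s t" "0 \<le> boundary_layer \<kappa> s t" "boundary_layer \<kappa> s t \<le> 2"
proof -
  have "1 * t \<le> \<kappa> * t" using assms by (intro mult_right_mono_neg) auto
  then have "exp t \<le> exp (\<kappa> * t)" by simp
  then show "exp t \<le> boundary_layer \<kappa> s t" "0 \<le> boundary_layer \<kappa> s t"
    by (simp_all add: boundary_layer_def add_increasing)
  have "exp (\<kappa> * t) \<le> 1" "exp (- \<kappa> * (t - s)) \<le> 1"
    using assms by (simp_all add: mult_nonneg_nonpos)
  then show "boundary_layer \<kappa> s t \<le> 2" unfolding boundary_layer_def by linarith
qed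

text \<open>The remainder when the difference of the nonlinear terms is replaced by its
  linearisation at w = 0, a = 1.\<close>

definition defect :: "(real \<Rightarrow> real) \<Rightarrow> (real \<Rightarrow> real) \<Rightarrow> real \<Rightarrow> real" where
  "defect w1 w2 t = a (exp t) * (exp (w1 t) - exp (w2 t)) - (w1 t - w2 t)"

text \<open>The defect splits into the contribution of a - 1, which is O(exp t), and the
  linearisation error, which is O(|w1| + |w2|). Each is a multiple of the boundary layer times |w1 -
  w2|, so the defect acts as a perturbation of the coefficients and not as a forcing term.\<close>

lemma defect_le:
  assumes C: "0 \<le> C" and \<kappa>: "0 < \<kappa>" "\<kappa> \<le> 1"
    and 1: "em_decay C \<kappa> s w1 p1" and 2: "em_decay C \<kappa> s w2 p2" and t: "t \<in> {s..0}"
  shows "\<bar>defect w1 w2 t\<bar> \<le> exp (2 * C) * (A1 + C) * boundary_layer \<kappa> s t * \<bar>w1 t - w2 t\<bar>"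
proof -
  let ?b = "boundary_layer \<kappa> s t"
  have b: "exp t \<le> ?b" "0 \<le> ?b" "?b \<le> 2" using boundary_layer_bounds[OF \<kappa>, of s t] t by auto
  have w: "\<bar>w1 t\<bar> \<le> C * ?b" "\<bar>w2 t\<bar> \<le> C * ?b" using 1 2 t by (auto simp: em_decay_def)
  have Cb: "C * ?b \<le> 2 * C" using b C mult_left_mono[of ?b 2 C] by simp
  have d2: "\<bar>exp (w1 t) - exp (w2 t) - (w1 t - w2 t)\<bar> \<le> exp (2 * C) * (C * ?b) * \<bar>w1 t - w2 t\<bar>"
    by (rule exp_diff_minus_diff_le[OF w Cb])
  have "\<bar>a (exp t) - 1\<bar> \<le> A1 * ?b"
    using a_minus_1_le[of "exp t"] t mult_left_mono[OF b(1) A1_nonneg] by simp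
  moreover have "\<bar>exp (w1 t) - exp (w2 t)\<bar> \<le> exp (2 * C) * \<bar>w1 t - w2 t\<bar>"
    using w Cb by (intro exp_diff_le_exp_mult) auto
  ultimately have "\<bar>a (exp t) - 1\<bar> * \<bar>exp (w1 t) - exp (w2 t)\<bar> \<le> (A1 * ?b) * (exp (2 * C) * \<bar>w1 t - w2 t\<bar>)"
    using A1_nonneg b by (intro mult_mono) auto
  then have d1: "\<bar>(a (exp t) - 1) * (exp (w1 t) - exp (w2 t))\<bar> \<le> (A1 * ?b) * (exp (2 * C) * \<bar>w1 t - w2 t\<bar>)"
    by (simp add: abs_mult)
  have "defect w1 w2 t = (a (exp t) - 1) * (exp (w1 t) - exp (w2 t)) + (exp (w1 t) - exp (w2 t) - (w1 t - w2 t))"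
    by (simp add: defect_def algebra_simps)
  with d1 d2 have "\<bar>defect w1 w2 t\<bar> \<le> (A1 * ?b) * (exp (2 * C) * \<bar>w1 t - w2 t\<bar>) + exp (2 * C) * (C * ?b) * \<bar>w1 t - w2 t\<bar>"
    by linarith
  then show ?thesis by (simp add: algebra_simps)
qed

definition shifted_velocity :: "(real \<Rightarrow> real) \<Rightarrow> (real \<Rightarrow> real) \<Rightarrow> (real \<Rightarrow> real) \<Rightarrow> (real \<Rightarrow> real) \<Rightarrow> real \<Rightarrow> real" where
  "shifted_velocity w1 p1 w2 p2 t = p1 t - p2 t + m / 2 * (w1 t - w2 t)"

lemma difference_has_derivative:
  assumes 1: "em_solution w1 p1" and 2: "em_solution w2 p2" and t: "t < 0"
  shows "((\<lambda>t. w1 t - w2 t) has_real_derivative shifted_velocity w1 p1 w2 p2 t - m / 2 * (w1 t - w2 t)) (at t)"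
    and "(shifted_velocity w1 p1 w2 p2 has_real_derivative
      - (m / 2) * shifted_velocity w1 p1 w2 p2 t - om\<^sup>2 * (w1 t - w2 t) - 2 * m * defect w1 w2 t) (at t)"
proof -
  have d: "(w1 has_real_derivative p1 t) (at t)" "(w2 has_real_derivative p2 t) (at t)"
    "(p1 has_real_derivative - m * p1 t - 2 * m * (a (exp t) * exp (w1 t) - 1)) (at t)"
    "(p2 has_real_derivative - m * p2 t - 2 * m * (a (exp t) * exp (w2 t) - 1)) (at t)"
    using 1 2 t by (auto simp: em_solution_def)
  show "((\<lambda>t. w1 t - w2 t) has_real_derivative shifted_velocity w1 p1 w2 p2 t - m / 2 * (w1 t - w2 t)) (at t)"
    by (rule derivative_eq_intros d refl)+ (simp add: shifted_velocity_def)
  show "(shifted_velocity w1 p1 w2 p2 has_real_derivative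
      - (m / 2) * shifted_velocity w1 p1 w2 p2 t - om\<^sup>2 * (w1 t - w2 t) - 2 * m * defect w1 w2 t) (at t)"
    unfolding shifted_velocity_def
    unfolding om_sq
    by (rule d derivative_eq_intros refl)+
      (simp add: defect_def power2_eq_square algebra_simps diff_divide_distrib add_divide_distrib)
qed

lemma difference_continuous:
  assumes "em_solution w1 p1" "em_solution w2 p2"
  shows "continuous_on {..0} (\<lambda>t. w1 t - w2 t)" "continuous_on {..0} (shifted_velocity w1 p1 w2 p2)"
  using assms unfolding em_solution_def shifted_velocity_def by (auto intro!: continuous_intros)

definition spiral_norm :: "(real \<Rightarrow> real) \<Rightarrow> (real \<Rightarrow> real) \<Rightarrow> (real \<Rightarrow> real) \<Rightarrow> (real \<Rightarrow> real) \<Rightarrow> real \<Rightarrow> real" where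
  "spiral_norm w1 p1 w2 p2 t = (shifted_velocity w1 p1 w2 p2 t)\<^sup>2 + om\<^sup>2 * (w1 t - w2 t)\<^sup>2"

text \<open>The inner factor is that of \<open>defect_le\<close>, 2m is the coefficient of the
  defect in the equation, and dividing by om passes from |z| to the radius, since om |z| is at most
  the radius.\<close>

definition spiral_const :: "real \<Rightarrow> real" where
  "spiral_const C = 2 * m * (exp (2 * C) * (A1 + C)) / om"

text \<open>
  In the variables \<open>y = z' + (m/2) z\<close> and \<open>om * z\<close> the linear part of the equation for a difference \<open>z\<close>
  is a rotation with speed \<open>om\<close> and contraction rate \<open>m/2\<close>; the discriminant condition behind this is
  \<open>m < 8\<close>, that is \<open>N < 10\<close>.
\<close>

lemma spiral_norm_has_derivative:
  assumes C: "0 \<le> C" and \<kappa>: "0 < \<kappa>" "\<kappa> \<le> 1"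
    and 1: "em_decay C \<kappa> s w1 p1" and 2: "em_decay C \<kappa> s w2 p2" and t: "s \<le> t" "t < 0"
  shows "\<exists>P'. (spiral_norm w1 p1 w2 p2 has_real_derivative P') (at t) \<and>
    \<bar>P' + m * spiral_norm w1 p1 w2 p2 t\<bar> \<le> spiral_const C * boundary_layer \<kappa> s t * spiral_norm w1 p1 w2 p2 t"
proof -
  let ?y = "shifted_velocity w1 p1 w2 p2" and ?z = "\<lambda>t. w1 t - w2 t" and ?b = "boundary_layer \<kappa> s t"
  let ?P = "spiral_norm w1 p1 w2 p2"
  have sol: "em_solution w1 p1" "em_solution w2 p2" using 1 2 by (auto simp: em_decay_def)
  note d = difference_has_derivative[OF sol t(2)]
  have "(?P has_real_derivative - m * ?P t - 4 * m * (?y t * defect w1 w2 t)) (at t)"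
    unfolding spiral_norm_def
    by (rule d derivative_eq_intros refl)+
      (simp add: power2_eq_square algebra_simps diff_divide_distrib add_divide_distrib)
  moreover have "\<bar>4 * m * (?y t * defect w1 w2 t)\<bar> \<le> spiral_const C * ?b * ?P t"
  proof -
    define K where "K = exp (2 * C) * (A1 + C)"
    have K: "0 \<le> K" using C A1_nonneg by (simp add: K_def)
    have b: "0 \<le> ?b" using boundary_layer_bounds[OF \<kappa>, of s t] t by auto
    have "\<bar>defect w1 w2 t\<bar> \<le> K * ?b * \<bar>?z t\<bar>"
      using defect_le[OF C \<kappa> 1 2, of t] t by (simp add: K_def)
    then have "\<bar>?y t\<bar> * \<bar>defect w1 w2 t\<bar> \<le> \<bar>?y t\<bar> * (K * ?b * \<bar>?z t\<bar>)" by (rule mult_left_mono) simp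
    then have "4 * m * (\<bar>?y t\<bar> * \<bar>defect w1 w2 t\<bar>) \<le> 4 * m * (\<bar>?y t\<bar> * (K * ?b * \<bar>?z t\<bar>))"
      by (rule mult_left_mono) (use m_bounds in simp)
    also have "\<dots> = 2 * m * K / om * ?b * (2 * \<bar>?y t\<bar> * (om * \<bar>?z t\<bar>))"
      using om_pos by simp
    also have "\<dots> \<le> 2 * m * K / om * ?b * ?P t"
    proof (rule mult_left_mono)
      show "2 * \<bar>?y t\<bar> * (om * \<bar>?z t\<bar>) \<le> ?P t"
        using sum_squares_bound[of "\<bar>?y t\<bar>" "om * \<bar>?z t\<bar>"]
        by (simp add: spiral_norm_def power_mult_distrib)
    qed (use b K m_bounds om_pos in simp)
    finally show ?thesis using m_bounds by (simp add: spiral_const_def K_def abs_mult)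
  qed
  ultimately show ?thesis by (intro exI[of _ "- m * ?P t - 4 * m * (?y t * defect w1 w2 t)"]) auto
qed

text \<open>Gronwall's inequality for the squared radius and for its negative. The relative error
  has integral at most 2 \<open>spiral_const\<close> / \<kappa>, so the decay exp (-m (t - s)) of
  the linear equation is exact up to a factor. The lower bound keeps the trajectory off the
  origin.\<close>

lemma spiral_norm_bounds:
  assumes C: "0 \<le> C" and \<kappa>: "0 < \<kappa>" "\<kappa> \<le> 1"
    and 1: "em_decay C \<kappa> s w1 p1" and 2: "em_decay C \<kappa> s w2 p2" and t: "s \<le> t" "t \<le> 0"
  shows "spiral_norm w1 p1 w2 p2 t \<le> spiral_norm w1 p1 w2 p2 s * exp (2 * spiral_const C / \<kappa>) * exp (- m * (t - s))"
    and "spiral_norm w1 p1 w2 p2 s * exp (- 2 * spiral_const C / \<kappa>) * exp (- m * (t - s)) \<le> spiral_norm w1 p1 w2 p2 t"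
proof -
  let ?P = "spiral_norm w1 p1 w2 p2" and ?K = "spiral_const C"
  define P' where "P' x = (SOME D. (?P has_real_derivative D) (at x) \<and>
    \<bar>D + m * ?P x\<bar> \<le> ?K * boundary_layer \<kappa> s x * ?P x)" for x
  have P': "(?P has_real_derivative P' x) (at x) \<and> \<bar>P' x + m * ?P x\<bar> \<le> ?K * boundary_layer \<kappa> s x * ?P x"
    if "s < x" "x < t" for x
    unfolding P'_def using that t spiral_norm_has_derivative[OF C \<kappa> 1 2, of x]
    by (intro someI_ex[where P = "\<lambda>D. (?P has_real_derivative D) (at x) \<and>
      \<bar>D + m * ?P x\<bar> \<le> ?K * boundary_layer \<kappa> s x * ?P x"]) auto
  have K: "0 \<le> ?K" using C A1_nonneg m_bounds om_pos by (simp add: spiral_const_def)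
  have P0: "0 \<le> ?P x" for x by (simp add: spiral_norm_def)
  have "em_solution w1 p1" "em_solution w2 p2" using 1 2 by (auto simp: em_decay_def)
  note dc = difference_continuous[OF this]
  have contP: "continuous_on {s..t} ?P"
    unfolding spiral_norm_def by (intro continuous_intros continuous_on_subset[OF dc(1)] continuous_on_subset[OF dc(2)]) (use t in auto)
  have contL: "continuous_on {s..t} (layer_int \<kappa> s)"
    unfolding layer_int_def using \<kappa> by (intro continuous_intros) auto
  have L: "?K * (layer_int \<kappa> s t - layer_int \<kappa> s s) \<le> 2 * ?K / \<kappa>"
    using mult_left_mono[OF layer_int_diff_le[OF \<kappa>(1) t] K] by (simp add: mult.commute)
  have "?P t \<le> ?P s * exp ((- m * t + ?K * layer_int \<kappa> s t) - (- m * s + ?K * layer_int \<kappa> s s))"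
  proof (rule deriv_le_imp_exp_bound[where P = ?P and c = "\<lambda>x. - m * x + ?K * layer_int \<kappa> s x", OF t(1) contP])
    show "continuous_on {s..t} (\<lambda>x. - m * x + ?K * layer_int \<kappa> s x)" by (intro continuous_intros contL)
    fix x assume x: "s < x" "x < t"
    show "(?P has_real_derivative P' x) (at x)" using P'[OF x] by blast
    show "((\<lambda>x. - m * x + ?K * layer_int \<kappa> s x) has_real_derivative - m + ?K * boundary_layer \<kappa> s x) (at x)"
      by (rule derivative_eq_intros layer_int_has_derivative[OF \<kappa>(1)] refl | simp)+
    show "P' x \<le> (- m + ?K * boundary_layer \<kappa> s x) * ?P x"
      using abs_le_D1[OF conjunct2[OF P'[OF x]]] by (simp add: algebra_simps)
  qed
  also have "(- m * t + ?K * layer_int \<kappa> s t) - (- m * s + ?K * layer_int \<kappa> s s)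
      = ?K * (layer_int \<kappa> s t - layer_int \<kappa> s s) + - m * (t - s)"
    by (simp add: algebra_simps)
  also have "?P s * exp \<dots> \<le> ?P s * exp (2 * ?K / \<kappa> + - m * (t - s))"
    using L P0 by (intro mult_left_mono) auto
  finally show "?P t \<le> ?P s * exp (2 * ?K / \<kappa>) * exp (- m * (t - s))" by (simp only: exp_add mult.assoc)
  have "- ?P t \<le> - ?P s * exp ((- m * t - ?K * layer_int \<kappa> s t) - (- m * s - ?K * layer_int \<kappa> s s))"
  proof (rule deriv_le_imp_exp_bound[where P = "\<lambda>x. - ?P x" and P' = "\<lambda>x. - P' x"
        and c = "\<lambda>x. - m * x - ?K * layer_int \<kappa> s x", OF t(1)])
    show "continuous_on {s..t} (\<lambda>x. - ?P x)" by (intro continuous_intros contP)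
    show "continuous_on {s..t} (\<lambda>x. - m * x - ?K * layer_int \<kappa> s x)" by (intro continuous_intros contL)
    fix x assume x: "s < x" "x < t"
    show "((\<lambda>x. - ?P x) has_real_derivative - P' x) (at x)" using P'[OF x] by (intro DERIV_minus) blast
    show "((\<lambda>x. - m * x - ?K * layer_int \<kappa> s x) has_real_derivative - m - ?K * boundary_layer \<kappa> s x) (at x)"
      by (rule derivative_eq_intros layer_int_has_derivative[OF \<kappa>(1)] refl | simp)+
    show "- P' x \<le> (- m - ?K * boundary_layer \<kappa> s x) * - ?P x"
      using abs_le_D2[OF conjunct2[OF P'[OF x]]] by (simp add: algebra_simps)
  qed
  also have "(- m * t - ?K * layer_int \<kappa> s t) - (- m * s - ?K * layer_int \<kappa> s s)
      = - (?K * (layer_int \<kappa> s t - layer_int \<kappa> s s)) + - m * (t - s)"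
    by (simp add: algebra_simps)
  finally have "?P s * exp (- (?K * (layer_int \<kappa> s t - layer_int \<kappa> s s)) + - m * (t - s)) \<le> ?P t" by simp
  moreover have "?P s * exp (- 2 * ?K / \<kappa> + - m * (t - s))
      \<le> ?P s * exp (- (?K * (layer_int \<kappa> s t - layer_int \<kappa> s s)) + - m * (t - s))"
    using L P0 by (intro mult_left_mono) auto
  ultimately have "?P s * exp (- 2 * ?K / \<kappa> + - m * (t - s)) \<le> ?P t" by linarith
  then show "?P s * exp (- 2 * ?K / \<kappa>) * exp (- m * (t - s)) \<le> ?P t" by (simp only: exp_add mult.assoc)
qed

text \<open>The squared radius is bounded at time s and decays at rate m \<ge> 1, so the radius
  decays at least at rate 1/2. The constant depends on C and \<kappa> but not on s.\<close>

lemma difference_decay: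
  assumes C: "0 \<le> C" and \<kappa>: "0 < \<kappa>" "\<kappa> \<le> 1"
  shows "\<exists>B\<ge>0. \<forall>s w1 p1 w2 p2. em_decay C \<kappa> s w1 p1 \<longrightarrow> em_decay C \<kappa> s w2 p2 \<longrightarrow>
    (\<forall>t\<in>{s..0}. \<bar>w1 t - w2 t\<bar> \<le> B * exp (- (t - s) / 2) \<and> \<bar>p1 t - p2 t\<bar> \<le> B * exp (- (t - s) / 2))"
proof -
  \<comment> \<open>At time s the boundary layer is at most 2, so each function is at most 2C and
    each difference at most 4C.\<close>
  define P0 where "P0 = (4 * C + m / 2 * (4 * C))\<^sup>2 + om\<^sup>2 * (4 * C)\<^sup>2"
  define Q where "Q = sqrt (P0 * exp (2 * spiral_const C / \<kappa>))"
  define B where "B = Q / om + Q * (1 + m / (2 * om))"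
  have Q: "0 \<le> Q" by (simp add: Q_def P0_def)
  have parts: "0 \<le> Q / om" "0 \<le> Q * (1 + m / (2 * om))" using Q om_pos m_bounds by auto
  have main: "\<bar>w1 t - w2 t\<bar> \<le> B * exp (- (t - s) / 2) \<and> \<bar>p1 t - p2 t\<bar> \<le> B * exp (- (t - s) / 2)"
    if 1: "em_decay C \<kappa> s w1 p1" and 2: "em_decay C \<kappa> s w2 p2" and t: "t \<in> {s..0}" for s w1 p1 w2 p2 t
  proof -
    let ?y = "shifted_velocity w1 p1 w2 p2" and ?z = "\<lambda>t. w1 t - w2 t"
    let ?P = "spiral_norm w1 p1 w2 p2" and ?E = "exp (- (t - s) / 2)"
    have s: "s \<in> {s..0}" and st: "s \<le> t" "t \<le> 0" using t by auto
    have "C * boundary_layer \<kappa> s s \<le> C * 2"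
      using boundary_layer_bounds[OF \<kappa>, of s s] s C by (intro mult_left_mono) auto
    moreover have "\<bar>w1 s\<bar> \<le> C * boundary_layer \<kappa> s s \<and> \<bar>p1 s\<bar> \<le> C * boundary_layer \<kappa> s s"
      "\<bar>w2 s\<bar> \<le> C * boundary_layer \<kappa> s s \<and> \<bar>p2 s\<bar> \<le> C * boundary_layer \<kappa> s s"
      using 1 2 s by (auto simp: em_decay_def)
    ultimately have zs: "\<bar>?z s\<bar> \<le> 4 * C" and ps: "\<bar>p1 s - p2 s\<bar> \<le> 4 * C" by linarith+
    have "m / 2 * \<bar>?z s\<bar> \<le> m / 2 * (4 * C)" using zs m_bounds by (intro mult_left_mono) auto
    then have "\<bar>m / 2 * ?z s\<bar> \<le> m / 2 * (4 * C)" using m_bounds by (simp add: abs_mult)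
    then have "\<bar>?y s\<bar> \<le> 4 * C + m / 2 * (4 * C)" using ps unfolding shifted_velocity_def by linarith
    then have "(?y s)\<^sup>2 \<le> (4 * C + m / 2 * (4 * C))\<^sup>2" by (rule abs_le_square_iff[THEN iffD1, OF order_trans[OF _ abs_ge_self]])
    moreover have "(?z s)\<^sup>2 \<le> (4 * C)\<^sup>2" using zs by (rule abs_le_square_iff[THEN iffD1, OF order_trans[OF _ abs_ge_self]])
    then have "om\<^sup>2 * (?z s)\<^sup>2 \<le> om\<^sup>2 * (4 * C)\<^sup>2" by (rule mult_left_mono) simp
    ultimately have Ps: "?P s \<le> P0" by (simp add: spiral_norm_def P0_def)
    have "?P t \<le> ?P s * exp (2 * spiral_const C / \<kappa>) * exp (- m * (t - s))"
      by (rule spiral_norm_bounds(1)[OF C \<kappa> 1 2 st])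
    also have "\<dots> \<le> P0 * exp (2 * spiral_const C / \<kappa>) * exp (- 1 * (t - s))"
    proof (intro mult_mono Ps)
      have "- m * (t - s) \<le> - 1 * (t - s)" using m_bounds st by (intro mult_right_mono) auto
      then show "exp (- m * (t - s)) \<le> exp (- 1 * (t - s))" by simp
    qed (simp_all add: P0_def)
    also have "exp (- 1 * (t - s)) = ?E\<^sup>2" by (simp add: power2_eq_square flip: exp_add)
    finally have "sqrt (?P t) \<le> sqrt (P0 * exp (2 * spiral_const C / \<kappa>) * ?E\<^sup>2)" by (rule real_sqrt_le_mono)
    then have sP: "sqrt (?P t) \<le> Q * ?E" by (simp add: Q_def real_sqrt_mult)
    have "sqrt ((?y t)\<^sup>2) \<le> sqrt (?P t)" unfolding spiral_norm_def by (intro real_sqrt_le_mono) simp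
    then have y: "\<bar>?y t\<bar> \<le> Q * ?E" using sP by simp
    have "sqrt (om\<^sup>2 * (?z t)\<^sup>2) \<le> sqrt (?P t)" unfolding spiral_norm_def by (intro real_sqrt_le_mono) simp
    then have "om * \<bar>?z t\<bar> \<le> Q * ?E" using sP om_pos by (simp add: real_sqrt_mult)
    then have z: "\<bar>?z t\<bar> \<le> Q / om * ?E" using om_pos by (simp add: field_simps)
    then have "m / 2 * \<bar>?z t\<bar> \<le> m / 2 * (Q / om * ?E)" using m_bounds by (intro mult_left_mono) auto
    then have "\<bar>m / 2 * ?z t\<bar> \<le> m / 2 * (Q / om * ?E)" using m_bounds by (simp add: abs_mult)
    then have "\<bar>p1 t - p2 t\<bar> \<le> Q * ?E + m / 2 * (Q / om * ?E)"
      using y unfolding shifted_velocity_def by linarith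
    also have "\<dots> = Q * (1 + m / (2 * om)) * ?E" using om_pos by (simp add: field_simps)
    also have "\<dots> \<le> B * ?E" using parts unfolding B_def by (intro mult_right_mono) auto
    finally have "\<bar>p1 t - p2 t\<bar> \<le> B * ?E" .
    moreover have "Q / om * ?E \<le> B * ?E" using parts unfolding B_def by (intro mult_right_mono) auto
    ultimately show ?thesis using z by linarith
  qed
  show ?thesis using main parts by (intro exI[of _ B]) (auto simp: B_def)
qed

end

section \<open>The singular solution\<close>

lemma convergent_of_tail_bound:
  fixes X :: "nat \<Rightarrow> real"
  assumes bd: "\<And>k n. \<lbrakk>k0 \<le> k; k \<le> n\<rbrakk> \<Longrightarrow> \<bar>X k - X n\<bar> \<le> err k" and err: "err \<longlonglongrightarrow> 0"
  shows "X \<longlonglongrightarrow> lim X"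
proof -
  have "Cauchy X"
  proof (rule metric_CauchyI)
    fix e :: real assume "0 < e"
    then have "\<forall>\<^sub>F n in sequentially. err n < e / 2" using err by (intro order_tendstoD) auto
    then obtain M where M: "\<And>n. n \<ge> M \<Longrightarrow> err n < e / 2" unfolding eventually_sequentially by blast
    define K where "K = max M k0"
    have "dist (X i) (X j) < e" if "K \<le> i" "K \<le> j" for i j
      using bd[of K i] bd[of K j] M[of K] that by (simp add: K_def dist_real_def)
    then show "\<exists>M. \<forall>i\<ge>M. \<forall>j\<ge>M. dist (X i) (X j) < e" by blast
  qed
  then show ?thesis using Cauchy_convergent_iff convergent_LIMSEQ_iff by blast
qed

lemma continuous_on_of_uniform_bound:
  fixes f :: "nat \<Rightarrow> real \<Rightarrow> real"
  assumes cont: "\<And>n. continuous_on S (f n)" and err: "err \<longlonglongrightarrow> 0"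
    and bd: "\<And>n x. \<lbrakk>n0 \<le> n; x \<in> S\<rbrakk> \<Longrightarrow> \<bar>f n x - g x\<bar> \<le> err n"
  shows "continuous_on S g"
proof (rule uniform_limit_theorem[OF _ _ sequentially_bot])
  show "uniform_limit S f g sequentially"
  proof (rule uniform_limitI)
    fix e :: real assume "0 < e"
    with err have "\<forall>\<^sub>F n in sequentially. err n < e" by (rule order_tendstoD)
    then show "\<forall>\<^sub>F n in sequentially. \<forall>x\<in>S. dist (f n x) (g x) < e"
      using eventually_ge_at_top[of n0]
      by eventually_elim (use bd in \<open>force simp: dist_real_def\<close>)
  qed
qed (simp add: cont)

context gelfand
begin

lemma W_family:
  "\<exists>C \<kappa> B. 0 \<le> C \<and> 0 < \<kappa> \<and> \<kappa> \<le> 1 \<and> 0 \<le> B \<and>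
    (\<forall>\<beta>\<ge>0. em_decay C \<kappa> (- \<beta> / 2) (W \<beta>) (Wd \<beta>)) \<and>
    (\<forall>\<beta> \<gamma> t. 0 \<le> \<beta> \<longrightarrow> \<beta> \<le> \<gamma> \<longrightarrow> t \<in> {- \<beta> / 2..0} \<longrightarrow>
      \<bar>W \<beta> t - W \<gamma> t\<bar> \<le> B * exp (- (t + \<beta> / 2) / 2) \<and> \<bar>Wd \<beta> t - Wd \<gamma> t\<bar> \<le> B * exp (- (t + \<beta> / 2) / 2))"
proof -
  obtain C \<kappa> where C: "0 \<le> C" and \<kappa>: "0 < \<kappa>" "\<kappa> \<le> 1" and dec: "\<And>\<beta> t. \<lbrakk>0 \<le> \<beta>; t \<in> {- \<beta> / 2..0}\<rbrakk> \<Longrightarrow>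
      \<bar>W \<beta> t\<bar> \<le> C * boundary_layer \<kappa> (- \<beta> / 2) t \<and> \<bar>Wd \<beta> t\<bar> \<le> C * boundary_layer \<kappa> (- \<beta> / 2) t"
    using W_decay by metis
  \<comment> \<open>A solution with larger parameter starts earlier, so its transient is already
    smaller; both solutions can then be compared from the later start -\<beta>/2.\<close>
  have ed: "em_decay C \<kappa> (- \<beta> / 2) (W \<gamma>) (Wd \<gamma>)" if "0 \<le> \<beta>" "\<beta> \<le> \<gamma>" for \<beta> \<gamma>
    unfolding em_decay_def
  proof (intro conjI ballI em_solution_W)
    fix t assume t: "t \<in> {- \<beta> / 2..0}"
    have "- \<kappa> * (t - - \<gamma> / 2) \<le> - \<kappa> * (t - - \<beta> / 2)"
      using that \<kappa> by (intro mult_left_mono_neg) auto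
    then have "boundary_layer \<kappa> (- \<gamma> / 2) t \<le> boundary_layer \<kappa> (- \<beta> / 2) t"
      unfolding boundary_layer_def by (intro add_mono) auto
    then have "C * boundary_layer \<kappa> (- \<gamma> / 2) t \<le> C * boundary_layer \<kappa> (- \<beta> / 2) t"
      using C by (rule mult_left_mono)
    moreover have "t \<in> {- \<gamma> / 2..0}" "0 \<le> \<gamma>" using t that by auto
    note dec[OF this(2,1)]
    ultimately show "\<bar>W \<gamma> t\<bar> \<le> C * boundary_layer \<kappa> (- \<beta> / 2) t" "\<bar>Wd \<gamma> t\<bar> \<le> C * boundary_layer \<kappa> (- \<beta> / 2) t"
      by linarith+
  qed
  obtain B where B: "0 \<le> B" "\<And>s w1 p1 w2 p2 t. \<lbrakk>em_decay C \<kappa> s w1 p1; em_decay C \<kappa> s w2 p2; t \<in> {s..0}\<rbrakk> \<Longrightarrow>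
      \<bar>w1 t - w2 t\<bar> \<le> B * exp (- (t - s) / 2) \<and> \<bar>p1 t - p2 t\<bar> \<le> B * exp (- (t - s) / 2)"
    using difference_decay[OF C \<kappa>] by metis
  have "\<bar>W \<beta> t - W \<gamma> t\<bar> \<le> B * exp (- (t + \<beta> / 2) / 2) \<and> \<bar>Wd \<beta> t - Wd \<gamma> t\<bar> \<le> B * exp (- (t + \<beta> / 2) / 2)"
    if "0 \<le> \<beta>" "\<beta> \<le> \<gamma>" "t \<in> {- \<beta> / 2..0}" for \<beta> \<gamma> t
    using B(2)[OF ed[of \<beta> \<beta>] ed[of \<beta> \<gamma>], of t] that by simp
  with C \<kappa> B(1) ed show ?thesis by (intro exI[of _ C] exI[of _ \<kappa>] exI[of _ B]) auto
qed

lemma layer_tail_tendsto_0: "(\<lambda>n. B * exp (- (u + real n / 2) / 2)) \<longlonglongrightarrow> 0" for B u :: real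
proof -
  have eq: "B * exp (- (u + real n / 2) / 2) = B * exp (- u / 2) * exp (- 1 / 4) ^ n" for n
    by (simp add: exp_of_nat_mult[symmetric] field_simps flip: exp_add)
  have "(\<lambda>n. exp (- 1 / 4 :: real) ^ n) \<longlonglongrightarrow> 0" by (intro LIMSEQ_realpow_zero) auto
  then show ?thesis unfolding eq by (rule tendsto_mult_right_zero)
qed

text \<open>The differences at a fixed time decay exponentially in the smaller parameter, so the
  solutions with integer parameter are locally uniformly Cauchy. The equation passes to the limit,
  and the transient in the decay bound disappears.\<close>

lemma singular_solution:
  "\<exists>C \<kappa> B w p. 0 \<le> C \<and> 0 < \<kappa> \<and> \<kappa> \<le> 1 \<and> 0 \<le> B \<and>
    (\<forall>\<beta>\<ge>0. em_decay C \<kappa> (- \<beta> / 2) (W \<beta>) (Wd \<beta>) \<and> em_decay C \<kappa> (- \<beta> / 2) w p) \<and>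
    (\<forall>t\<le>0. \<bar>w t\<bar> \<le> C * exp (\<kappa> * t)) \<and>
    (\<forall>\<beta>\<ge>0. \<forall>t\<in>{- \<beta> / 2..0}. \<bar>W \<beta> t - w t\<bar> \<le> B * exp (- (t + \<beta> / 2) / 2))"
proof -
  obtain C \<kappa> B where C: "0 \<le> C" and \<kappa>: "0 < \<kappa>" "\<kappa> \<le> 1" and B: "0 \<le> B"
    and ed: "\<And>\<beta>. 0 \<le> \<beta> \<Longrightarrow> em_decay C \<kappa> (- \<beta> / 2) (W \<beta>) (Wd \<beta>)"
    and diff: "\<And>\<beta> \<gamma> t. \<lbrakk>0 \<le> \<beta>; \<beta> \<le> \<gamma>; t \<in> {- \<beta> / 2..0}\<rbrakk> \<Longrightarrow>
      \<bar>W \<beta> t - W \<gamma> t\<bar> \<le> B * exp (- (t + \<beta> / 2) / 2) \<and> \<bar>Wd \<beta> t - Wd \<gamma> t\<bar> \<le> B * exp (- (t + \<beta> / 2) / 2)"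
    using W_family by metis
  define w p where "w t = lim (\<lambda>n. W (real n) t)" and "p t = lim (\<lambda>n. Wd (real n) t)" for t
  have wl: "(\<lambda>n. W (real n) t) \<longlonglongrightarrow> w t" and pl: "(\<lambda>n. Wd (real n) t) \<longlonglongrightarrow> p t" if t: "t \<le> 0" for t
  proof -
    obtain k0 :: nat where k0: "- 2 * t \<le> real k0" using real_arch_simple by blast
    have "\<bar>W (real k) t - W (real n) t\<bar> \<le> B * exp (- (t + real k / 2) / 2) \<and>
        \<bar>Wd (real k) t - Wd (real n) t\<bar> \<le> B * exp (- (t + real k / 2) / 2)"
      if "k0 \<le> k" "k \<le> n" for k n
      using that k0 t of_nat_mono[OF that(1), where 'a = real] by (intro diff) auto
    then show "(\<lambda>n. W (real n) t) \<longlonglongrightarrow> w t" "(\<lambda>n. Wd (real n) t) \<longlonglongrightarrow> p t"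
      unfolding w_def p_def
      by (auto intro!: convergent_of_tail_bound[OF _ layer_tail_tendsto_0[of B t], of k0])
  qed
  \<comment> \<open>The larger parameter tends to infinity through the integers while \<beta> stays
    real; this upgrades convergence along integers to convergence in \<beta>.\<close>
  have err: "\<bar>W \<beta> t - w t\<bar> \<le> B * exp (- (t + \<beta> / 2) / 2) \<and> \<bar>Wd \<beta> t - p t\<bar> \<le> B * exp (- (t + \<beta> / 2) / 2)"
    if \<beta>: "0 \<le> \<beta>" and t: "t \<in> {- \<beta> / 2..0}" for \<beta> t
  proof -
    obtain k0 :: nat where k0: "\<beta> \<le> real k0" using real_arch_simple by blast
    then have n: "\<beta> \<le> real n" if "k0 \<le> n" for n using that of_nat_mono[OF that, where 'a = real] by linarith
    have "(\<lambda>n. \<bar>W \<beta> t - W (real n) t\<bar>) \<longlonglongrightarrow> \<bar>W \<beta> t - w t\<bar>"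
      "(\<lambda>n. \<bar>Wd \<beta> t - Wd (real n) t\<bar>) \<longlonglongrightarrow> \<bar>Wd \<beta> t - p t\<bar>"
      using t by (intro tendsto_intros wl pl; simp)+
    then show ?thesis using diff[OF \<beta> n t] by (blast intro: LIMSEQ_le_const2)
  qed
  have lim0: "\<bar>w t\<bar> \<le> C * exp (\<kappa> * t) \<and> \<bar>p t\<bar> \<le> C * exp (\<kappa> * t)" if t: "t \<le> 0" for t
  proof -
    have "(\<lambda>n. exp (- \<kappa> * (t + real n / 2))) \<longlonglongrightarrow> 0"
    proof -
      have eq: "exp (- \<kappa> * (t + real n / 2)) = exp (- \<kappa> * t) * exp (- \<kappa> / 2) ^ n" for n
        by (simp add: exp_of_nat_mult[symmetric] field_simps flip: exp_add)
      have "(\<lambda>n. exp (- \<kappa> / 2) ^ n) \<longlonglongrightarrow> 0" using \<kappa> by (intro LIMSEQ_realpow_zero) auto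
      then show ?thesis unfolding eq by (rule tendsto_mult_right_zero)
    qed
    then have "(\<lambda>n. C * (exp (- \<kappa> * (t + real n / 2)) + exp (\<kappa> * t))) \<longlonglongrightarrow> C * (0 + exp (\<kappa> * t))"
      by (intro tendsto_intros)
    then have rhs: "(\<lambda>n. C * boundary_layer \<kappa> (- real n / 2) t) \<longlonglongrightarrow> C * exp (\<kappa> * t)"
      by (simp add: boundary_layer_def)
    obtain k0 :: nat where k0: "- 2 * t \<le> real k0" using real_arch_simple by blast
    have "\<bar>W (real n) t\<bar> \<le> C * boundary_layer \<kappa> (- real n / 2) t \<and> \<bar>Wd (real n) t\<bar> \<le> C * boundary_layer \<kappa> (- real n / 2) t"
      if "k0 \<le> n" for n
    proof -
      have "t \<in> {- real n / 2..0}" using that k0 t of_nat_mono[OF that, where 'a = real] by auto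
      then show ?thesis using ed[of "real n"] by (simp add: em_decay_def)
    qed
    moreover have "(\<lambda>n. \<bar>W (real n) t\<bar>) \<longlonglongrightarrow> \<bar>w t\<bar>" "(\<lambda>n. \<bar>Wd (real n) t\<bar>) \<longlonglongrightarrow> \<bar>p t\<bar>"
      by (intro tendsto_intros wl pl t)+
    ultimately show ?thesis using rhs by (blast intro: LIMSEQ_le)
  qed
  have uerr: "\<bar>W (real n) t - w t\<bar> \<le> B * exp (- (u + real n / 2) / 2) \<and> \<bar>Wd (real n) t - p t\<bar> \<le> B * exp (- (u + real n / 2) / 2)"
    if "nat \<lceil>- 2 * u\<rceil> \<le> n" "t \<in> {u..0}" for u t n
  proof -
    have "- 2 * u \<le> real n" using that(1) by linarith
    then have "t \<in> {- real n / 2..0}" using that(2) by auto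
    note err[OF _ this]
    moreover have "B * exp (- (t + real n / 2) / 2) \<le> B * exp (- (u + real n / 2) / 2)"
      using that(2) B by (intro mult_left_mono) auto
    ultimately show ?thesis by (meson of_nat_0_le_iff order_trans)
  qed
  have sol: "em_solution w p"
    unfolding em_solution_def
  proof (intro conjI allI impI)
    have c: "continuous_on {u..0} (W (real n))" "continuous_on {u..0} (Wd (real n))" for u n
      using em_solution_W[of "real n"] by (auto simp: em_solution_def intro: continuous_on_subset)
    show "continuous_on {..0} w"
      by (rule continuous_on_atMost_0I, rule continuous_on_of_uniform_bound[OF c(1) layer_tail_tendsto_0])
        (use uerr in blast)
    show "continuous_on {..0} p"
      by (rule continuous_on_atMost_0I, rule continuous_on_of_uniform_bound[OF c(2) layer_tail_tendsto_0])
        (use uerr in blast)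
  next
    fix t :: real assume t: "t < 0"
    have dW: "(W (real n) has_real_derivative Wd (real n) x) (at x)"
      "(Wd (real n) has_real_derivative - m * Wd (real n) x - 2 * m * (a (exp x) * exp (W (real n) x) - 1)) (at x)"
      if "x \<in> {t - 1<..<0}" for n x
      using em_solution_W[of "real n"] that by (auto simp: em_solution_def)
    let ?err = "\<lambda>n. B * exp (- (t - 1 + real n / 2) / 2)"
    let ?k0 = "nat \<lceil>- 2 * (t - 1)\<rceil>"
    show "(w has_real_derivative p t) (at t)"
    proof (rule has_real_derivative_sequence[where u = "t - 1" and v = 0 and err = ?err and start = ?k0])
      show "(W (real n) has_real_derivative Wd (real n) x) (at x)" if "x \<in> {t - 1<..<0}" for n x
        by (rule dW(1)[OF that])
      show "\<forall>n\<ge>?k0. \<bar>Wd (real n) x - p x\<bar> \<le> ?err n" if "x \<in> {t - 1<..<0}" for x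
        using uerr[of "t - 1" _ x] that by simp
      show "?err \<longlonglongrightarrow> 0" by (rule layer_tail_tendsto_0)
    qed (use wl t in auto)
    \<comment> \<open>A Lipschitz constant of the right side of the equation on the region w \<le>
      2C, which contains all functions compared here.\<close>
    define K where "K = m + 2 * m * (A * exp (2 * C))"
    show "(p has_real_derivative - m * p t - 2 * m * (a (exp t) * exp (w t) - 1)) (at t)"
    proof (rule has_real_derivative_sequence[where u = "t - 1" and v = 0 and err = "\<lambda>n. K * ?err n" and start = ?k0])
      show "(Wd (real n) has_real_derivative - m * Wd (real n) x - 2 * m * (a (exp x) * exp (W (real n) x) - 1)) (at x)"
        if "x \<in> {t - 1<..<0}" for n x by (rule dW(2)[OF that])
      show "(\<lambda>n. K * ?err n) \<longlonglongrightarrow> 0" using layer_tail_tendsto_0 by (rule tendsto_mult_right_zero)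
      show "\<forall>n\<ge>?k0. \<bar>- m * Wd (real n) x - 2 * m * (a (exp x) * exp (W (real n) x) - 1)
          - (- m * p x - 2 * m * (a (exp x) * exp (w x) - 1))\<bar> \<le> K * ?err n"
        if x: "x \<in> {t - 1<..<0}" for x
      proof (intro allI impI)
        fix n assume n: "?k0 \<le> n"
        have "- 2 * (t - 1) \<le> real n" using n by linarith
        then have xn: "x \<in> {- real n / 2..0}" using x by auto
        have e: "\<bar>W (real n) x - w x\<bar> \<le> ?err n" "\<bar>Wd (real n) x - p x\<bar> \<le> ?err n"
          using uerr[OF n, of x] x by auto
        have "C * boundary_layer \<kappa> (- real n / 2) x \<le> C * 2"
          using boundary_layer_bounds[OF \<kappa>, of "- real n / 2" x] xn C by (intro mult_left_mono) auto
        then have b1: "W (real n) x \<le> 2 * C" using ed[of "real n"] xn by (force simp: em_decay_def)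
        have "C * exp (\<kappa> * x) \<le> C * 1" using C \<kappa> x by (intro mult_left_mono) (auto simp: mult_nonneg_nonpos)
        then have b2: "w x \<le> 2 * C" using lim0[of x] x C by auto
        have "\<bar>a (exp x) * exp (W (real n) x) - a (exp x) * exp (w x)\<bar> \<le> A * exp (2 * C) * ?err n * 1"
          by (rule nonlinearity_diff_le[OF b1 b2]) (use e x in auto)
        then have "2 * m * \<bar>a (exp x) * exp (W (real n) x) - a (exp x) * exp (w x)\<bar> \<le> 2 * m * (A * exp (2 * C) * ?err n * 1)"
          by (rule mult_left_mono) (use m_bounds in simp)
        moreover have "m * \<bar>Wd (real n) x - p x\<bar> \<le> m * ?err n"
          using e(2) by (rule mult_left_mono) (use m_bounds in simp)
        moreover have "- m * Wd (real n) x - 2 * m * (a (exp x) * exp (W (real n) x) - 1)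
            - (- m * p x - 2 * m * (a (exp x) * exp (w x) - 1))
          = - (m * (Wd (real n) x - p x)) - 2 * m * (a (exp x) * exp (W (real n) x) - a (exp x) * exp (w x))"
          by (simp add: algebra_simps)
        moreover have "\<bar>m * (Wd (real n) x - p x)\<bar> = m * \<bar>Wd (real n) x - p x\<bar>"
          "\<bar>2 * m * (a (exp x) * exp (W (real n) x) - a (exp x) * exp (w x))\<bar>
            = 2 * m * \<bar>a (exp x) * exp (W (real n) x) - a (exp x) * exp (w x)\<bar>"
          using m_bounds by (simp_all add: abs_mult)
        moreover have "K * ?err n = m * ?err n + 2 * m * (A * exp (2 * C) * ?err n * 1)"
          by (simp add: K_def algebra_simps)
        ultimately show "\<bar>- m * Wd (real n) x - 2 * m * (a (exp x) * exp (W (real n) x) - 1)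
            - (- m * p x - 2 * m * (a (exp x) * exp (w x) - 1))\<bar> \<le> K * ?err n"
          by linarith
      qed
    qed (use pl t in auto)
  qed
  have "em_decay C \<kappa> (- \<beta> / 2) w p" if "0 \<le> \<beta>" for \<beta>
    unfolding em_decay_def
  proof (intro conjI ballI sol)
    fix t assume t: "t \<in> {- \<beta> / 2..0}"
    have "C * exp (\<kappa> * t) \<le> C * boundary_layer \<kappa> (- \<beta> / 2) t"
      using C by (intro mult_left_mono) (auto simp: boundary_layer_def)
    then show "\<bar>w t\<bar> \<le> C * boundary_layer \<kappa> (- \<beta> / 2) t" "\<bar>p t\<bar> \<le> C * boundary_layer \<kappa> (- \<beta> / 2) t"
      using lim0[of t] t by auto
  qed
  with C \<kappa> B ed lim0 err show ?thesis
    by (intro exI[of _ C] exI[of _ \<kappa>] exI[of _ B] exI[of _ w] exI[of _ p]) auto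
qed

end

section \<open>The phase\<close>

text \<open>F times exp of minus the indefinite integral of q has derivative 0. The imaginary part
  of the integral records the total change of the argument of a nonvanishing F, without a choice of
  branches along the path.\<close>

lemma exp_integral_representation:
  fixes F q :: "real \<Rightarrow> complex"
  assumes F: "continuous_on {0..1} F" and q: "continuous_on {0..1} q"
    and dF: "\<And>x. \<lbrakk>0 < x; x < 1\<rbrakk> \<Longrightarrow> (F has_vector_derivative q x * F x) (at x)"
  shows "F 1 = F 0 * exp (integral {0..1} q)"
proof -
  define E where "E x = integral {0..x} q" for x
  have contE: "continuous_on {0..1} E"
    unfolding E_def by (intro indefinite_integral_continuous_1 integrable_continuous_real q)
  have "((\<lambda>_. 0) has_integral (F 1 * exp (- E 1) - F 0 * exp (- E 0))) {0..1::real}"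
  proof (rule fundamental_theorem_of_calculus_interior[where f = "\<lambda>x. F x * exp (- E x)"])
    show "continuous_on {0..1} (\<lambda>x. F x * exp (- E x))" by (intro continuous_intros F contE)
    fix x :: real assume x: "x \<in> {0<..<1}"
    then have "(E has_vector_derivative q x) (at x)"
      using integral_has_vector_derivative[OF q, of x] at_within_Icc_at[of 0 x 1] by (simp add: E_def[abs_def])
    then have "((\<lambda>x. - E x) has_vector_derivative - q x) (at x)" by (rule has_vector_derivative_minus)
    from field_vector_diff_chain_at[OF this DERIV_exp]
    have "((\<lambda>x. exp (- E x)) has_vector_derivative - q x * exp (- E x)) (at x)" by (simp add: o_def)
    from has_vector_derivative_mult[OF dF this, of] x
    show "((\<lambda>x. F x * exp (- E x)) has_vector_derivative 0) (at x)" by (simp add: mult_ac)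
  qed simp
  then have "F 1 * exp (- E 1) - F 0 * exp (- E 0) = 0" using has_integral_0_eq by blast
  moreover have "E 0 = 0" by (simp add: E_def)
  ultimately have "F 1 * exp (- E 1) * exp (E 1) = F 0 * exp (E 1)" by simp
  then show ?thesis by (simp add: mult.assoc E_def flip: exp_add)
qed

context gelfand
begin

text \<open>The imaginary part has the sign of w1 - w2, and the linear equation becomes
  multiplication by -m/2 + i om.\<close>

definition spiral :: "(real \<Rightarrow> real) \<Rightarrow> (real \<Rightarrow> real) \<Rightarrow> (real \<Rightarrow> real) \<Rightarrow> (real \<Rightarrow> real) \<Rightarrow> real \<Rightarrow> complex" where
  "spiral w1 p1 w2 p2 t = Complex (shifted_velocity w1 p1 w2 p2 t) (om * (w1 t - w2 t))"

text \<open>The logarithmic derivative of \<open>spiral\<close> where that is nonzero; its imaginary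
  part is the angular velocity.\<close>

definition spiral_rate :: "(real \<Rightarrow> real) \<Rightarrow> (real \<Rightarrow> real) \<Rightarrow> (real \<Rightarrow> real) \<Rightarrow> (real \<Rightarrow> real) \<Rightarrow> real \<Rightarrow> complex" where
  "spiral_rate w1 p1 w2 p2 t =
    Complex (- m / 2) om - complex_of_real (2 * m * defect w1 w2 t) / spiral w1 p1 w2 p2 t"

lemma spiral_has_vector_derivative:
  assumes sol: "em_solution w1 p1" "em_solution w2 p2" and t: "t < 0" and nz: "spiral w1 p1 w2 p2 t \<noteq> 0"
  shows "(spiral w1 p1 w2 p2 has_vector_derivative spiral_rate w1 p1 w2 p2 t * spiral w1 p1 w2 p2 t) (at t)"
proof -
  have "spiral_rate w1 p1 w2 p2 t * spiral w1 p1 w2 p2 t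
      = Complex (- m / 2) om * spiral w1 p1 w2 p2 t - complex_of_real (2 * m * defect w1 w2 t)"
    using nz by (simp add: spiral_rate_def left_diff_distrib)
  also have "\<dots> = Complex (- (m / 2) * shifted_velocity w1 p1 w2 p2 t - om\<^sup>2 * (w1 t - w2 t) - 2 * m * defect w1 w2 t)
      (om * (shifted_velocity w1 p1 w2 p2 t - m / 2 * (w1 t - w2 t)))"
    by (simp add: spiral_def complex_eq_iff power2_eq_square algebra_simps diff_divide_distrib)
  finally have eq: "spiral_rate w1 p1 w2 p2 t * spiral w1 p1 w2 p2 t = \<dots>" .
  note d = difference_has_derivative[OF sol t]
  show ?thesis unfolding eq has_vector_derivative_complex_iff
    using d(2) DERIV_cmult[OF d(1), of om] by (simp add: spiral_def)
qed

lemma norm_spiral: "(norm (spiral w1 p1 w2 p2 t))\<^sup>2 = spiral_norm w1 p1 w2 p2 t"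
  by (simp add: spiral_def cmod_power2 spiral_norm_def power_mult_distrib)

lemma spiral_nonzero:
  assumes C: "0 \<le> C" and \<kappa>: "0 < \<kappa>" "\<kappa> \<le> 1"
    and 1: "em_decay C \<kappa> s w1 p1" and 2: "em_decay C \<kappa> s w2 p2"
    and ne: "w1 s \<noteq> w2 s" and t: "t \<in> {s..0}"
  shows "spiral w1 p1 w2 p2 t \<noteq> 0"
proof -
  have "0 < om\<^sup>2 * (w1 s - w2 s)\<^sup>2" using ne om_pos by simp
  then have "0 < spiral_norm w1 p1 w2 p2 s" unfolding spiral_norm_def
    using zero_le_power2[of "shifted_velocity w1 p1 w2 p2 s"] by linarith
  then have "0 < spiral_norm w1 p1 w2 p2 s * exp (- 2 * spiral_const C / \<kappa>) * exp (- m * (t - s))" by simp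
  also have "\<dots> \<le> spiral_norm w1 p1 w2 p2 t"
    using spiral_norm_bounds(2)[OF C \<kappa> 1 2] t by simp
  finally have "0 < (norm (spiral w1 p1 w2 p2 t))\<^sup>2" by (simp add: norm_spiral)
  then show ?thesis by auto
qed

text \<open>The defect is proportional to |w1 - w2|, which is at most the modulus of
  \<open>spiral\<close> divided by om, so the quotient stays bounded however small the spiral
  is.\<close>

lemma Im_spiral_rate_ge:
  assumes C: "0 \<le> C" and \<kappa>: "0 < \<kappa>" "\<kappa> \<le> 1"
    and 1: "em_decay C \<kappa> s w1 p1" and 2: "em_decay C \<kappa> s w2 p2" and t: "t \<in> {s..0}"
    and nz: "spiral w1 p1 w2 p2 t \<noteq> 0"
  shows "om - spiral_const C * boundary_layer \<kappa> s t \<le> Im (spiral_rate w1 p1 w2 p2 t)"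
proof -
  let ?f = "spiral w1 p1 w2 p2 t" and ?b = "boundary_layer \<kappa> s t"
  define K where "K = exp (2 * C) * (A1 + C)"
  have K: "0 \<le> K" using C A1_nonneg by (simp add: K_def)
  have b: "0 \<le> ?b" using boundary_layer_bounds[OF \<kappa>, of s t] t by auto
  have "\<bar>Im ?f\<bar> \<le> norm ?f" by (rule abs_Im_le_cmod)
  then have z: "om * \<bar>w1 t - w2 t\<bar> \<le> norm ?f" using om_pos by (simp add: spiral_def abs_mult)
  have "2 * m * \<bar>defect w1 w2 t\<bar> \<le> 2 * m * (K * ?b * \<bar>w1 t - w2 t\<bar>)"
    using defect_le[OF C \<kappa> 1 2 t] m_bounds by (intro mult_left_mono) (auto simp: K_def)
  also have "\<dots> = spiral_const C * ?b * (om * \<bar>w1 t - w2 t\<bar>)"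
    using om_pos by (simp add: spiral_const_def K_def)
  also have "\<dots> \<le> spiral_const C * ?b * norm ?f"
    using z b K m_bounds om_pos by (intro mult_left_mono) (auto simp: spiral_const_def K_def[symmetric])
  finally have "2 * m * \<bar>defect w1 w2 t\<bar> / norm ?f \<le> spiral_const C * ?b"
    using nz by (simp add: pos_divide_le_eq)
  moreover have "norm (complex_of_real (2 * m * defect w1 w2 t) / ?f) = 2 * m * \<bar>defect w1 w2 t\<bar> / norm ?f"
    using m_bounds by (simp add: norm_divide norm_mult abs_mult)
  ultimately have "\<bar>Im (complex_of_real (2 * m * defect w1 w2 t) / ?f)\<bar> \<le> spiral_const C * ?b"
    using abs_Im_le_cmod order_trans by metis
  moreover have "Im (spiral_rate w1 p1 w2 p2 t) = om - Im (complex_of_real (2 * m * defect w1 w2 t) / ?f)"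
    unfolding spiral_rate_def by (simp only: minus_complex.simps complex.sel)
  ultimately show ?thesis by linarith
qed

lemma spiral_continuous:
  assumes sol: "em_solution w1 p1" "em_solution w2 p2"
  shows "continuous_on {..0} (spiral w1 p1 w2 p2)"
proof -
  have "continuous_on {..0} (\<lambda>t. complex_of_real (shifted_velocity w1 p1 w2 p2 t) + \<i> * complex_of_real (om * (w1 t - w2 t)))"
    by (intro continuous_intros difference_continuous[OF sol])
  then show ?thesis by (simp add: spiral_def Complex_eq)
qed

text \<open>The substitution t = s (1 - x) carries [0,1] onto [s,0], with x = 1 at t = 0. On a fixed
  interval, dependence on s = -\<beta>/2 becomes dependence on a parameter of the integrand.\<close>

definition phase_density :: "(real \<Rightarrow> real) \<Rightarrow> (real \<Rightarrow> real) \<Rightarrow> (real \<Rightarrow> real) \<Rightarrow> (real \<Rightarrow> real) \<Rightarrow> real \<Rightarrow> real \<Rightarrow> complex" where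
  "phase_density w1 p1 w2 p2 s x = complex_of_real (- s) * spiral_rate w1 p1 w2 p2 (s * (1 - x))"

lemma spiral_representation:
  assumes C: "0 \<le> C" and \<kappa>: "0 < \<kappa>" "\<kappa> \<le> 1" and s: "s < 0"
    and 1: "em_decay C \<kappa> s w1 p1" and 2: "em_decay C \<kappa> s w2 p2" and ne: "w1 s \<noteq> w2 s"
  shows "spiral w1 p1 w2 p2 0 = spiral w1 p1 w2 p2 s * exp (integral {0..1} (phase_density w1 p1 w2 p2 s))"
    and "- s * om - 2 * spiral_const C / \<kappa> \<le> Im (integral {0..1} (phase_density w1 p1 w2 p2 s))"
proof -
  let ?q = "phase_density w1 p1 w2 p2 s" and ?f = "spiral w1 p1 w2 p2"
  have sol: "em_solution w1 p1" "em_solution w2 p2" using 1 2 by (auto simp: em_decay_def)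
  have time: "s * (1 - x) \<in> {s..0}" if "x \<in> {0..1}" for x
  proof -
    have "s * 1 \<le> s * (1 - x)" using s that by (intro mult_left_mono_neg) auto
    moreover have "s * (1 - x) \<le> 0" using s that by (simp add: mult_nonpos_nonneg)
    ultimately show ?thesis by simp
  qed
  then have sub: "(\<lambda>x. s * (1 - x)) ` {0..1} \<subseteq> {..0}" by auto
  have nz: "?f (s * (1 - x)) \<noteq> 0" if "x \<in> {0..1}" for x
    using spiral_nonzero[OF C \<kappa> 1 2 ne time[OF that]] .
  have wc: "continuous_on {..0} w1" "continuous_on {..0} w2" using sol by (auto simp: em_solution_def)
  have "continuous_on {..0} (\<lambda>t. defect w1 w2 t)"
    unfolding defect_def by (intro continuous_intros alpha_continuous wc)
  note dc = continuous_on_compose2[OF this _ sub] and fc = continuous_on_compose2[OF spiral_continuous[OF sol] _ sub]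
  have q: "continuous_on {0..1} ?q"
    unfolding phase_density_def spiral_rate_def by (intro continuous_intros dc fc) (use nz in auto)
  have "(\<lambda>x. ?f (s * (1 - x))) 1 = (\<lambda>x. ?f (s * (1 - x))) 0 * exp (integral {0..1} ?q)"
  proof (rule exp_integral_representation[OF _ q])
    show "continuous_on {0..1} (\<lambda>x. ?f (s * (1 - x)))" by (intro fc continuous_intros)
    fix x :: real assume x: "0 < x" "x < 1"
    then have t: "s * (1 - x) < 0" using s by (simp add: mult_neg_pos)
    have "((\<lambda>x. s * (1 - x)) has_vector_derivative - s) (at x)"
      unfolding has_real_derivative_iff_has_vector_derivative[symmetric]
      by (rule derivative_eq_intros refl | simp)+
    from vector_diff_chain_at[OF this spiral_has_vector_derivative[OF sol t nz]] x
    show "((\<lambda>x. ?f (s * (1 - x))) has_vector_derivative ?q x * ?f (s * (1 - x))) (at x)"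
      by (simp add: o_def phase_density_def scaleR_conv_of_real mult.assoc)
  qed
  then show "?f 0 = ?f s * exp (integral {0..1} ?q)" by simp
  \<comment> \<open>A lower bound for the imaginary part of the density, with explicit
    antiderivative G; the boundary layer costs at most 2 \<open>spiral_const\<close> / \<kappa> in
    total.\<close>
  define g where "g x = - s * (om - spiral_const C * boundary_layer \<kappa> s (s * (1 - x)))" for x
  define G where "G x = om * (s * (1 - x)) - spiral_const C * layer_int \<kappa> s (s * (1 - x))" for x
  have g: "(g has_integral (G 1 - G 0)) {0..1}"
  proof (rule fundamental_theorem_of_calculus[where f = G])
    fix x :: real
    have dt: "((\<lambda>x. s * (1 - x)) has_real_derivative - s) (at x within {0..1})"
      by (rule derivative_eq_intros refl | simp)+
    note dl = DERIV_chain2[where f = "layer_int \<kappa> s", OF layer_int_has_derivative[OF \<kappa>(1)] dt]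
    have "(G has_real_derivative om * - s - spiral_const C * (boundary_layer \<kappa> s (s * (1 - x)) * - s)) (at x within {0..1})"
      unfolding G_def by (intro DERIV_diff DERIV_cmult dt dl)
    then show "(G has_vector_derivative g x) (at x within {0..1})"
      by (simp add: has_real_derivative_iff_has_vector_derivative g_def algebra_simps)
  qed simp
  have K: "0 \<le> spiral_const C" using C A1_nonneg m_bounds om_pos by (simp add: spiral_const_def)
  have "spiral_const C * (layer_int \<kappa> s 0 - layer_int \<kappa> s s) \<le> spiral_const C * (2 / \<kappa>)"
    using layer_int_diff_le[OF \<kappa>(1), of s 0] s K by (intro mult_left_mono) auto
  then have "- s * om - 2 * spiral_const C / \<kappa> \<le> G 1 - G 0"
    by (simp add: G_def algebra_simps)
  also have "G 1 - G 0 = integral {0..1} g" using integral_unique[OF g] by simp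
  also have "\<dots> \<le> integral {0..1} (Im \<circ> ?q)"
  proof (rule integral_le)
    show "g integrable_on {0..1}" using g by blast
    show "(Im \<circ> ?q) integrable_on {0..1}"
      by (intro integrable_linear integrable_continuous_real q bounded_linear_Im)
    fix x :: real assume x: "x \<in> {0..1}"
    have "- s * (om - spiral_const C * boundary_layer \<kappa> s (s * (1 - x))) \<le> - s * Im (spiral_rate w1 p1 w2 p2 (s * (1 - x)))"
      by (rule mult_left_mono[OF Im_spiral_rate_ge[OF C \<kappa> 1 2 time[OF x] nz[OF x]]]) (use s in simp)
    then show "g x \<le> (Im \<circ> ?q) x" by (simp add: g_def phase_density_def)
  qed
  also have "\<dots> = Im (integral {0..1} ?q)"
    by (rule integral_linear[OF integrable_continuous_real[OF q] bounded_linear_Im])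
  finally show "- s * om - 2 * spiral_const C / \<kappa> \<le> Im (integral {0..1} ?q)" .
qed

section \<open>Continuity in the parameter and winding of the phase\<close>

lemma continuous_W_joint: "continuous_on (UNIV \<times> {..0}) (\<lambda>(\<beta>, t). W \<beta> t)"
  and continuous_Wd_joint: "continuous_on (UNIV \<times> {..0}) (\<lambda>(\<beta>, t). Wd \<beta> t)"
proof -
  have 1: "continuous_on (UNIV \<times> {..0::real}) (\<lambda>q :: real \<times> real. (fst q, exp (snd q)))"
    by (intro continuous_intros)
  have 2: "(\<lambda>q :: real \<times> real. (fst q, exp (snd q))) ` (UNIV \<times> {..0}) \<subseteq> UNIV \<times> {0..1}" by auto
  note v = continuous_on_compose2[OF continuous_radial_v_joint 1 2, simplified]
    and f = continuous_on_compose2[OF continuous_flux_joint 1 2, simplified]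
  show "continuous_on (UNIV \<times> {..0}) (\<lambda>(\<beta>, t). W \<beta> t)"
    unfolding W_def case_prod_beta by (intro continuous_intros v)
  show "continuous_on (UNIV \<times> {..0}) (\<lambda>(\<beta>, t). Wd \<beta> t)"
    unfolding Wd_def case_prod_beta by (intro continuous_intros f)
qed

lemma oscillation:
  assumes C: "0 \<le> C" and \<kappa>: "0 < \<kappa>" "\<kappa> \<le> 1"
    and dec: "\<And>\<beta>. 0 \<le> \<beta> \<Longrightarrow> em_decay C \<kappa> (- \<beta> / 2) (W \<beta>) (Wd \<beta>) \<and> em_decay C \<kappa> (- \<beta> / 2) w p"
    and w: "\<And>t. t \<le> 0 \<Longrightarrow> \<bar>w t\<bar> \<le> C * exp (\<kappa> * t)"
  shows "\<exists>\<beta>>b. \<exists>\<beta>'>b. W \<beta> 0 < w 0 \<and> w 0 < W \<beta>' 0"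
proof -
  \<comment> \<open>From here on C exp (-\<kappa> \<beta>/2) < ln 2 \<le> ln (2m), so the singular
    solution lies above -ln (2m) at -\<beta>/2. The summand 1 keeps the starting time
    negative.\<close>
  define \<beta>0 where "\<beta>0 = 1 + 2 * C / (\<kappa> * ln 2)"
  have \<beta>0: "1 \<le> \<beta>0" using C \<kappa> by (simp add: \<beta>0_def)
  have neg: "W \<beta> (- \<beta> / 2) < w (- \<beta> / 2)" if \<beta>: "\<beta>0 \<le> \<beta>" for \<beta>
  proof -
    have "C / ln 2 = \<kappa> * (2 * C / (\<kappa> * ln 2)) / 2" using \<kappa> by simp
    also have "\<dots> < \<kappa> * \<beta> / 2"
      using \<beta> \<kappa> by (intro divide_strict_right_mono mult_strict_left_mono) (auto simp: \<beta>0_def)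
    also have "\<dots> < exp (\<kappa> * \<beta> / 2)" using exp_ge_add_one_self[of "\<kappa> * \<beta> / 2"] by linarith
    finally have "C < ln 2 * exp (\<kappa> * \<beta> / 2)" by (simp add: field_simps)
    then have "C * exp (\<kappa> * (- \<beta> / 2)) < ln 2" by (simp add: exp_minus field_simps)
    moreover have "ln 2 \<le> ln (2 * m)" using m_bounds by simp
    ultimately show ?thesis using w[of "- \<beta> / 2"] W_initial(1)[of \<beta>] \<beta> \<beta>0 by auto
  qed
  define F where "F \<beta> = spiral (W \<beta>) (Wd \<beta>) w p" for \<beta>
  define L where "L \<beta> = integral {0..1} (phase_density (W \<beta>) (Wd \<beta>) w p (- \<beta> / 2))" for \<beta>
  \<comment> \<open>A lift of the argument of F \<beta> at t = 0. It is continuous in \<beta>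
    because the starting points lie in the open lower half plane, away from the cut of
    \<open>Ln\<close>.\<close>
  define \<Theta> where "\<Theta> \<beta> = Im (Ln (F \<beta> (- \<beta> / 2)) + L \<beta>)" for \<beta>
  have Imneg: "Im (F \<beta> (- \<beta> / 2)) < 0" if "\<beta>0 \<le> \<beta>" for \<beta>
    using neg[OF that] om_pos by (simp add: F_def spiral_def mult_pos_neg)
  have rep: "F \<beta> 0 = exp (Ln (F \<beta> (- \<beta> / 2)) + L \<beta>)"
    and ge: "\<beta> / 2 * om - 2 * spiral_const C / \<kappa> \<le> Im (L \<beta>)" if \<beta>: "\<beta>0 \<le> \<beta>" for \<beta>
  proof -
    have s: "- \<beta> / 2 < 0" and b: "0 \<le> \<beta>" using \<beta> \<beta>0 by auto
    have ne: "W \<beta> (- \<beta> / 2) \<noteq> w (- \<beta> / 2)" using neg[OF \<beta>] by simp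
    note r = spiral_representation[OF C \<kappa> s conjunct1[OF dec[OF b]] conjunct2[OF dec[OF b]] ne]
    have "F \<beta> (- \<beta> / 2) \<noteq> 0" using Imneg[OF \<beta>] by auto
    then show "F \<beta> 0 = exp (Ln (F \<beta> (- \<beta> / 2)) + L \<beta>)" using r(1) by (simp add: F_def L_def exp_add)
    show "\<beta> / 2 * om - 2 * spiral_const C / \<kappa> \<le> Im (L \<beta>)" using r(2) by (simp add: L_def)
  qed
  have \<Theta>_ge: "- pi + (\<beta> / 2 * om - 2 * spiral_const C / \<kappa>) \<le> \<Theta> \<beta>" if \<beta>: "\<beta>0 \<le> \<beta>" for \<beta>
  proof -
    have "F \<beta> (- \<beta> / 2) \<noteq> 0" using Imneg[OF \<beta>] by auto
    then have "- pi < Im (Ln (F \<beta> (- \<beta> / 2)))" by (rule mpi_less_Im_Ln)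
    then show ?thesis using ge[OF \<beta>] by (simp add: \<Theta>_def)
  qed
  have cont\<Theta>: "continuous_on {\<beta>0..} \<Theta>"
  proof -
    let ?S = "{\<beta>0..} \<times> cbox 0 (1 :: real)"
    have sol: "em_solution w p" using dec[of 0] by (simp add: em_decay_def)
    have wc: "continuous_on {..0} w" "continuous_on {..0} p" using sol by (auto simp: em_solution_def)
    have time: "- \<beta> / 2 * (1 - x) \<in> {- \<beta> / 2..0}" if "\<beta>0 \<le> \<beta>" "x \<in> {0..1}" for \<beta> x :: real
    proof -
      have "- \<beta> / 2 * 1 \<le> - \<beta> / 2 * (1 - x)" using that \<beta>0 by (intro mult_left_mono_neg) auto
      moreover have "- \<beta> / 2 * (1 - x) \<le> 0" using that \<beta>0 by (intro mult_nonpos_nonneg) auto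
      ultimately show ?thesis by simp
    qed
    define T where "T q = - fst q / 2 * (1 - snd q)" for q :: "real \<times> real"
    have T: "continuous_on ?S T" unfolding T_def by (intro continuous_intros) auto
    have Tsub: "T ` ?S \<subseteq> {..0}" using time by (force simp: T_def)
    have P: "continuous_on ?S (\<lambda>q. (fst q, T q))" by (intro continuous_intros T)
    have Psub: "(\<lambda>q. (fst q, T q)) ` ?S \<subseteq> UNIV \<times> {..0}" using Tsub by auto
    note Wc = continuous_on_compose2[OF continuous_W_joint P Psub, unfolded case_prod_beta fst_conv snd_conv]
      and Wdc = continuous_on_compose2[OF continuous_Wd_joint P Psub, unfolded case_prod_beta fst_conv snd_conv]
      and wc' = continuous_on_compose2[OF wc(1) T Tsub] and pc' = continuous_on_compose2[OF wc(2) T Tsub]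
      and ac' = continuous_on_compose2[OF alpha_continuous T Tsub]
    have nz: "spiral (W (fst q)) (Wd (fst q)) w p (T q) \<noteq> 0" if q: "q \<in> ?S" for q
    proof -
      have b: "\<beta>0 \<le> fst q" "0 \<le> fst q" "snd q \<in> {0..1}" using q \<beta>0 by auto
      have "W (fst q) (- fst q / 2) \<noteq> w (- fst q / 2)" using neg[OF b(1)] by simp
      then show ?thesis
        using spiral_nonzero[OF C \<kappa> conjunct1[OF dec[OF b(2)]] conjunct2[OF dec[OF b(2)]] _ time[OF b(1,3)]]
        by (simp add: T_def)
    qed
    have dc: "continuous_on ?S (\<lambda>q. defect (W (fst q)) w (T q))"
      unfolding defect_def using Wc wc' ac' by (intro continuous_intros) auto
    have "continuous_on ?S (\<lambda>q. complex_of_real (shifted_velocity (W (fst q)) (Wd (fst q)) w p (T q))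
        + \<i> * complex_of_real (om * (W (fst q) (T q) - w (T q))))"
      unfolding shifted_velocity_def using Wc Wdc wc' pc' by (intro continuous_intros) auto
    then have sc: "continuous_on ?S (\<lambda>q. spiral (W (fst q)) (Wd (fst q)) w p (T q))"
      by (simp add: spiral_def Complex_eq)
    have "continuous_on ?S (\<lambda>q. complex_of_real (fst q / 2) * (Complex (- m / 2) om
        - complex_of_real (2 * m * defect (W (fst q)) w (T q)) / spiral (W (fst q)) (Wd (fst q)) w p (T q)))"
      by (intro continuous_intros dc sc ballI nz) auto
    then have "continuous_on ?S (\<lambda>(\<beta>, x). phase_density (W \<beta>) (Wd \<beta>) w p (- \<beta> / 2) x)"
      by (simp add: phase_density_def spiral_rate_def case_prod_beta T_def)
    from integral_continuous_on_param[OF this] have Lc: "continuous_on {\<beta>0..} L"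
      by (simp add: L_def[abs_def])
    have "continuous_on {\<beta>0..} (\<lambda>\<beta>. (\<lambda>q. spiral (W (fst q)) (Wd (fst q)) w p (T q)) (\<beta>, 0))"
      by (rule continuous_on_compose2[OF sc]) (auto intro!: continuous_intros)
    then have Fc: "continuous_on {\<beta>0..} (\<lambda>\<beta>. F \<beta> (- \<beta> / 2))" by (simp add: T_def F_def)
    have "F \<beta> (- \<beta> / 2) \<notin> \<real>\<^sub>\<le>\<^sub>0" if "\<beta> \<in> {\<beta>0..}" for \<beta>
      using Imneg[of \<beta>] that by (auto simp: complex_nonpos_Reals_iff)
    then show ?thesis unfolding \<Theta>_def by (intro continuous_intros Lc Fc) auto
  qed
  have sgn: "\<exists>r>0. om * (W \<beta> 0 - w 0) = r * sin (\<Theta> \<beta>)" if \<beta>: "\<beta>0 \<le> \<beta>" for \<beta>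
  proof -
    have "om * (W \<beta> 0 - w 0) = Im (F \<beta> 0)" by (simp add: F_def spiral_def)
    also have "\<dots> = exp (Re (Ln (F \<beta> (- \<beta> / 2)) + L \<beta>)) * sin (\<Theta> \<beta>)"
      unfolding rep[OF \<beta>] \<Theta>_def by (rule Im_exp)
    finally show ?thesis using exp_gt_zero by blast
  qed
  \<comment> \<open>\<Theta> is continuous and tends to infinity, so it attains every value above
    \<Theta> b1, among them some \<theta> + 2 k pi. The choices \<theta> = -pi/2 and \<theta> = pi/2
    produce the two signs.\<close>
  have hit: "\<exists>\<beta>>b. \<beta>0 \<le> \<beta> \<and> sin (\<Theta> \<beta>) = sin \<theta>" for \<theta>
  proof -
    define b1 where "b1 = max \<beta>0 (b + 1)"
    obtain k :: nat where k: "(\<Theta> b1 - \<theta>) / (2 * pi) \<le> real k" using real_arch_simple by blast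
    define y where "y = \<theta> + 2 * real k * pi"
    have y: "\<Theta> b1 \<le> y" using k by (simp add: y_def field_simps)
    \<comment> \<open>The second argument of the maximum is where the lower bound
      \<open>\<Theta>_ge\<close> reaches y.\<close>
    define b2 where "b2 = max b1 (2 / om * (y + pi + 2 * spiral_const C / \<kappa>))"
    have "2 / om * (y + pi + 2 * spiral_const C / \<kappa>) \<le> b2" by (simp add: b2_def)
    then have "y + pi + 2 * spiral_const C / \<kappa> \<le> b2 / 2 * om" using om_pos by (simp add: field_simps)
    moreover have "\<beta>0 \<le> b2" by (simp add: b2_def b1_def)
    ultimately have "y \<le> \<Theta> b2" using \<Theta>_ge[of b2] by linarith
    moreover have "continuous_on {b1..b2} \<Theta>"
      by (rule continuous_on_subset[OF cont\<Theta>]) (auto simp: b1_def)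
    ultimately obtain \<beta> where "b1 \<le> \<beta>" "\<Theta> \<beta> = y"
      using IVT'[of \<Theta> b1 y b2] y by (auto simp: b2_def)
    moreover have "sin y = sin \<theta>"
      unfolding y_def sin_add sin_2npi cos_2npi by simp
    ultimately show ?thesis by (intro exI[of _ \<beta>]) (auto simp: b1_def)
  qed
  obtain \<beta> where \<beta>: "b < \<beta>" "\<beta>0 \<le> \<beta>" "sin (\<Theta> \<beta>) = sin (- (pi / 2))" using hit[of "- (pi / 2)"] by blast
  obtain \<beta>' where \<beta>': "b < \<beta>'" "\<beta>0 \<le> \<beta>'" "sin (\<Theta> \<beta>') = sin (pi / 2)" using hit[of "pi / 2"] by blast
  have "om * (W \<beta> 0 - w 0) < 0" using sgn[OF \<beta>(2)] \<beta>(3) by auto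
  moreover have "0 < om * (W \<beta>' 0 - w 0)" using sgn[OF \<beta>'(2)] \<beta>'(3) by auto
  ultimately have "W \<beta> 0 < w 0" "w 0 < W \<beta>' 0"
    using om_pos by (simp_all add: mult_less_0_iff zero_less_mult_iff)
  with \<beta> \<beta>' show ?thesis by blast
qed

end

section \<open>The bifurcation curve\<close>

context gelfand
begin

lemma bif_lambda_eq: "bif_lambda N a \<beta> = 2 * m * exp (W \<beta> 0)"
proof -
  have "exp (radial_v N a \<beta> 1) = exp (W \<beta> 0 + ln (2 * m))" by (simp add: W_def)
  also have "\<dots> = 2 * m * exp (W \<beta> 0)" using m_bounds by (simp add: exp_add)
  finally show ?thesis by (simp add: bif_lambda_def)
qed

lemma continuous_bif_lambda: "continuous_on S (bif_lambda N a)"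
proof -
  have "continuous_on S (\<lambda>\<beta>. radial_v N a \<beta> 1)"
    using continuous_on_compose2[OF continuous_radial_v_joint, of S "\<lambda>\<beta>. (\<beta>, 1)"]
    by (simp add: continuous_on_Pair image_subset_iff)
  then show ?thesis unfolding bif_lambda_def by (intro continuous_intros)
qed

lemma bif_lambda_oscillates:
  "\<exists>L>0. (bif_lambda N a \<longlongrightarrow> L) at_top \<and>
    (\<forall>b. \<exists>\<beta>>b. \<exists>\<beta>'>b. bif_lambda N a \<beta> < L \<and> L < bif_lambda N a \<beta>')"
proof -
  obtain C \<kappa> B w p where C: "0 \<le> C" and \<kappa>: "0 < \<kappa>" "\<kappa> \<le> 1" and B: "0 \<le> B"
    and dec: "\<And>\<beta>. 0 \<le> \<beta> \<Longrightarrow> em_decay C \<kappa> (- \<beta> / 2) (W \<beta>) (Wd \<beta>) \<and> em_decay C \<kappa> (- \<beta> / 2) w p"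
    and w: "\<And>t. t \<le> 0 \<Longrightarrow> \<bar>w t\<bar> \<le> C * exp (\<kappa> * t)"
    and conv: "\<And>\<beta> t. 0 \<le> \<beta> \<Longrightarrow> t \<in> {- \<beta> / 2..0} \<Longrightarrow> \<bar>W \<beta> t - w t\<bar> \<le> B * exp (- (t + \<beta> / 2) / 2)"
    using singular_solution by metis
  have "filterlim (\<lambda>\<beta>::real. - \<beta> / 4) at_bot at_top"
    unfolding filterlim_at_bot_dense
  proof
    fix Z :: real
    show "\<forall>\<^sub>F \<beta> in at_top. - \<beta> / 4 < Z"
      using eventually_gt_at_top[of "- 4 * Z"] by eventually_elim simp
  qed
  then have "((\<lambda>\<beta>::real. exp (- \<beta> / 4)) \<longlongrightarrow> 0) at_top"
    by (rule filterlim_compose[OF exp_at_bot])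
  then have lim0: "((\<lambda>\<beta>. B * exp (- \<beta> / 4)) \<longlongrightarrow> 0) at_top" by (rule tendsto_mult_right_zero)
  have "((\<lambda>\<beta>. W \<beta> 0 - w 0) \<longlongrightarrow> 0) at_top"
  proof (rule Lim_null_comparison[OF _ lim0])
    show "\<forall>\<^sub>F \<beta> in at_top. norm (W \<beta> 0 - w 0) \<le> B * exp (- \<beta> / 4)"
      using eventually_ge_at_top[of 0] by eventually_elim (use conv[of _ 0] in simp)
  qed
  then have "((\<lambda>\<beta>. W \<beta> 0) \<longlongrightarrow> w 0) at_top" by (simp add: LIM_zero_iff)
  then have "((\<lambda>\<beta>. 2 * m * exp (W \<beta> 0)) \<longlongrightarrow> 2 * m * exp (w 0)) at_top" by (intro tendsto_intros)
  then have "(bif_lambda N a \<longlongrightarrow> 2 * m * exp (w 0)) at_top" by (simp add: bif_lambda_eq[abs_def])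
  moreover have "\<exists>\<beta>>b. \<exists>\<beta>'>b. bif_lambda N a \<beta> < 2 * m * exp (w 0) \<and> 2 * m * exp (w 0) < bif_lambda N a \<beta>'" for b
    using oscillation[OF C \<kappa> dec w, of b] m_bounds by (simp add: bif_lambda_eq)
  ultimately show ?thesis using m_bounds by (intro exI[of _ "2 * m * exp (w 0)"]) auto
qed

end

text \<open>Take x < y < z beyond b with values below, above and below L. The maximum over [x,z]
  exceeds L, so it is attained in the interior.\<close>

lemma oscillating_imp_unbounded_extrema:
  fixes f :: "real \<Rightarrow> real"
  assumes cont: "\<And>S. continuous_on S f"
    and osc: "\<And>b. \<exists>\<beta>>b. \<exists>\<beta>'>b. f \<beta> < L \<and> L < f \<beta>'"
  shows "\<exists>\<beta>>b. local_extremum_at f \<beta>"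
proof -
  obtain x where x: "b < x" "f x < L" using osc by blast
  obtain y where y: "x < y" "L < f y" using osc by blast
  obtain z where z: "y < z" "f z < L" using osc by blast
  have "\<exists>\<beta>\<in>{x..z}. \<forall>\<gamma>\<in>{x..z}. f \<gamma> \<le> f \<beta>"
    by (rule continuous_attains_sup[OF compact_Icc _ cont]) (use y z in simp)
  then obtain \<beta> where \<beta>: "\<beta> \<in> {x..z}" "\<And>\<gamma>. \<gamma> \<in> {x..z} \<Longrightarrow> f \<gamma> \<le> f \<beta>" by blast
  have "L < f \<beta>" using \<beta>(2)[of y] y z by auto
  then have "\<beta> \<noteq> x" "\<beta> \<noteq> z" using x z by auto
  then have "\<beta> \<in> {x<..<z}" using \<beta>(1) by auto
  then have "\<forall>\<^sub>F \<gamma> in nhds \<beta>. \<gamma> \<in> {x<..<z}" by (intro eventually_nhds_in_open) auto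
  then have "\<forall>\<^sub>F \<gamma> in nhds \<beta>. f \<gamma> \<le> f \<beta>" by eventually_elim (use \<beta>(2) in auto)
  then show ?thesis using x \<open>\<beta> \<in> {x<..<z}\<close> unfolding local_extremum_at_def by (intro exI[of _ \<beta>]) auto
qed

text \<open>The parameter is recovered as \<beta> = \<alpha> + ln \<lambda>; infinitely many
  extremal parameters therefore give infinitely many points of the curve.\<close>

lemma inj_bif_point: "inj (bif_point N a)"
  by (rule injI) (auto simp: bif_point_def bif_alpha_def)

lemma (in gelfand) bifurcation_type_I: "type_I N a"
proof -
  obtain L where L: "0 < L" "(bif_lambda N a \<longlongrightarrow> L) at_top"
    and osc: "\<And>b. \<exists>\<beta>>b. \<exists>\<beta>'>b. bif_lambda N a \<beta> < L \<and> L < bif_lambda N a \<beta>'"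
    using bif_lambda_oscillates by blast
  have "\<not> bdd_above {\<beta>. local_extremum_at (bif_lambda N a) \<beta>}"
    using oscillating_imp_unbounded_extrema[OF continuous_bif_lambda osc]
    by (auto simp: bdd_above_def not_le)
  then have "infinite {\<beta>. local_extremum_at (bif_lambda N a) \<beta>}" by (rule contrapos_nn) (rule bdd_above_finite)
  moreover have "turning_points N a = bif_point N a ` {\<beta>. local_extremum_at (bif_lambda N a) \<beta>}"
    by (auto simp: turning_points_def)
  ultimately have "infinite (turning_points N a)"
    using finite_imageD[OF _ inj_on_subset[OF inj_bif_point subset_UNIV]] by metis
  with L osc show ?thesis unfolding type_I_def by blast
qed

text \<open>Along a ray the profile is the function itself, and its derivative is the radial
  component of the gradient. The gradient extends continuously to the closed ball, hence is
  bounded.\<close>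

lemma C2_on_closure_radial_profile:
  fixes a :: "real \<Rightarrow> real"
  assumes "C2_on_closure (\<lambda>x :: real ^ 'n. a (norm x)) (ball 0 1)"
  shows "continuous_on {0..1} a"
    and "\<exists>a' A1. \<forall>r. 0 < r \<longrightarrow> r < 1 \<longrightarrow> (a has_real_derivative a' r) (at r) \<and> \<bar>a' r\<bar> \<le> A1"
proof -
  obtain g :: "real ^ 'n \<Rightarrow> real ^ 'n" where f: "continuous_on (cball 0 1) (\<lambda>x :: real ^ 'n. a (norm x))"
    and g: "continuous_on (cball 0 1) g"
    and df: "\<And>x :: real ^ 'n. x \<in> ball 0 1 \<Longrightarrow> ((\<lambda>x. a (norm x)) has_derivative (\<lambda>h. g x \<bullet> h)) (at x)"
    using assms unfolding C2_on_closure_def by (auto simp del: mem_ball)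
  \<comment> \<open>Any unit vector would do; \<open>undefined\<close> picks an arbitrary coordinate
    of the unspecified index type.\<close>
  define e :: "real ^ 'n" where "e = axis undefined 1"
  have e: "norm e = 1" by (simp add: e_def)
  have "continuous_on {0..1} (\<lambda>r. a (norm (r *\<^sub>R e)))"
    by (rule continuous_on_compose2[OF f]) (auto intro!: continuous_intros simp: e)
  then show "continuous_on {0..1} a" by (rule continuous_on_eq) (simp add: e)
  have "compact (g ` cball 0 1)" by (rule compact_continuous_image[OF g compact_cball])
  then obtain A1 where A1: "\<And>x. x \<in> cball 0 1 \<Longrightarrow> norm (g x) \<le> A1"
    using compact_imp_bounded[of "g ` cball 0 1"] unfolding bounded_iff by blast
  have "(a has_real_derivative g (r *\<^sub>R e) \<bullet> e) (at r) \<and> \<bar>g (r *\<^sub>R e) \<bullet> e\<bar> \<le> A1" if r: "0 < r" "r < 1" for r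
  proof
    have "((\<lambda>r. r *\<^sub>R e) has_derivative (\<lambda>h. h *\<^sub>R e)) (at r)" by (auto intro!: derivative_eq_intros)
    moreover have "r *\<^sub>R e \<in> ball 0 1" using r by (simp add: e)
    ultimately have "((\<lambda>r. a (norm (r *\<^sub>R e))) has_derivative (\<lambda>h. g (r *\<^sub>R e) \<bullet> (h *\<^sub>R e))) (at r)"
      using has_derivative_compose[OF _ df] by blast
    then have "((\<lambda>r. a (norm (r *\<^sub>R e))) has_real_derivative g (r *\<^sub>R e) \<bullet> e) (at r)"
      by (simp add: has_field_derivative_def mult_commute_abs)
    then show "(a has_real_derivative g (r *\<^sub>R e) \<bullet> e) (at r)"
      by (rule has_field_derivative_transform_within_open[where S = "{0<..<1}"]) (use r in \<open>auto simp: e\<close>)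
    have "\<bar>g (r *\<^sub>R e) \<bullet> e\<bar> \<le> norm (g (r *\<^sub>R e)) * norm e" by (rule Cauchy_Schwarz_ineq2)
    also have "\<dots> \<le> A1" using A1[of "r *\<^sub>R e"] r by (simp add: e)
    finally show "\<bar>g (r *\<^sub>R e) \<bullet> e\<bar> \<le> A1" .
  qed
  then show "\<exists>a' A1. \<forall>r. 0 < r \<longrightarrow> r < 1 \<longrightarrow> (a has_real_derivative a' r) (at r) \<and> \<bar>a' r\<bar> \<le> A1"
    by (intro exI[of _ "\<lambda>r. g (r *\<^sub>R e) \<bullet> e"] exI[of _ A1]) simp
qed

theorem theorem1p3:
  fixes a :: "real \<Rightarrow> real"
  assumes "3 \<le> CARD('n::finite)" and "CARD('n) \<le> 9"
    and "C2_on_closure (\<lambda>x :: real ^ 'n. a (norm x)) (ball 0 1)"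
    and "\<And>r. r \<in> {0..1} \<Longrightarrow> a r > 0"
    and "a 0 = 1"
  shows "type_I CARD('n) a"
proof -
  note cont = C2_on_closure_radial_profile(1)[OF assms(3)]
  obtain a' A1 where a': "\<And>r. 0 < r \<Longrightarrow> r < 1 \<Longrightarrow> (a has_real_derivative a' r) (at r) \<and> \<bar>a' r\<bar> \<le> A1"
    using C2_on_closure_radial_profile(2)[OF assms(3)] by blast
  have "\<exists>x\<in>{0..1}. \<forall>y\<in>{0..1}. a x \<le> a y"
    by (rule continuous_attains_inf[OF compact_Icc _ cont]) simp
  then obtain r0 where r0: "r0 \<in> {0..1}" "\<And>r. r \<in> {0..1} \<Longrightarrow> a r0 \<le> a r" by blast
  have "\<exists>x\<in>{0..1}. \<forall>y\<in>{0..1}. a y \<le> a x"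
    by (rule continuous_attains_sup[OF compact_Icc _ cont]) simp
  then obtain r1 where r1: "r1 \<in> {0..1}" "\<And>r. r \<in> {0..1} \<Longrightarrow> a r \<le> a r1" by blast
  interpret gelfand "CARD('n)" a a' "a r1" "a r0" A1
    using assms a' r0 r1 cont by unfold_locales auto
  show ?thesis by (rule bifurcation_type_I)
qed

end
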